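(* Let $p$ be a prime. Let $\Gamma=\Gamma_1*_A\Gamma_2$ be an amalgamated free product of finitely generated groups $\Gamma_1,\Gamma_2$ over a common subgroup $A$, and suppose that $\Gamma$ is finitely generated and residually-$p$ and that $A$ is amenable. Let $\{H_n\}$ be a lattice of normal subgroups of $p$-power index in $\Gamma$ such that $\bigcap H_n=1$. Then $$RG_p(\Gamma,\{H_n\}) = RG_p(\Gamma_1,\{\Gamma_1\cap H_n\}) + RG_p(\Gamma_2,\{\Gamma_2\cap H_n\})+\frac{1}{|A|}.$$ In particular, $RG_p(\Gamma)\ge RG_p(\Gamma_1)+RG_p(\Gamma_2)+\frac{1}{|A|}$.
   Context: For a group $H$ and a prime $p$, $d_p(H)=d\left(H/[H,H]H^p\right)$, where $d$ denotes the minimal number of generators; equivalently $d_p(H)$ is the dimension of $H/[H,H]H^p$ over $\mathbb{F}_p$. A set of subgroups $\{H_n\}$ of a group is called a lattice if it is closed under finite intersections. The $p$-gradient of a finitely generated group $G$ relative to a lattice $\{H_n\}$ of normal subgroups of $p$-power index is $$RG_p(G,\{H_n\})=\inf_n\frac{d_p(H_n)-1}{[G:H_n]}.$$ The absolute $p$-gradient $RG_p(G)$ is the infimum of $\frac{d_p(H)-1}{[G:H]}$ over all normal subgroups $H$ of $p$-power index in $G$. A group is residually-$p$ if its normal subgroups of $p$-power index have trivial intersection. Convention: $\frac{1}{|A|}=0$ if $A$ is infinite. *)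

theory Defs
  imports
    "HOL-Algebra.Generated_Groups"
    "HOL-Algebra.Coset"
    "HOL-Computational_Algebra.Primes"
    Complex_Main
begin

section \<open>Amalgamated free products\<close>

text \<open>
  For groups \<open>G1\<close>, \<open>G2\<close>, \<open>A\<close> and embeddings \<open>i1 : A \<rightarrow> G1\<close>, \<open>i2 : A \<rightarrow> G2\<close>, the amalgamated free
  product is constructed from words whose letters are tagged elements of \<open>G1\<close> and \<open>G2\<close>, modulo the
  congruence generated by multiplying adjacent letters from the same factor, deleting identity
  letters, and identifying the two copies of every element of \<open>A\<close>.
\<close>

inductive amalgam_eq ::
  "('a, 'm) monoid_scheme \<Rightarrow> ('b, 'n) monoid_scheme \<Rightarrow> ('c, 'k) monoid_scheme \<Rightarrow>
    ('c \<Rightarrow> 'a) \<Rightarrow> ('c \<Rightarrow> 'b) \<Rightarrow> ('a + 'b) list \<Rightarrow> ('a + 'b) list \<Rightarrow> bool"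
  for G1 G2 A i1 i2
where
  refl: "w \<in> lists (carrier G1 <+> carrier G2) \<Longrightarrow> amalgam_eq G1 G2 A i1 i2 w w"
| sym: "amalgam_eq G1 G2 A i1 i2 v w \<Longrightarrow> amalgam_eq G1 G2 A i1 i2 w v"
| trans: "amalgam_eq G1 G2 A i1 i2 u v \<Longrightarrow> amalgam_eq G1 G2 A i1 i2 v w \<Longrightarrow>
    amalgam_eq G1 G2 A i1 i2 u w"
| mult1: "u \<in> lists (carrier G1 <+> carrier G2) \<Longrightarrow> v \<in> lists (carrier G1 <+> carrier G2) \<Longrightarrow>
    x \<in> carrier G1 \<Longrightarrow> y \<in> carrier G1 \<Longrightarrow>
    amalgam_eq G1 G2 A i1 i2 (u @ [Inl x, Inl y] @ v) (u @ [Inl (x \<otimes>\<^bsub>G1\<^esub> y)] @ v)"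
| mult2: "u \<in> lists (carrier G1 <+> carrier G2) \<Longrightarrow> v \<in> lists (carrier G1 <+> carrier G2) \<Longrightarrow>
    x \<in> carrier G2 \<Longrightarrow> y \<in> carrier G2 \<Longrightarrow>
    amalgam_eq G1 G2 A i1 i2 (u @ [Inr x, Inr y] @ v) (u @ [Inr (x \<otimes>\<^bsub>G2\<^esub> y)] @ v)"
| one1: "u \<in> lists (carrier G1 <+> carrier G2) \<Longrightarrow> v \<in> lists (carrier G1 <+> carrier G2) \<Longrightarrow>
    amalgam_eq G1 G2 A i1 i2 (u @ [Inl \<one>\<^bsub>G1\<^esub>] @ v) (u @ v)"
| one2: "u \<in> lists (carrier G1 <+> carrier G2) \<Longrightarrow> v \<in> lists (carrier G1 <+> carrier G2) \<Longrightarrow>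
    amalgam_eq G1 G2 A i1 i2 (u @ [Inr \<one>\<^bsub>G2\<^esub>] @ v) (u @ v)"
| glue: "u \<in> lists (carrier G1 <+> carrier G2) \<Longrightarrow> v \<in> lists (carrier G1 <+> carrier G2) \<Longrightarrow>
    a \<in> carrier A \<Longrightarrow>
    amalgam_eq G1 G2 A i1 i2 (u @ [Inl (i1 a)] @ v) (u @ [Inr (i2 a)] @ v)"

definition amalgam_class ::
  "('a, 'm) monoid_scheme \<Rightarrow> ('b, 'n) monoid_scheme \<Rightarrow> ('c, 'k) monoid_scheme \<Rightarrow>
    ('c \<Rightarrow> 'a) \<Rightarrow> ('c \<Rightarrow> 'b) \<Rightarrow> ('a + 'b) list \<Rightarrow> ('a + 'b) list set"
where
  "amalgam_class G1 G2 A i1 i2 w = {v. amalgam_eq G1 G2 A i1 i2 w v}"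

definition amalgam ::
  "('a, 'm) monoid_scheme \<Rightarrow> ('b, 'n) monoid_scheme \<Rightarrow> ('c, 'k) monoid_scheme \<Rightarrow>
    ('c \<Rightarrow> 'a) \<Rightarrow> ('c \<Rightarrow> 'b) \<Rightarrow> ('a + 'b) list set monoid"
where
  "amalgam G1 G2 A i1 i2 =
    \<lparr> carrier = amalgam_class G1 G2 A i1 i2 ` lists (carrier G1 <+> carrier G2),
      monoid.mult = (\<lambda>X Y. \<Union>u\<in>X. \<Union>v\<in>Y. amalgam_class G1 G2 A i1 i2 (u @ v)),
      monoid.one = amalgam_class G1 G2 A i1 i2 [] \<rparr>"

text \<open>
  \<open>\<Gamma> = \<Gamma>1 *\<^sub>A \<Gamma>2\<close> for subgroups \<open>\<Gamma>1\<close>, \<open>\<Gamma>2\<close> of \<open>\<Gamma>\<close> with common subgroup \<open>A\<close>: the homomorphism from the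
  constructed amalgamated free product to \<open>\<Gamma>\<close> that restricts to the inclusions of the two
  factors is an isomorphism.
\<close>

definition is_amalgamated_free_product ::
  "('a, 'm) monoid_scheme \<Rightarrow> 'a set \<Rightarrow> 'a set \<Rightarrow> 'a set \<Rightarrow> bool"
where
  "is_amalgamated_free_product \<Gamma> \<Gamma>1 \<Gamma>2 A \<longleftrightarrow>
    group \<Gamma> \<and> subgroup \<Gamma>1 \<Gamma> \<and> subgroup \<Gamma>2 \<Gamma> \<and> subgroup A \<Gamma> \<and> A \<subseteq> \<Gamma>1 \<and> A \<subseteq> \<Gamma>2 \<and>
    (let G1 = \<Gamma>\<lparr>carrier := \<Gamma>1\<rparr>; G2 = \<Gamma>\<lparr>carrier := \<Gamma>2\<rparr>; A' = \<Gamma>\<lparr>carrier := A\<rparr>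
     in \<exists>\<phi> \<in> iso (amalgam G1 G2 A' (\<lambda>a. a) (\<lambda>a. a)) \<Gamma>.
          (\<forall>x\<in>\<Gamma>1. \<phi> (amalgam_class G1 G2 A' (\<lambda>a. a) (\<lambda>a. a) [Inl x]) = x) \<and>
          (\<forall>y\<in>\<Gamma>2. \<phi> (amalgam_class G1 G2 A' (\<lambda>a. a) (\<lambda>a. a) [Inr y]) = y))"


section \<open>Amenability and finite generation\<close>

text \<open>Amenability of a discrete group in von Neumann's sense.\<close>

definition amenable :: "('a, 'm) monoid_scheme \<Rightarrow> bool" where
  "amenable G \<longleftrightarrow>
    (\<exists>\<mu> :: 'a set \<Rightarrow> real.
      (\<forall>X. X \<subseteq> carrier G \<longrightarrow> 0 \<le> \<mu> X) \<and>
      \<mu> (carrier G) = 1 \<and>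
      (\<forall>X Y. X \<subseteq> carrier G \<longrightarrow> Y \<subseteq> carrier G \<longrightarrow> X \<inter> Y = {} \<longrightarrow> \<mu> (X \<union> Y) = \<mu> X + \<mu> Y) \<and>
      (\<forall>g X. g \<in> carrier G \<longrightarrow> X \<subseteq> carrier G \<longrightarrow> \<mu> (g <#\<^bsub>G\<^esub> X) = \<mu> X))"

definition finitely_generated :: "('a, 'm) monoid_scheme \<Rightarrow> bool" where
  "finitely_generated G \<longleftrightarrow> (\<exists>S. finite S \<and> S \<subseteq> carrier G \<and> generate G S = carrier G)"

text \<open>Meaningful for finitely generated groups only; it is \<open>0\<close> otherwise.\<close>

definition min_generators :: "('a, 'm) monoid_scheme \<Rightarrow> nat" where
  "min_generators G = Inf {card S | S. finite S \<and> S \<subseteq> carrier G \<and> generate G S = carrier G}"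


section \<open>The p-gradient\<close>

definition d_p :: "nat \<Rightarrow> ('a, 'm) monoid_scheme \<Rightarrow> nat" where
  "d_p p H = min_generators
    (H Mod (derived H (carrier H) <#>\<^bsub>H\<^esub> generate H ((\<lambda>h. h [^]\<^bsub>H\<^esub> p) ` carrier H)))"

text \<open>
  Since \<open>card\<close> of an infinite set is \<open>0\<close>, having \<open>p\<close>-power index includes having finite index.
\<close>

definition normal_p_power_index :: "nat \<Rightarrow> ('a, 'm) monoid_scheme \<Rightarrow> 'a set set" where
  "normal_p_power_index p G = {H. H \<lhd> G \<and> (\<exists>k. card (rcosets\<^bsub>G\<^esub> H) = p ^ k)}"

definition residually_p :: "nat \<Rightarrow> ('a, 'm) monoid_scheme \<Rightarrow> bool" where
  "residually_p p G \<longleftrightarrow> \<Inter> (normal_p_power_index p G) = {\<one>\<^bsub>G\<^esub>}"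

text \<open>A lattice is a nonempty collection, so that the infimum defining the gradient makes sense.\<close>

definition subgroup_lattice :: "('a, 'm) monoid_scheme \<Rightarrow> 'a set set \<Rightarrow> bool" where
  "subgroup_lattice G L \<longleftrightarrow>
    L \<noteq> {} \<and> (\<forall>H\<in>L. subgroup H G) \<and> (\<forall>H\<in>L. \<forall>K\<in>L. H \<inter> K \<in> L)"

definition p_gradient :: "nat \<Rightarrow> ('a, 'm) monoid_scheme \<Rightarrow> 'a set set \<Rightarrow> real" where
  "p_gradient p G L =
    (INF H\<in>L. (real (d_p p (G\<lparr>carrier := H\<rparr>)) - 1) / real (card (rcosets\<^bsub>G\<^esub> H)))"

definition abs_p_gradient :: "nat \<Rightarrow> ('a, 'm) monoid_scheme \<Rightarrow> real" where
  "abs_p_gradient p G = p_gradient p G (normal_p_power_index p G)"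

text \<open>
  \<open>1 / |A|\<close>, with value \<open>0\<close> for infinite \<open>A\<close>: in HOL, \<open>card A = 0\<close> for such \<open>A\<close> and \<open>1 / 0 = 0\<close>.
\<close>

definition inverse_order :: "'a set \<Rightarrow> real" where
  "inverse_order A = 1 / real (card A)"

end

(*
For a subgroup K of G and a normal subgroup H of p-power index, let Z(K,H) be the space of cocycles of
K with values in the functions from G/H to F_p. By Shapiro's lemma
  dim Z(K,H) / [G:H] = 1 + (d_p(K Int H) - 1) / [K : K Int H],
so gradients are normalised dimensions of cocycle spaces. By the universal property of the amalgam,
Z(G,H) is the fibre product of Z(G1,H) and Z(G2,H) over Z(A,H); hence its dimension is
dim Z(G1,H) + dim Z(G2,H) minus the dimension of a space I that lies between the coboundaries of A and
Z(A,H). The coboundaries have normalised dimension 1 - 1/[A : A Int H], which gives the upper bound for the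
gradient of G. For the lower bound, for fixed H only a finitely generated subgroup B of A matters.
The normalised dimension of the fibre product over B decreases with H, because a finite p-group
acting on an F_p-space W satisfies dim W <= |P| dim W^P. So H may be shrunk until a Foelner set F of B
embeds into G/H, and then Shearer's inequality for the translates of F bounds the normalised dimension
of Z(B,H) by (|F| - 1)/k, where k is the minimal overlap of F with its translates by generators.
*)
theory Submission
  imports Defs "HOL-Algebra.Zassenhaus" "HOL-Algebra.Group_Action"
begin

section \<open>Finite groups of functions\<close>

text \<open>The numbers d_p for G, G1 and G2 belong to different indices and do not add up;
  dimensions of cocycle spaces are all divided by the same [G:H], and a fibre product relates them
  exactly, without second cohomology. Since A need not be finitely generated, Z(A,H) may be infinite
  and cannot be bounded directly. For fixed H there are only finitely many pairs of cocycles, so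
  finitely many elements of A enforce agreement on A. The subgroup B generated by them depends on H,
  however, and for a smaller H' the fibre product over B may be larger than Z(G,H'). Therefore
  monotonicity is needed for the fibre product over B: it is estimated at H' and carried back to H,
  where it has the size of Z(G,H). The term 1/|A| must come out exactly, and it does because a
  cocycle on a window is a potential up to a constant, so that a window F costs |F| - 1 parameters.
  For finite B the window F = B with k = |B| gives 1 - 1/|B|, which is at most 1 - 1/|A|, the
  limiting share of the coboundaries; for infinite B the ratio can be brought as close to 1 as
  desired.\<close>

lemma root_unity_nonzero: "z ^ p = 1 \<Longrightarrow> p > 0 \<Longrightarrow> z \<noteq> (0::complex)"
  by (auto simp: power_0_left)

lemma coprime_powers_eq_1:
  fixes z :: complex
  assumes "z ^ m = 1" "z ^ n = 1" "coprime m n"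
  shows "z = 1"
proof (cases "m = 0")
  case True
  then show ?thesis using assms by auto
next
  case False
  obtain x y where "m * x = n * y + gcd m n" using bezout_nat[OF False] by blast
  then have "m * x = n * y + 1" using assms(3) by (metis coprime_imp_gcd_eq_1)
  then have "z ^ (m * x) = z ^ (n * y) * z" by simp
  then show ?thesis using assms by (simp add: power_mult)
qed

lemma inj_on_powers:
  fixes z :: complex
  assumes "prime p" "z ^ p = 1" "z \<noteq> 1"
  shows "inj_on (\<lambda>i. z ^ i) {..<p}"
proof (rule linorder_inj_onI')
  fix i j assume ij: "i \<in> {..<p}" "j \<in> {..<p}" "i < j"
  show "z ^ i \<noteq> z ^ j"
  proof
    assume "z ^ i = z ^ j"
    also have "z ^ j = z ^ i * z ^ (j - i)" using ij(3) by (simp flip: power_add)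
    finally have "z ^ (j - i) = 1"
      using root_unity_nonzero[OF assms(2) prime_gt_0_nat[OF assms(1)]] by simp
    moreover have "coprime p (j - i)" using ij assms(1)
      by (auto intro!: prime_imp_coprime dest: dvd_imp_le)
    ultimately show False using coprime_powers_eq_1 assms by blast
  qed
qed

text \<open>This plays the role of F_p having only the subspaces 0 and F_p: the powers of a
  nontrivial element are p different roots, and there are only p roots.\<close>

lemma card_mult_closed_roots_unity:
  assumes "prime p" "A \<subseteq> {z::complex. z ^ p = 1}" "1 \<in> A" "\<And>y z. y \<in> A \<Longrightarrow> z \<in> A \<Longrightarrow> y * z \<in> A"
  shows "A = {1} \<or> card A = p"
proof (cases "A = {1}")
  case False
  then obtain z where z: "z \<in> A" "z \<noteq> 1" using assms by blast
  have p: "1 \<le> p" using prime_ge_1_nat assms(1) by blast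
  have "z ^ i \<in> A" for i by (induction i) (use assms z in auto)
  then have "(\<lambda>i. z ^ i) ` {..<p} \<subseteq> A" by auto
  moreover have fin: "finite A" using assms(2) p finite_roots_unity finite_subset by blast
  ultimately have "card ((\<lambda>i. z ^ i) ` {..<p}) \<le> card A" by (rule card_mono[rotated])
  moreover have "card ((\<lambda>i. z ^ i) ` {..<p}) = p"
    using card_image[OF inj_on_powers[of p z]] assms z by auto
  moreover have "card A \<le> p"
    using card_mono[OF finite_roots_unity[OF p] assms(2)] card_roots_unity[OF p, where 'a=complex]
    by linarith
  ultimately show ?thesis by simp
qed simp

text \<open>The field \<open>\<F>\<^sub>p\<close> is modelled by the complex \<open>p\<close>-th roots of unity, so that an \<open>\<F>\<^sub>p\<close>-space of
  functions becomes a set closed under pointwise multiplication, whose dimension is read off its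
  cardinality.\<close>

definition fun_group :: "nat \<Rightarrow> ('x \<Rightarrow> complex) set \<Rightarrow> bool" where
  "fun_group p W \<longleftrightarrow> (\<lambda>_. 1) \<in> W \<and> (\<forall>f\<in>W. \<forall>x. f x ^ p = 1) \<and>
     (\<forall>f\<in>W. \<forall>g\<in>W. (\<lambda>x. f x * g x) \<in> W)"

lemma fun_group_one: "fun_group p W \<Longrightarrow> (\<lambda>_. 1) \<in> W"
  and fun_group_root: "fun_group p W \<Longrightarrow> f \<in> W \<Longrightarrow> f x ^ p = 1"
  and fun_group_mult: "fun_group p W \<Longrightarrow> f \<in> W \<Longrightarrow> g \<in> W \<Longrightarrow> (\<lambda>x. f x * g x) \<in> W"
  by (auto simp: fun_group_def)

lemma card_fun_group_pos: "fun_group p W \<Longrightarrow> finite W \<Longrightarrow> card W > 0"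
  using fun_group_one by (auto simp: card_gt_0_iff)

lemma fun_group_nonzero: "fun_group p W \<Longrightarrow> p > 0 \<Longrightarrow> f \<in> W \<Longrightarrow> f x \<noteq> 0"
  using fun_group_root root_unity_nonzero by metis

text \<open>Values are p-th roots of unity, so the power p - 1, which closure under products
  provides, is the inverse. For this reason \<open>fun_group\<close> does not ask for
  inverses.\<close>

lemma fun_group_inverse:
  assumes "fun_group p W" "p > 0" "f \<in> W"
  shows "(\<lambda>x. inverse (f x)) \<in> W"
proof -
  have pow: "(\<lambda>x. f x ^ n) \<in> W" for n
    by (induction n) (use assms in \<open>auto simp: fun_group_one intro!: fun_group_mult\<close>)
  have "inverse (f x) = f x ^ (p - 1)" for x
  proof -
    have "f x * f x ^ (p - 1) = 1"
      using fun_group_root[OF assms(1,3)] assms(2) by (simp flip: power_Suc)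
    then show ?thesis using inverse_unique by blast
  qed
  then show ?thesis using pow by simp
qed

lemma fun_group_divide:
  assumes "fun_group p W" "p > 0" "f \<in> W" "g \<in> W"
  shows "(\<lambda>x. f x / g x) \<in> W"
  using fun_group_mult[OF assms(1,3) fun_group_inverse[OF assms(1,2,4)]]
  by (simp add: divide_inverse)

lemma fun_group_eqI:
  assumes "fun_group p W" "p > 0" "w \<in> W" "(\<lambda>x. v x / w x) = (\<lambda>_. 1)"
  shows "v = w"
proof
  fix x
  have "v x / w x = 1" using assms(4) by (rule fun_cong)
  then show "v x = w x" using fun_group_nonzero[OF assms(1-3), of x] by simp
qed

text \<open>Rank-nullity, read off cardinalities: every nonempty fibre is the kernel multiplied by
  any one of its points. The target is not assumed to be a \<open>fun_group\<close>, so the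
  nonvanishing that permits division is a separate hypothesis.\<close>

lemma card_image_kernel:
  fixes \<phi> :: "('x \<Rightarrow> complex) \<Rightarrow> 'y \<Rightarrow> complex"
  assumes W: "fun_group p W" "p > 0" "finite W"
    and mult: "\<And>f g. f \<in> W \<Longrightarrow> g \<in> W \<Longrightarrow> \<phi> (\<lambda>x. f x * g x) = (\<lambda>y. \<phi> f y * \<phi> g y)"
    and nz: "\<And>f y. f \<in> W \<Longrightarrow> \<phi> f y \<noteq> 0"
  shows "card W = card (\<phi> ` W) * card {w\<in>W. \<phi> w = (\<lambda>_. 1)}"
proof -
  have fib: "card {w\<in>W. \<phi> w = v} = card {w\<in>W. \<phi> w = (\<lambda>_. 1)}" if "v \<in> \<phi> ` W" for v
  proof -
    obtain w0 where w0: "w0 \<in> W" "v = \<phi> w0" using \<open>v \<in> \<phi> ` W\<close> by blast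
    have nz0: "w0 x \<noteq> 0" for x by (rule fun_group_nonzero[OF W(1,2) w0(1)])
    have \<phi>div: "\<phi> (\<lambda>x. w x / w0 x) = (\<lambda>y. \<phi> w y / \<phi> w0 y)" if w: "w \<in> W" for w
    proof -
      have "\<phi> (\<lambda>x. w x / w0 x * w0 x) = (\<lambda>y. \<phi> (\<lambda>x. w x / w0 x) y * \<phi> w0 y)"
        using mult[OF fun_group_divide[OF W(1,2) w w0(1)] w0(1)] .
      then have "\<phi> w y = \<phi> (\<lambda>x. w x / w0 x) y * \<phi> w0 y" for y
        using nz0 by (simp add: fun_eq_iff)
      then show ?thesis using nz[OF w0(1)] by (intro ext) (simp add: nonzero_eq_divide_eq)
    qed
    have "bij_betw (\<lambda>w x. w x / w0 x) {w\<in>W. \<phi> w = v} {w\<in>W. \<phi> w = (\<lambda>_. 1)}"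
    proof (rule bij_betw_byWitness[where f' = "\<lambda>w x. w x * w0 x"])
      show "(\<lambda>w x. w x / w0 x) ` {w\<in>W. \<phi> w = v} \<subseteq> {w\<in>W. \<phi> w = (\<lambda>_. 1)}"
        using w0 nz by (auto simp: \<phi>div intro!: fun_group_divide[OF W(1,2)])
      show "(\<lambda>w x. w x * w0 x) ` {w\<in>W. \<phi> w = (\<lambda>_. 1)} \<subseteq> {w\<in>W. \<phi> w = v}"
        using w0 by (auto simp: mult intro!: fun_group_mult[OF W(1)])
    qed (use nz0 in auto)
    then show ?thesis by (rule bij_betw_same_card)
  qed
  have "card W = (\<Sum>v\<in>\<phi> ` W. card {w\<in>W. \<phi> w = v})"
    using sum.image_gen[OF W(3), of "\<lambda>_. 1::nat" \<phi>] by simp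
  then show ?thesis using fib by simp
qed

section \<open>Restriction to coordinates, dimension, and Shearer's inequality\<close>

definition restr :: "'x set \<Rightarrow> ('x \<Rightarrow> complex) \<Rightarrow> 'x \<Rightarrow> complex" where
  "restr E w = (\<lambda>x. if x \<in> E then w x else 1)"

lemma restr_eq_iff: "restr E v = restr E w \<longleftrightarrow> (\<forall>x\<in>E. v x = w x)"
  by (auto simp: restr_def fun_eq_iff)

lemma restr_eq_one_iff: "restr E w = (\<lambda>_. 1) \<longleftrightarrow> (\<forall>x\<in>E. w x = 1)"
  by (auto simp: restr_def fun_eq_iff)

text \<open>Restricting means overwriting by the neutral value 1 off \<open>E\<close>. The
  restrictions keep their type and form a \<open>fun_group\<close> again, so that rank-nullity
  applies to them in turn.\<close>

lemma fun_group_restr: "fun_group p W \<Longrightarrow> fun_group p (restr E ` W)"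
proof -
  assume W: "fun_group p W"
  have "restr E (\<lambda>_. 1) = (\<lambda>_. 1)" by (simp add: restr_eq_one_iff)
  moreover have "(\<lambda>x. restr E f x * restr E g x) = restr E (\<lambda>x. f x * g x)" for f g
    by (auto simp: restr_def)
  moreover have "restr E f x ^ p = 1" if "f \<in> W" for f x
    using fun_group_root[OF W that] by (simp add: restr_def)
  ultimately show ?thesis
    using fun_group_one[OF W] fun_group_mult[OF W] unfolding fun_group_def
    by (auto simp: image_iff) metis+
qed

text \<open>Rank-nullity for forgetting the coordinate \<open>e\<close>: an element that is trivial
  on \<open>E\<close> is known on \<open>insert e E\<close> from its value at
  \<open>e\<close>.\<close>

lemma card_restr_insert:
  assumes W: "fun_group p W" "p > 0" "finite W" and e: "e \<notin> E"
  shows "card (restr (insert e E) ` W) =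
     card (restr E ` W) * card ((\<lambda>w. w e) ` {w\<in>W. \<forall>x\<in>E. w x = 1})"
proof -
  let ?W' = "restr (insert e E) ` W"
  have "card ?W' = card (restr E ` ?W') * card {w\<in>?W'. restr E w = (\<lambda>_. 1)}"
    by (rule card_image_kernel[OF fun_group_restr[OF W(1)] W(2)])
      (use W in \<open>auto simp: restr_def fun_eq_iff fun_group_nonzero\<close>)
  moreover have "restr E ` ?W' = restr E ` W"
    unfolding image_image by (intro image_cong refl) (auto simp: restr_def)
  moreover have "bij_betw (\<lambda>w. w e) {w\<in>?W'. restr E w = (\<lambda>_. 1)} ((\<lambda>w. w e) ` {w\<in>W. \<forall>x\<in>E. w x = 1})"
  proof (rule bij_betw_imageI)
    show "inj_on (\<lambda>w. w e) {w\<in>?W'. restr E w = (\<lambda>_. 1)}"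
    proof (rule inj_onI)
      fix v w assume "v \<in> {w\<in>?W'. restr E w = (\<lambda>_. 1)}" "w \<in> {w\<in>?W'. restr E w = (\<lambda>_. 1)}" "v e = w e"
      then show "v = w" by (auto simp: restr_def fun_eq_iff split: if_splits)
    qed
    have "w e \<in> (\<lambda>w. w e) ` {w\<in>?W'. restr E w = (\<lambda>_. 1)}" if "w \<in> W" "\<forall>x\<in>E. w x = 1" for w
      using that e by (intro image_eqI[of _ _ "restr (insert e E) w"]) (auto simp: restr_def)
    then show "(\<lambda>w. w e) ` {w\<in>?W'. restr E w = (\<lambda>_. 1)} = (\<lambda>w. w e) ` {w\<in>W. \<forall>x\<in>E. w x = 1}"
      using e by (auto simp: restr_eq_one_iff) (force simp: restr_def)
  qed
  ultimately show ?thesis by (simp add: bij_betw_same_card)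
qed

text \<open>A greedy choice of coordinates: \<open>e\<close> is kept exactly when it still takes a
  nontrivial value on elements that are trivial at the earlier points. It then takes p values there,
  so each kept point multiplies the cardinality by p.\<close>

lemma fun_group_coordinates_aux:
  assumes "prime p" and W: "fun_group p W" "finite W" and "finite E"
  shows "\<exists>E'\<subseteq>E. card (restr E ` W) = p ^ card E' \<and>
    (\<forall>w\<in>W. (\<forall>x\<in>E'. w x = 1) \<longrightarrow> (\<forall>x\<in>E. w x = 1))"
  using \<open>finite E\<close>
proof (induction E)
  case empty
  have "restr {} ` W = {\<lambda>_. 1}" using fun_group_one[OF W(1)] by (auto simp: restr_def)
  then show ?case by auto
next
  case (insert e E)
  note p = prime_gt_0_nat[OF \<open>prime p\<close>]
  obtain E' where E': "E' \<subseteq> E" "card (restr E ` W) = p ^ card E'"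
    "\<And>w. w\<in>W \<Longrightarrow> (\<forall>x\<in>E'. w x = 1) \<Longrightarrow> (\<forall>x\<in>E. w x = 1)" using insert.IH by blast
  let ?K = "(\<lambda>w. w e) ` {w\<in>W. \<forall>x\<in>E. w x = 1}"
  have "?K = {1} \<or> card ?K = p"
  proof (rule card_mult_closed_roots_unity[OF \<open>prime p\<close>])
    show "?K \<subseteq> {z. z ^ p = 1}" using fun_group_root[OF W(1)] by auto
    show "1 \<in> ?K" using fun_group_one[OF W(1)] by force
    fix y z assume "y \<in> ?K" "z \<in> ?K"
    then obtain v w where "v \<in> W" "w \<in> W" "\<forall>x\<in>E. v x = 1" "\<forall>x\<in>E. w x = 1" "y = v e" "z = w e"
      by auto
    then show "y * z \<in> ?K"
      by (intro image_eqI[of _ _ "\<lambda>x. v x * w x"]) (auto intro: fun_group_mult[OF W(1)])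
  qed
  then show ?case
  proof
    assume K: "?K = {1}"
    have "card (restr (insert e E) ` W) = p ^ card E'"
      using card_restr_insert[OF W(1) p W(2) insert.hyps(2)] E' by (simp add: K)
    then show ?case using E' K by (intro exI[of _ E']) auto
  next
    assume K: "card ?K = p"
    have "e \<notin> E'" "finite E'" using insert.hyps E' finite_subset by auto
    then have "card (restr (insert e E) ` W) = p ^ card (insert e E')"
      using card_restr_insert[OF W(1) p W(2) insert.hyps(2)] E' by (simp add: K)
    then show ?case using E' by (intro exI[of _ "insert e E'"]) auto
  qed
qed

text \<open>Here \<open>card E\<close> is the dimension of \<open>W\<close>, and evaluation on
  \<open>E\<close> identifies \<open>W\<close> with F_p^E.\<close>

lemma fun_group_coordinates:
  assumes "prime p" and W: "fun_group p W" "finite W"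
  obtains E where "finite E" "card W = p ^ card E"
    "\<And>w. w \<in> W \<Longrightarrow> (\<And>x. x \<in> E \<Longrightarrow> w x = 1) \<Longrightarrow> w = (\<lambda>_. 1)"
proof -
  \<comment> \<open>The domain may be infinite; one point for each nontrivial element of the finite
    \<open>W\<close> gives a finite set that detects triviality.\<close>
  have "\<exists>x. w \<noteq> (\<lambda>_. 1) \<longrightarrow> w x \<noteq> 1" for w :: "'a \<Rightarrow> complex" by auto
  then obtain x where x: "\<And>w :: 'a \<Rightarrow> complex. w \<noteq> (\<lambda>_. 1) \<Longrightarrow> w (x w) \<noteq> 1" by metis
  define E where "E = x ` W"
  have det: "w = (\<lambda>_. 1)" if "w \<in> W" "\<forall>y\<in>E. w y = 1" for w
    using x that unfolding E_def by blast
  have fin: "finite E" unfolding E_def using W by simp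
  obtain E' where E': "E' \<subseteq> E" "card (restr E ` W) = p ^ card E'"
    "\<And>w. w\<in>W \<Longrightarrow> (\<forall>x\<in>E'. w x = 1) \<Longrightarrow> (\<forall>x\<in>E. w x = 1)"
    using fun_group_coordinates_aux[OF assms fin] by blast
  have "inj_on (restr E) W"
  proof (rule inj_onI)
    fix v w assume vw: "v \<in> W" "w \<in> W" "restr E v = restr E w"
    note p = prime_gt_0_nat[OF \<open>prime p\<close>]
    show "v = w"
      using vw by (intro fun_group_eqI[OF W(1) p vw(2)] det fun_group_divide[OF W(1) p])
        (auto simp: restr_eq_iff fun_group_nonzero[OF W(1) p])
  qed
  then have "card W = p ^ card E'" using E' by (simp add: card_image)
  then show ?thesis using that[of E'] E' det fin finite_subset by metis
qed

text \<open>The coordinates are added one by one: a new coordinate contributes at most as many values over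
  all old coordinates as it does over some of them.\<close>

lemma shearer_card:
  assumes W: "fun_group p W" "p > 0" "finite W" and "finite J" "finite E"
    and cover: "\<And>e. e \<in> E \<Longrightarrow> k \<le> card {j\<in>J. e \<in> D j}"
  shows "card (restr E ` W) ^ k \<le> (\<Prod>j\<in>J. card (restr (D j \<inter> E) ` W))"
  using \<open>finite E\<close> cover
proof (induction E)
  case empty
  have "restr {} ` W = {\<lambda>_. 1}" using fun_group_one[OF W(1)] by (auto simp: restr_def)
  then show ?case by simp
next
  case (insert e E)
  define K where "K F = card ((\<lambda>w. w e) ` {w\<in>W. \<forall>x\<in>F. w x = 1})" for F
  have K_mono: "K E \<le> K F" if "F \<subseteq> E" for F
    unfolding K_def by (rule card_mono) (use W that in auto)
  \<comment> \<open>This allows the exponent to be raised from k to the number of windows that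
    contain e.\<close>
  have K1: "1 \<le> K E"
  proof -
    have "(\<lambda>w. w e) ` {w\<in>W. \<forall>x\<in>E. w x = 1} \<noteq> {}" using fun_group_one[OF W(1)] by auto
    then show ?thesis unfolding K_def using W(3) by (simp add: Suc_leI card_gt_0_iff)
  qed
  have "card (restr (insert e E) ` W) ^ k = card (restr E ` W) ^ k * K E ^ k"
    using card_restr_insert[OF W insert.hyps(2)] by (simp add: K_def power_mult_distrib)
  also have "\<dots> \<le> (\<Prod>j\<in>J. card (restr (D j \<inter> E) ` W)) * K E ^ card {j\<in>J. e \<in> D j}"
    using insert.IH insert.prems K1 by (intro mult_mono power_increasing) auto
  also have "\<dots> = (\<Prod>j\<in>J. card (restr (D j \<inter> E) ` W) * (if e \<in> D j then K E else 1))"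
    using \<open>finite J\<close> by (simp add: prod.distrib prod.If_cases Int_def)
  also have "\<dots> \<le> (\<Prod>j\<in>J. card (restr (D j \<inter> insert e E) ` W))"
  proof (rule prod_mono, safe)
    fix j assume "j \<in> J"
    show "card (restr (D j \<inter> E) ` W) * (if e \<in> D j then K E else 1) \<le> card (restr (D j \<inter> insert e E) ` W)"
    proof (cases "e \<in> D j")
      case True
      have "card (restr (insert e (D j \<inter> E)) ` W) = card (restr (D j \<inter> E) ` W) * K (D j \<inter> E)"
        unfolding K_def using insert.hyps(2) by (intro card_restr_insert[OF W]) blast
      then show ?thesis using True K_mono[of "D j \<inter> E"] by simp
    qed simp
  qed
  finally show ?case .
qed

section \<open>Hall's theorem and Foelner sets\<close>

definition hall_condition :: "'i set \<Rightarrow> ('i \<Rightarrow> 'x set) \<Rightarrow> bool" where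
  "hall_condition I N \<longleftrightarrow>
    (\<forall>J. finite J \<longrightarrow> J \<subseteq> I \<longrightarrow> card J \<le> card (\<Union>v\<in>J. N v))"

text \<open>Suppose that deleting x and deleting y both violate the condition. The violating sets
  contain v; without v call them K and L, with neighbourhoods P and Q that include what is left of
  \<open>N v\<close>. Then |P| <= |K| and |Q| <= |L|. The condition for the union of K and L with v
  gives |P Un Q| > |K Un L|, since x and y differ, and for the intersection it gives |P Int Q| >= |K
  Int L|. The sums contradict each other.\<close>

lemma hall_condition_minimal:
  assumes hall: "hall_condition I N" and fin: "\<And>v. v \<in> I \<Longrightarrow> finite (N v)"
    and v: "v \<in> I" "x \<in> N v" "y \<in> N v" "x \<noteq> y"
  shows "hall_condition I (N(v := N v - {x})) \<or> hall_condition I (N(v := N v - {y}))"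
proof (rule ccontr)
  assume neg: "\<not> ?thesis"
  have hallD: "card J \<le> card (\<Union>u\<in>J. N u)" if "finite J" "J \<subseteq> I" for J
    using hall that unfolding hall_condition_def by blast
  have *: "\<exists>K. finite K \<and> K \<subseteq> I \<and> v \<notin> K \<and> card ((\<Union>u\<in>K. N u) \<union> (N v - {z})) \<le> card K"
    if nz: "\<not> hall_condition I (N(v := N v - {z}))" for z
  proof -
    obtain J where J: "finite J" "J \<subseteq> I" "card (\<Union>u\<in>J. (N(v := N v - {z})) u) < card J"
      using nz unfolding hall_condition_def by (auto simp: not_le)
    have v: "v \<in> J"
    proof (rule ccontr)
      assume "v \<notin> J"
      then have "(\<Union>u\<in>J. (N(v := N v - {z})) u) = (\<Union>u\<in>J. N u)" by (intro SUP_cong) auto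
      moreover have "card J \<le> card (\<Union>u\<in>J. N u)" by (rule hallD[OF J(1,2)])
      ultimately show False using J(3) by simp
    qed
    have "(\<Union>u\<in>J - {v}. (N(v := N v - {z})) u) = (\<Union>u\<in>J - {v}. N u)" by (intro SUP_cong) auto
    moreover have "(\<Union>u\<in>J. (N(v := N v - {z})) u) =
        (\<Union>u\<in>insert v (J - {v}). (N(v := N v - {z})) u)"
      using v by (simp add: insert_absorb)
    ultimately have "(\<Union>u\<in>J. (N(v := N v - {z})) u) = (\<Union>u\<in>J - {v}. N u) \<union> (N v - {z})"
      by (simp only: UN_insert fun_upd_same Un_commute)
    moreover have "card J = Suc (card (J - {v}))"
      by (rule card.remove[OF J(1) v])
    ultimately have "card ((\<Union>u\<in>J - {v}. N u) \<union> (N v - {z})) \<le> card (J - {v})"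
      using J(3) by (simp only: less_Suc_eq_le)
    moreover have "finite (J - {v})" "J - {v} \<subseteq> I" "v \<notin> J - {v}" using J(1,2) by auto
    ultimately show ?thesis by (intro exI[of _ "J - {v}"] conjI)
  qed
  have nx: "\<not> hall_condition I (N(v := N v - {x}))" and ny: "\<not> hall_condition I (N(v := N v - {y}))"
    using neg by (simp_all only: de_Morgan_disj not_False_eq_True)
  obtain K where K: "finite K" "K \<subseteq> I" "v \<notin> K" "card ((\<Union>u\<in>K. N u) \<union> (N v - {x})) \<le> card K"
    using *[OF nx] by blast
  obtain L where L: "finite L" "L \<subseteq> I" "v \<notin> L" "card ((\<Union>u\<in>L. N u) \<union> (N v - {y})) \<le> card L"
    using *[OF ny] by blast
  let ?P = "(\<Union>u\<in>K. N u) \<union> (N v - {x})" and ?Q = "(\<Union>u\<in>L. N u) \<union> (N v - {y})"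
  have finPQ: "finite ?P" "finite ?Q" using K L fin v by auto
  have "card (insert v (K \<union> L)) \<le> card (\<Union>u\<in>insert v (K \<union> L). N u)"
    by (rule hallD) (use K L v(1) in auto)
  also have "\<dots> \<le> card (?P \<union> ?Q)" using v(4) finPQ by (intro card_mono) auto
  finally have 1: "Suc (card (K \<union> L)) \<le> card (?P \<union> ?Q)" using K L by simp
  have "card (K \<inter> L) \<le> card (\<Union>u\<in>K \<inter> L. N u)"
    by (rule hallD) (use K L in auto)
  also have "\<dots> \<le> card (?P \<inter> ?Q)" using finPQ by (intro card_mono) auto
  finally show False
    using 1 card_Un_Int[OF finPQ] card_Un_Int[OF K(1) L(1)] K(4) L(4) by linarith
qed

text \<open>Rado's proof: a family that is minimal for Hall's condition consists of singletons.\<close>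

lemma hall_marriage:
  assumes hall: "hall_condition I N" and fin: "\<And>v. v \<in> I \<Longrightarrow> finite (N v)"
  shows "\<exists>f. inj_on f I \<and> (\<forall>v\<in>I. f v \<in> N v)"
proof -
  \<comment> \<open>\<open>R\<close> collects deleted pairs; a minimal subfamily is a maximal
    \<open>R\<close>, to which Zorn's lemma applies.\<close>
  define M where "M R = (\<lambda>v. {x\<in>N v. (v, x) \<notin> R})" for R
  define \<R> where "\<R> = {R. hall_condition I (M R)}"
  have "\<exists>R\<in>\<R>. \<forall>X\<in>\<R>. R \<subseteq> X \<longrightarrow> X = R"
  proof (rule subset_Zorn_nonempty)
    have "M {} = N" by (simp add: M_def)
    then have "{} \<in> \<R>" using hall by (simp add: \<R>_def)
    then show "\<R> \<noteq> {}" by blast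
    fix \<C> assume C: "\<C> \<noteq> {}" "subset.chain \<R> \<C>"
    have "card J \<le> card (\<Union>v\<in>J. M (\<Union>\<C>) v)" if J: "finite J" "J \<subseteq> I" for J
    proof -
      \<comment> \<open>Here finiteness of the sets \<open>N v\<close> enters: \<open>J\<close>
        involves only finitely many pairs, and one member of the chain already deletes all those of
        them that the union deletes.\<close>
      have "finite ((SIGMA v:J. N v) \<inter> \<Union>\<C>)" using J fin by (intro finite_Int disjI1 finite_SigmaI) auto
      then obtain R where R: "R \<in> \<C>" "(SIGMA v:J. N v) \<inter> \<Union>\<C> \<subseteq> R"
        using finite_subset_Union_chain[of "(SIGMA v:J. N v) \<inter> \<Union>\<C>" \<C> \<R>] C by auto
      then have "M (\<Union>\<C>) v = M R v" if "v \<in> J" for v using that by (auto simp: M_def)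
      then have "(\<Union>v\<in>J. M (\<Union>\<C>) v) = (\<Union>v\<in>J. M R v)" by simp
      moreover have "R \<in> \<R>" using C R by (auto simp: subset_chain_def)
      ultimately show ?thesis using J by (auto simp: \<R>_def hall_condition_def)
    qed
    then show "\<Union>\<C> \<in> \<R>" by (auto simp: \<R>_def hall_condition_def)
  qed
  then obtain R where R: "hall_condition I (M R)"
    and max: "\<And>X. hall_condition I (M X) \<Longrightarrow> R \<subseteq> X \<Longrightarrow> X = R"
    by (auto simp: \<R>_def)
  have finM: "finite (M R v)" if "v \<in> I" for v using fin that by (simp add: M_def)
  have "\<exists>x. M R v = {x}" if v: "v \<in> I" for v
  proof -
    have "card {v} \<le> card (\<Union>u\<in>{v}. M R u)"
      using R v unfolding hall_condition_def by (metis empty_subsetI finite.emptyI finite.insertI insert_subset)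
    then obtain x where x: "x \<in> M R v" by (cases "M R v = {}") auto
    have "y = x" if y: "y \<in> M R v" for y
    proof (rule ccontr)
      assume "y \<noteq> x"
      have "(M R)(v := M R v - {z}) = M (insert (v, z) R)" for z
        by (auto simp: M_def fun_eq_iff)
      then have "hall_condition I (M (insert (v, x) R)) \<or> hall_condition I (M (insert (v, y) R))"
        using hall_condition_minimal[OF R finM v x y] \<open>y \<noteq> x\<close> by metis
      then have "insert (v, x) R = R \<or> insert (v, y) R = R" using max by blast
      then show False using x y by (auto simp: M_def)
    qed
    then show ?thesis using x by blast
  qed
  then obtain f where f: "\<And>v. v \<in> I \<Longrightarrow> M R v = {f v}" by metis
  have "inj_on f I"
  proof (rule inj_onI, rule ccontr)
    fix u v assume uv: "u \<in> I" "v \<in> I" "f u = f v" "u \<noteq> v"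
    have "card {u, v} \<le> card (\<Union>w\<in>{u, v}. M R w)"
      using R uv unfolding hall_condition_def by (metis empty_subsetI finite.emptyI finite.insertI insert_subset)
    then show False using uv by (simp add: f)
  qed
  moreover have "f v \<in> N v" if "v \<in> I" for v using f[OF that] by (auto simp: M_def)
  ultimately show ?thesis by blast
qed

section \<open>Invariant means and the Foelner condition\<close>

definition invariant_mean :: "('a, 'm) monoid_scheme \<Rightarrow> ('a set \<Rightarrow> real) \<Rightarrow> bool" where
  "invariant_mean G \<mu> \<longleftrightarrow>
    (\<forall>X. X \<subseteq> carrier G \<longrightarrow> 0 \<le> \<mu> X) \<and> \<mu> (carrier G) = 1 \<and>
    (\<forall>X Y. X \<subseteq> carrier G \<longrightarrow> Y \<subseteq> carrier G \<longrightarrow> X \<inter> Y = {} \<longrightarrow> \<mu> (X \<union> Y) = \<mu> X + \<mu> Y) \<and>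
    (\<forall>g X. g \<in> carrier G \<longrightarrow> X \<subseteq> carrier G \<longrightarrow> \<mu> (g <#\<^bsub>G\<^esub> X) = \<mu> X)"

lemma amenable_iff: "amenable G \<longleftrightarrow> (\<exists>\<mu>. invariant_mean G \<mu>)"
  unfolding amenable_def invariant_mean_def ..

lemma
  assumes "invariant_mean G \<mu>"
  shows invariant_mean_nonneg: "X \<subseteq> carrier G \<Longrightarrow> 0 \<le> \<mu> X"
    and invariant_mean_carrier: "\<mu> (carrier G) = 1"
    and invariant_mean_Un: "X \<subseteq> carrier G \<Longrightarrow> Y \<subseteq> carrier G \<Longrightarrow> X \<inter> Y = {} \<Longrightarrow> \<mu> (X \<union> Y) = \<mu> X + \<mu> Y"
    and invariant_mean_translate: "g \<in> carrier G \<Longrightarrow> X \<subseteq> carrier G \<Longrightarrow> \<mu> (g <#\<^bsub>G\<^esub> X) = \<mu> X"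
  using assms unfolding invariant_mean_def by blast+

lemma invariant_mean_UN:
  assumes "invariant_mean G \<mu>" "finite I" "\<And>i. i \<in> I \<Longrightarrow> X i \<subseteq> carrier G"
    and "\<And>i j. i \<in> I \<Longrightarrow> j \<in> I \<Longrightarrow> i \<noteq> j \<Longrightarrow> X i \<inter> X j = {}"
  shows "\<mu> (\<Union>i\<in>I. X i) = (\<Sum>i\<in>I. \<mu> (X i))"
  using assms(2-4)
proof (induction I)
  case empty
  have "\<mu> ({} \<union> {}) = \<mu> {} + \<mu> {}" by (rule invariant_mean_Un[OF assms(1)]) auto
  then show ?case by simp
next
  case (insert i I)
  have "X i \<inter> (\<Union>i\<in>I. X i) = {}" using insert.prems(2) insert.hyps(2) by blast
  moreover have "(\<Union>i\<in>I. X i) \<subseteq> carrier G" using insert.prems(1) by blast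
  ultimately have "\<mu> (X i \<union> (\<Union>i\<in>I. X i)) = \<mu> (X i) + \<mu> (\<Union>i\<in>I. X i)"
    using insert.prems(1) by (intro invariant_mean_Un[OF assms(1)]) auto
  then show ?case using insert by simp
qed

lemma invariant_mean_le_1:
  assumes "invariant_mean G \<mu>" "X \<subseteq> carrier G"
  shows "\<mu> X \<le> 1"
proof -
  have "\<mu> (X \<union> (carrier G - X)) = \<mu> X + \<mu> (carrier G - X)"
    by (rule invariant_mean_Un[OF assms(1)]) (use assms in auto)
  moreover have "X \<union> (carrier G - X) = carrier G" using assms(2) by blast
  ultimately show ?thesis
    using invariant_mean_carrier[OF assms(1)] invariant_mean_nonneg[OF assms(1), of "carrier G - X"] by simp
qed

text \<open>Hall's theorem embeds two copies of \<open>G\<close> into \<open>G\<close> by maps that move each point by an element of \<open>T\<close>,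
  which is a paradoxical decomposition.\<close>

lemma (in group) not_invariant_mean_if_doubling:
  assumes T: "finite T" "T \<subseteq> carrier G"
    and doubling: "\<And>F. finite F \<Longrightarrow> F \<subseteq> carrier G \<Longrightarrow> 2 * card F \<le> card (T <#> F)"
  shows "\<not> invariant_mean G \<mu>"
proof
  assume \<mu>: "invariant_mean G \<mu>"
  \<comment> \<open>The Boolean is a label for the two copies of the group.\<close>
  define I where "I = carrier G \<times> (UNIV :: bool set)"
  define N where "N v = (\<lambda>t. t \<otimes> fst v) ` T" for v :: "'a \<times> bool"
  have "hall_condition I N"
    unfolding hall_condition_def
  proof (intro allI impI)
    fix J assume J: "finite J" "J \<subseteq> I"
    have "card J \<le> card (fst ` J \<times> (UNIV :: bool set))"
      using J(1) by (intro card_mono) (auto intro: rev_image_eqI)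
    also have "\<dots> = 2 * card (fst ` J)" by (simp add: card_cartesian_product)
    also have "\<dots> \<le> card (T <#> fst ` J)"
      using J by (intro doubling) (auto simp: I_def)
    also have "T <#> fst ` J = (\<Union>v\<in>J. N v)" by (auto simp: N_def set_mult_def)
    finally show "card J \<le> card (\<Union>v\<in>J. N v)" .
  qed
  then obtain f where f: "inj_on f I" "\<And>v. v \<in> I \<Longrightarrow> f v \<in> N v"
    using hall_marriage[of I N] T by (auto simp: N_def)
  \<comment> \<open>\<open>P i t\<close> consists of the points of copy i that f moves by t. For
    each i these pieces partition the group, so their means add up to 1. Injectivity of f makes all
    translated pieces disjoint, so their total mean is at most 1, whereas invariance makes it
    2.\<close>
  define P where "P i t = {x\<in>carrier G. f (x, i) = t \<otimes> x}" for i t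
  have P_sub: "P i t \<subseteq> carrier G" for i t by (auto simp: P_def)
  have sum1: "(\<Sum>t\<in>T. \<mu> (P i t)) = 1" for i
  proof -
    have "(\<Union>t\<in>T. P i t) = carrier G"
      using f(2) by (fastforce simp: P_def N_def I_def)
    moreover have "P i t \<inter> P i u = {}" if "t \<in> T" "u \<in> T" "t \<noteq> u" for t u
      using that T(2) by (auto simp: P_def subset_iff)
    ultimately show ?thesis
      using invariant_mean_UN[OF \<mu> T(1), of "P i"] P_sub invariant_mean_carrier[OF \<mu>] by simp
  qed
  define Q where "Q = (\<lambda>(i, t). t <# P i t)"
  have Q_eq: "Q (i, t) = (\<lambda>x. f (x, i)) ` P i t" for i t
    unfolding Q_def l_coset_def P_def by auto
  have Q_sub: "Q v \<subseteq> carrier G" if "v \<in> UNIV \<times> T" for v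
    using that T(2) by (auto simp: Q_def l_coset_def P_def)
  have "Q v \<inter> Q w = {}" if "v \<in> UNIV \<times> T" "w \<in> UNIV \<times> T" "v \<noteq> w" for v w
  proof (rule ccontr)
    assume "Q v \<inter> Q w \<noteq> {}"
    then obtain x y where xy: "x \<in> P (fst v) (snd v)" "y \<in> P (fst w) (snd w)"
      "f (x, fst v) = f (y, fst w)"
      using Q_eq[of "fst v" "snd v"] Q_eq[of "fst w" "snd w"] by auto
    then have eq: "(x, fst v) = (y, fst w)"
      using P_sub by (intro inj_onD[OF f(1)]) (auto simp: I_def)
    then have "snd v \<otimes> x = snd w \<otimes> x" "x \<in> carrier G" using xy by (auto simp: P_def)
    then have "snd v = snd w" using that(1,2) T(2) by (auto simp: subset_iff)
    then show False using eq that(3) by (auto simp: prod_eq_iff)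
  qed
  then have "(\<Sum>v\<in>UNIV \<times> T. \<mu> (Q v)) = \<mu> (\<Union>v\<in>UNIV \<times> T. Q v)"
    using invariant_mean_UN[OF \<mu>, of "UNIV \<times> T" Q] T(1) Q_sub by simp
  also have "\<dots> \<le> 1" using Q_sub by (intro invariant_mean_le_1[OF \<mu>]) blast
  also have "(\<Sum>v\<in>UNIV \<times> T. \<mu> (Q v)) = (\<Sum>i\<in>UNIV. \<Sum>t\<in>T. \<mu> (Q (i, t)))"
    by (simp add: sum.cartesian_product)
  also have "\<dots> = (\<Sum>i\<in>(UNIV :: bool set). \<Sum>t\<in>T. \<mu> (P i t))"
    using T(2) P_sub by (intro sum.cong refl) (auto simp: Q_def intro!: invariant_mean_translate[OF \<mu>])
  finally show False by (simp add: sum1)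
qed

text \<open>If there is no Foelner set, some element of \<open>S\<close> moves more than the
  proportion \<epsilon> of a given finite nonempty set out of it, so that the set grows by the
  factor 1 + \<epsilon>. Iteration yields the doubling that rules out an invariant mean.\<close>

lemma (in group) folner:
  assumes "amenable G" "finite S" "S \<subseteq> carrier G" "\<epsilon> > (0::real)"
  shows "\<exists>F. finite F \<and> F \<subseteq> carrier G \<and> F \<noteq> {} \<and>
    (\<forall>s\<in>S. (1 - \<epsilon>) * card F \<le> card {f\<in>F. s \<otimes> f \<in> F})"
proof (rule ccontr)
  assume neg: "\<not> ?thesis"
  \<comment> \<open>With \<one> added, \<open>S1 <#> F\<close> contains \<open>F\<close> itself as
    well as the points that s moves out of it.\<close>
  define S1 where "S1 = insert \<one> S"
  have S1: "finite S1" "S1 \<subseteq> carrier G" using assms by (auto simp: S1_def)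
  have fin: "finite (X <#> Y)" if "finite X" "finite Y" for X Y
    using that by (auto simp: set_mult_def)
  have step: "(1 + \<epsilon>) * card F \<le> card (S1 <#> F)" if F: "finite F" "F \<subseteq> carrier G" for F
  proof (cases "F = {}")
    case False
    then obtain s where s: "s \<in> S" "card {f\<in>F. s \<otimes> f \<in> F} < (1 - \<epsilon>) * card F"
      using neg F by (meson not_le)
    have sG: "s \<in> carrier G" using s assms by blast
    let ?E = "{f\<in>F. s \<otimes> f \<notin> F}"
    have "card F = card {f\<in>F. s \<otimes> f \<in> F} + card ?E"
      using F by (subst card_Un_disjoint[symmetric]) (auto intro!: arg_cong[where f = card])
    then have E: "card ?E \<ge> \<epsilon> * card F" using s(2) by (simp add: algebra_simps)
    have "inj_on (\<lambda>f. s \<otimes> f) ?E" using F sG by (intro inj_onI) (auto simp: subset_iff)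
    then have "card F + card ?E = card F + card ((\<lambda>f. s \<otimes> f) ` ?E)" by (simp add: card_image)
    also have "\<dots> = card (F \<union> (\<lambda>f. s \<otimes> f) ` ?E)"
      using F by (intro card_Un_disjoint[symmetric]) auto
    also have "\<dots> \<le> card (S1 <#> F)"
    proof (rule card_mono[OF fin[OF S1(1) F(1)]])
      have "f \<in> S1 <#> F" if "f \<in> F" for f
        using that F by (auto simp: set_mult_def S1_def intro!: bexI[of _ f])
      then show "F \<union> (\<lambda>f. s \<otimes> f) ` ?E \<subseteq> S1 <#> F"
        using s(1) by (auto simp: set_mult_def S1_def)
    qed
    finally have "real (card F) + real (card ?E) \<le> card (S1 <#> F)" by linarith
    then show ?thesis using E by (simp add: algebra_simps)
  qed simp
  define T where "T n = ((\<lambda>X. S1 <#> X) ^^ n) {\<one>}" for n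
  have T: "finite (T n)" "T n \<subseteq> carrier G" for n
    by (induction n) (use fin S1 setmult_subset_G in \<open>auto simp: T_def\<close>)
  have grow: "(1 + \<epsilon>) ^ n * card F \<le> card (T n <#> F)" if F: "finite F" "F \<subseteq> carrier G" for n F
  proof (induction n)
    case 0
    have "{\<one>} <#> F = F" using F by (auto simp: set_mult_def subset_iff)
    then show ?case by (simp add: T_def)
  next
    case (Suc n)
    have "(1 + \<epsilon>) ^ Suc n * card F \<le> (1 + \<epsilon>) * card (T n <#> F)"
      using Suc assms(4) by (simp add: mult.assoc)
    also have "\<dots> \<le> card (S1 <#> (T n <#> F))"
      using T F fin setmult_subset_G by (intro step) auto
    also have "S1 <#> (T n <#> F) = T (Suc n) <#> F"
      using set_mult_assoc[OF S1(2) T(2) F(2), symmetric] by (simp add: T_def)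
    finally show ?case .
  qed
  obtain n where n: "2 < (1 + \<epsilon>) ^ n" using real_arch_pow[of "1 + \<epsilon>" 2] assms(4) by auto
  have "2 * card F \<le> card (T n <#> F)" if F: "finite F" "F \<subseteq> carrier G" for F
  proof -
    have "2 * real (card F) \<le> (1 + \<epsilon>) ^ n * card F" using n by (intro mult_right_mono) auto
    then show ?thesis using grow[OF F, of n] by linarith
  qed
  then have "\<not> invariant_mean G \<mu>" for \<mu>
    by (rule not_invariant_mean_if_doubling[OF T])
  then show False using assms(1) amenable_iff by blast
qed

text \<open>With T a set of representatives of the cosets B x, every element of G is uniquely a
  product b t. The mean of Y is taken to be that of Y T: disjoint Y have disjoint products, and left
  multiplication by B passes through.\<close>

lemma (in group) amenable_subgroup:
  assumes "amenable G" "subgroup B G"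
  shows "amenable (G\<lparr>carrier := B\<rparr>)"
proof -
  obtain \<mu> where \<mu>: "invariant_mean G \<mu>" using assms(1) amenable_iff by blast
  interpret B: subgroup B G by fact
  define t where "t x = (SOME y. y \<in> B #> x)" for x
  have t: "t x \<in> B #> x" if "x \<in> carrier G" for x
    unfolding t_def by (rule someI) (rule rcos_self[OF that assms(2)])
  have t_eq: "t (b \<otimes> x) = t x" if "b \<in> B" "x \<in> carrier G" for b x
    using repr_independence[OF _ that(2) assms(2), of "b \<otimes> x"] that rcosI[OF that(1) B.subset that(2)]
    by (simp add: t_def)
  define T where "T = t ` carrier G"
  have T: "T \<subseteq> carrier G" using t r_coset_subset_G[OF B.subset] by (auto simp: T_def)
  have tT: "t u = u" if "u \<in> T" for u
  proof -
    obtain x where x: "x \<in> carrier G" "u = t x" using \<open>u \<in> T\<close> by (auto simp: T_def)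
    then obtain b where "b \<in> B" "u = b \<otimes> x" using t[OF x(1)] by (auto simp: r_coset_def)
    then show ?thesis using x t_eq by simp
  qed
  have disj: "(Y <#> T) \<inter> (Z <#> T) = {}" if YZ: "Y \<subseteq> B" "Z \<subseteq> B" "Y \<inter> Z = {}" for Y Z
  proof (rule ccontr)
    assume "(Y <#> T) \<inter> (Z <#> T) \<noteq> {}"
    then obtain y z u v where *: "y \<in> Y" "z \<in> Z" "u \<in> T" "v \<in> T" "y \<otimes> u = z \<otimes> v"
      by (auto simp: set_mult_def)
    then have "u = t (y \<otimes> u)" "v = t (z \<otimes> v)" using t_eq tT YZ T by (metis subsetD)+
    then have "u = v" using * by simp
    then have "y = z" using * YZ T B.subset by (metis right_cancel subsetD)
    then show False using * YZ by blast
  qed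
  have "invariant_mean (G\<lparr>carrier := B\<rparr>) (\<lambda>Y. \<mu> (Y <#> T))"
    unfolding invariant_mean_def
  proof (intro conjI allI impI; simp)
    fix X assume X: "X \<subseteq> B"
    show "0 \<le> \<mu> (X <#> T)"
      using X T B.subset setmult_subset_G by (intro invariant_mean_nonneg[OF \<mu>]) blast
    fix g assume "g \<in> B"
    then have "g <# X <#> T = g <# (X <#> T)"
      using X T B.subset setmult_lcos_assoc by (metis B.mem_carrier order_trans)
    moreover have "\<mu> (g <# (X <#> T)) = \<mu> (X <#> T)"
      using X T B.subset \<open>g \<in> B\<close> setmult_subset_G by (intro invariant_mean_translate[OF \<mu>]) auto
    ultimately show "\<mu> (g <# X <#> T) = \<mu> (X <#> T)" by simp
  next
    have "x \<in> B <#> T" if x: "x \<in> carrier G" for x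
    proof -
      obtain b where b: "b \<in> B" "t x = b \<otimes> x" using t[OF x] by (auto simp: r_coset_def)
      then have "x = inv b \<otimes> t x" using x by (simp add: inv_solve_left)
      then show ?thesis using b x unfolding set_mult_def T_def by blast
    qed
    then have "B <#> T = carrier G" using setmult_subset_G[OF B.subset T] by blast
    then show "\<mu> (B <#> T) = 1" using invariant_mean_carrier[OF \<mu>] by simp
  next
    fix X Y assume XY: "X \<subseteq> B" "Y \<subseteq> B" "X \<inter> Y = {}"
    have "(X \<union> Y) <#> T = (X <#> T) \<union> (Y <#> T)" by (auto simp: set_mult_def)
    then show "\<mu> (X \<union> Y <#> T) = \<mu> (X <#> T) + \<mu> (Y <#> T)"
      using XY T B.subset setmult_subset_G disj[OF XY]
      by (simp add: invariant_mean_Un[OF \<mu>])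
  qed
  then show ?thesis using amenable_iff by blast
qed

section \<open>Characters of order \<open>p\<close>\<close>

text \<open>Homomorphisms to F_p in the multiplicative model, that is, the dual space of M/[M,M]M^p.
  The value 1 off the carrier makes equality of characters equality of functions.\<close>

definition chars :: "nat \<Rightarrow> ('a, 'm) monoid_scheme \<Rightarrow> ('a \<Rightarrow> complex) set" where
  "chars p M = {\<chi>. (\<forall>x. \<chi> x ^ p = 1) \<and> (\<forall>x. x \<notin> carrier M \<longrightarrow> \<chi> x = 1) \<and>
     (\<forall>x\<in>carrier M. \<forall>y\<in>carrier M. \<chi> (x \<otimes>\<^bsub>M\<^esub> y) = \<chi> x * \<chi> y)}"

lemma charsI:
  assumes "\<And>x. x \<in> carrier M \<Longrightarrow> \<chi> x ^ p = 1" "\<And>x. x \<notin> carrier M \<Longrightarrow> \<chi> x = 1"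
    "\<And>x y. x \<in> carrier M \<Longrightarrow> y \<in> carrier M \<Longrightarrow> \<chi> (x \<otimes>\<^bsub>M\<^esub> y) = \<chi> x * \<chi> y"
  shows "\<chi> \<in> chars p M"
proof -
  have "\<chi> x ^ p = 1" for x using assms(1,2)[of x] by (cases "x \<in> carrier M") simp_all
  then show ?thesis using assms(2,3) unfolding chars_def by simp
qed

lemma chars_root: "\<chi> \<in> chars p M \<Longrightarrow> \<chi> x ^ p = 1"
  and chars_outside: "\<chi> \<in> chars p M \<Longrightarrow> x \<notin> carrier M \<Longrightarrow> \<chi> x = 1"
  and chars_mult: "\<chi> \<in> chars p M \<Longrightarrow> x \<in> carrier M \<Longrightarrow> y \<in> carrier M \<Longrightarrow> \<chi> (x \<otimes>\<^bsub>M\<^esub> y) = \<chi> x * \<chi> y"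
  by (auto simp: chars_def)

lemma fun_group_chars: "fun_group p (chars p M)"
  unfolding fun_group_def
proof (intro conjI ballI allI)
  show "(\<lambda>_. 1) \<in> chars p M" by (rule charsI) auto
  fix \<chi> assume \<chi>: "\<chi> \<in> chars p M"
  show "\<chi> x ^ p = 1" for x using chars_root[OF \<chi>] .
  fix \<psi> assume \<psi>: "\<psi> \<in> chars p M"
  show "(\<lambda>x. \<chi> x * \<psi> x) \<in> chars p M"
    by (rule charsI)
      (simp_all add: power_mult_distrib chars_root[OF \<chi>] chars_root[OF \<psi>] chars_outside[OF \<chi>]
        chars_outside[OF \<psi>] chars_mult[OF \<chi>] chars_mult[OF \<psi>])
qed

context group
begin

lemma chars_nonzero: "p > 0 \<Longrightarrow> \<chi> \<in> chars p G \<Longrightarrow> \<chi> x \<noteq> 0"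
  by (rule fun_group_nonzero[OF fun_group_chars])

lemma chars_one: "p > 0 \<Longrightarrow> \<chi> \<in> chars p G \<Longrightarrow> \<chi> \<one> = 1"
  using chars_mult[of \<chi> p G \<one> \<one>] chars_nonzero[of p \<chi> \<one>] by simp

lemma chars_inv: "p > 0 \<Longrightarrow> \<chi> \<in> chars p G \<Longrightarrow> x \<in> carrier G \<Longrightarrow> \<chi> (inv x) = inverse (\<chi> x)"
  using chars_mult[of \<chi> p G x "inv x"] chars_one[of p \<chi>] by (simp add: inverse_unique)

lemma chars_pow: "p > 0 \<Longrightarrow> \<chi> \<in> chars p G \<Longrightarrow> x \<in> carrier G \<Longrightarrow> \<chi> (x [^] (n::nat)) = \<chi> x ^ n"
  by (induction n) (simp_all add: chars_one chars_mult)

lemma subgroup_chars_kernel: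
  assumes "p > 0" "\<chi> \<in> chars p G"
  shows "subgroup {x\<in>carrier G. \<chi> x = 1} G"
  by (rule subgroupI)
    (use one_closed chars_one[OF assms] in \<open>auto simp: chars_inv[OF assms] chars_mult[OF assms(2)]\<close>)

lemma subgroup_Union_chain:
  assumes "C \<noteq> {}" "subset.chain {H. subgroup H G} C"
  shows "subgroup (\<Union>C) G"
proof (rule subgroupI)
  have sub: "subgroup H G" if "H \<in> C" for H using assms(2) that by (auto simp: subset_chain_def)
  show "\<Union>C \<subseteq> carrier G" using sub subgroup.subset by blast
  show "\<Union>C \<noteq> {}" using assms(1) sub subgroup.one_closed by blast
  show "inv a \<in> \<Union>C" if "a \<in> \<Union>C" for a using that sub subgroup.m_inv_closed by (metis Union_iff)
  show "a \<otimes> b \<in> \<Union>C" if ab: "a \<in> \<Union>C" "b \<in> \<Union>C" for a b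
  proof -
    obtain H K where HK: "H \<in> C" "a \<in> H" "K \<in> C" "b \<in> K" using ab by blast
    then have "H \<subseteq> K \<or> K \<subseteq> H" using assms(2) by (auto simp: subset_chain_def)
    then show ?thesis
    proof
      assume "H \<subseteq> K"
      then have "a \<otimes> b \<in> K" using HK sub[OF HK(3)] by (intro subgroup.m_closed) auto
      then show ?thesis using HK by blast
    next
      assume "K \<subseteq> H"
      then have "a \<otimes> b \<in> H" using HK sub[OF HK(1)] by (intro subgroup.m_closed) auto
      then show ?thesis using HK by blast
    qed
  qed
qed

end

text \<open>Take C maximal among the subgroups that contain B and avoid x; Zorn's lemma is used
  since the group may be infinite. Maximality forces every element to be x^j modulo C with j unique
  modulo p, and the character reads off this exponent.\<close>

lemma (in comm_group) exists_char_separating: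
  assumes "prime p" and exp: "\<And>y. y \<in> carrier G \<Longrightarrow> y [^] p = \<one>"
    and B: "subgroup B G" and x: "x \<in> carrier G" "x \<notin> B"
  shows "\<exists>\<chi>\<in>chars p G. (\<forall>b\<in>B. \<chi> b = 1) \<and> \<chi> x \<noteq> 1"
proof -
  have p: "p > 0" using \<open>prime p\<close> prime_gt_0_nat by blast
  define \<A> where "\<A> = {C. subgroup C G \<and> B \<subseteq> C \<and> x \<notin> C}"
  have "\<exists>C\<in>\<A>. \<forall>X\<in>\<A>. C \<subseteq> X \<longrightarrow> X = C"
  proof (rule subset_Zorn_nonempty)
    show "\<A> \<noteq> {}" using B x by (auto simp: \<A>_def)
    fix \<C> assume \<C>: "\<C> \<noteq> {}" "subset.chain \<A> \<C>"
    have "subset.chain {H. subgroup H G} \<C>" using \<C>(2) by (auto simp: subset_chain_def \<A>_def)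
    then show "\<Union>\<C> \<in> \<A>"
      using \<C> subgroup_Union_chain[OF \<C>(1)] by (auto simp: subset_chain_def \<A>_def)
  qed
  then obtain C where C: "subgroup C G" "B \<subseteq> C" "x \<notin> C"
    and max: "\<And>X. subgroup X G \<Longrightarrow> C \<subseteq> X \<Longrightarrow> x \<notin> X \<Longrightarrow> X = C"
    by (auto simp: \<A>_def)
  interpret C: subgroup C G by fact
  have Cpow: "c [^] (n::nat) \<in> C" if "c \<in> C" for c n
    by (induction n) (use that in auto)
  have inverse_mod: "\<exists>j b. i * j = p * b + 1" if "\<not> p dvd i" for i
  proof -
    have "i \<noteq> 0" using that by (intro notI) simp
    then obtain j b where "i * j = p * b + gcd i p" using bezout_nat by blast
    moreover have "gcd i p = 1"
      using prime_imp_coprime_nat[OF \<open>prime p\<close> that] by (simp add: coprime_iff_gcd_eq_1 gcd.commute)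
    ultimately show ?thesis by auto
  qed
  have pow_inverse: "(y [^] i) [^] j = y" if "y \<in> carrier G" "i * j = p * b + 1" for y i j b
  proof -
    have "(y [^] i) [^] j = (y [^] p) [^] b \<otimes> y"
      using that by (simp add: nat_pow_pow)
    then show ?thesis using that exp by simp
  qed
  have rep: "\<exists>c\<in>C. \<exists>j::nat. y = c \<otimes> x [^] j" if y: "y \<in> carrier G" for y
  proof (cases "y \<in> C")
    case True
    then show ?thesis using y by (intro bexI[of _ y] exI[of _ 0]) auto
  next
    case False
    \<comment> \<open>\<open>D\<close> is the subgroup generated by C and y. It is strictly larger
      than C, so it contains x, and x = c y^i can be solved for y because i is invertible modulo p.
      Natural exponents suffice, as y^(i (p - 1)) is the inverse of y^i.\<close>
    define D where "D = {c \<otimes> y [^] (i::nat) | c i. c \<in> C}"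
    have DI: "c \<otimes> y [^] (i::nat) \<in> D" if "c \<in> C" for c i using that by (auto simp: D_def)
    have "subgroup D G"
    proof (rule subgroupI)
      show "D \<subseteq> carrier G" using y C.subset by (auto simp: D_def)
      show "D \<noteq> {}" using DI[OF C.one_closed] by blast
      fix u assume "u \<in> D"
      then obtain c i where u: "c \<in> C" "u = c \<otimes> y [^] (i::nat)" by (auto simp: D_def)
      have "y [^] i \<otimes> y [^] (i * (p - 1)) = y [^] (i * p)"
        using y p by (simp add: nat_pow_mult flip: mult_Suc_right)
      also have "\<dots> = \<one>" using exp[of "y [^] i"] y by (simp add: nat_pow_pow)
      finally have "y [^] (i * (p - 1)) = inv (y [^] i)"
        using y by (metis inv_equality m_comm nat_pow_closed)
      then have "inv u = inv c \<otimes> y [^] (i * (p - 1))" using u y by (simp add: inv_mult)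
      then show "inv u \<in> D" using DI u by simp
      fix v assume "v \<in> D"
      then obtain d j where v: "d \<in> C" "v = d \<otimes> y [^] (j::nat)" by (auto simp: D_def)
      have "u \<otimes> v = (c \<otimes> d) \<otimes> (y [^] i \<otimes> y [^] j)" using u v y by (simp add: m_ac)
      then have "u \<otimes> v = (c \<otimes> d) \<otimes> y [^] (i + j)" using y by (simp add: nat_pow_mult)
      then show "u \<otimes> v \<in> D" using DI u v by simp
    qed
    moreover have "C \<subseteq> D"
    proof
      fix c assume "c \<in> C"
      then show "c \<in> D" using DI[of c 0] by simp
    qed
    moreover have "y \<in> D" using DI[OF C.one_closed, of 1] y by simp
    ultimately have "x \<in> D" using max[of D] False by blast
    then obtain c i where ci: "c \<in> C" "x = c \<otimes> y [^] (i::nat)" by (auto simp: D_def)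
    have "\<not> p dvd i"
    proof
      assume "p dvd i"
      then obtain l where "i = p * l" by blast
      then have "y [^] i = (y [^] p) [^] l" using y by (simp add: nat_pow_pow)
      then show False using ci C(3) y exp by simp
    qed
    then obtain j b where j: "i * j = p * b + 1" using inverse_mod by blast
    have "x [^] j = c [^] j \<otimes> y"
      using ci y pow_inverse[OF y j] by (simp add: nat_pow_distrib)
    then have "y = inv (c [^] j) \<otimes> x [^] j"
      using ci y x Cpow by (simp add: inv_solve_left)
    then show ?thesis using Cpow[OF ci(1)] by blast
  qed
  \<comment> \<open>Otherwise x^(j - i) would lie in C with j - i invertible modulo p, and x would
    be a power of it.\<close>
  have uniq: "i mod p = j mod p"
    if cd: "c \<in> C" "d \<in> C" "c \<otimes> x [^] i = d \<otimes> x [^] j" and ij: "i \<le> j" for c d and i j :: nat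
  proof (rule ccontr)
    assume "i mod p \<noteq> j mod p"
    then have "\<not> p dvd j - i" using mod_eq_dvd_iff_nat[OF ij, of p] by simp
    then obtain k b where k: "(j - i) * k = p * b + 1" using inverse_mod by blast
    have "x [^] j = x [^] i \<otimes> x [^] (j - i)" using x ij by (simp add: nat_pow_mult)
    then have "x [^] i \<otimes> c = x [^] i \<otimes> (d \<otimes> x [^] (j - i))" using cd x by (simp add: m_ac)
    then have "c = d \<otimes> x [^] (j - i)" using cd x by simp
    then have "x [^] (j - i) = inv d \<otimes> c" using cd x by (simp add: inv_solve_left)
    then have "x [^] (j - i) \<in> C" using cd by simp
    then have "(x [^] (j - i)) [^] k \<in> C" by (rule Cpow)
    then show False using pow_inverse[OF x(1) k] C(3) by simp
  qed
  obtain \<zeta> :: complex where \<zeta>: "\<zeta> ^ p = 1" "\<zeta> \<noteq> 1"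
  proof -
    have "card {z::complex. z ^ p = 1} \<noteq> card {1::complex}"
      using card_roots_unity_eq[OF p] prime_gt_1_nat[OF \<open>prime p\<close>] by simp
    then have "{z::complex. z ^ p = 1} \<noteq> {1}" by metis
    then have "\<exists>z::complex. z ^ p = 1 \<and> z \<noteq> 1" by auto
    then show ?thesis using that by blast
  qed
  have \<zeta>_mod: "\<zeta> ^ (k mod p) = \<zeta> ^ k" for k
    using \<zeta>(1) by (metis div_mult_mod_eq mult_1 mult.commute power_add power_mult power_one)
  define \<chi> where "\<chi> y = (if y \<in> carrier G then \<zeta> ^ (SOME j. \<exists>c\<in>C. y = c \<otimes> x [^] (j::nat)) else 1)" for y
  have \<chi>: "\<chi> (c \<otimes> x [^] j) = \<zeta> ^ j" if c: "c \<in> C" for c and j :: nat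
  proof -
    define i where "i = (SOME i. \<exists>d\<in>C. c \<otimes> x [^] j = d \<otimes> x [^] (i::nat))"
    have "\<exists>d\<in>C. c \<otimes> x [^] j = d \<otimes> x [^] i" unfolding i_def by (rule someI[of _ j]) (use c in blast)
    then obtain d where d: "d \<in> C" "c \<otimes> x [^] j = d \<otimes> x [^] i" by blast
    have "i mod p = j mod p"
    proof (cases "i \<le> j")
      case True
      show ?thesis by (rule uniq[OF d(1) c d(2)[symmetric] True])
    next
      case False
      then show ?thesis by (intro uniq[OF c d(1) d(2), symmetric]) simp
    qed
    then have "\<zeta> ^ i = \<zeta> ^ j" using \<zeta>_mod by metis
    then show ?thesis using c x by (simp add: \<chi>_def i_def)
  qed
  have "\<chi> \<in> chars p G"
  proof (rule charsI)
    show "\<chi> y ^ p = 1" for y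
    proof -
      have "(\<zeta> ^ n) ^ p = 1" for n using \<zeta>(1) by (metis mult.commute power_mult power_one)
      then show ?thesis by (simp add: \<chi>_def)
    qed
    show "\<chi> y = 1" if "y \<notin> carrier G" for y using that by (simp add: \<chi>_def)
    fix y z assume "y \<in> carrier G" "z \<in> carrier G"
    then obtain c i d j where *: "c \<in> C" "d \<in> C" "y = c \<otimes> x [^] (i::nat)" "z = d \<otimes> x [^] (j::nat)"
      using rep by metis
    have "y \<otimes> z = (c \<otimes> d) \<otimes> (x [^] i \<otimes> x [^] j)" using * x by (simp add: m_ac)
    then have "y \<otimes> z = (c \<otimes> d) \<otimes> x [^] (i + j)" using x by (simp add: nat_pow_mult)
    then show "\<chi> (y \<otimes> z) = \<chi> y * \<chi> z" using * by (simp add: \<chi> power_add)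
  qed
  moreover have "\<chi> b = 1" if "b \<in> B" for b using \<chi>[of b 0] that C(2) by auto
  moreover have "\<chi> x \<noteq> 1" using \<chi>[OF C.one_closed, of 1] x \<zeta> by simp
  ultimately show ?thesis by blast
qed

section \<open>Characters and the quotient by commutators and p-th powers\<close>

context group
begin

text \<open>The subgroup divided out in \<open>d_p\<close>. For finite p-groups it is the Frattini
  subgroup, hence the name.\<close>

definition frattini_p :: "nat \<Rightarrow> 'a set" where
  "frattini_p p = derived G (carrier G) <#> generate G ((\<lambda>h. h [^] p) ` carrier G)"

lemma subgroup_frattini_p: "subgroup (frattini_p p) G"
  and derived_subset_frattini_p: "derived G (carrier G) \<subseteq> frattini_p p"
  and pow_in_frattini_p: "x \<in> carrier G \<Longrightarrow> x [^] p \<in> frattini_p p"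
proof -
  let ?P = "(\<lambda>h. h [^] p) ` carrier G"
  have gen: "subgroup (generate G ?P) G" by (intro generate_is_subgroup) auto
  have der: "subgroup (derived G (carrier G)) G" by (rule derived_is_subgroup) auto
  show "subgroup (frattini_p p) G"
    unfolding frattini_p_def by (rule mult_norm_subgroup[OF derived_self_is_normal gen])
  show "derived G (carrier G) \<subseteq> frattini_p p"
  proof
    fix d assume d: "d \<in> derived G (carrier G)"
    then have "d \<otimes> \<one> \<in> frattini_p p"
      unfolding frattini_p_def set_mult_def using subgroup.one_closed[OF gen] by blast
    then show "d \<in> frattini_p p" using d subgroup.mem_carrier[OF der] by simp
  qed
  show "x [^] p \<in> frattini_p p" if "x \<in> carrier G"
  proof -
    have "\<one> \<otimes> x [^] p \<in> frattini_p p"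
      unfolding frattini_p_def set_mult_def
      using subgroup.one_closed[OF der] that by (blast intro: generate.incl)
    then show ?thesis using that by simp
  qed
qed

lemma commutator_in_frattini_p:
  assumes "x \<in> carrier G" "y \<in> carrier G"
  shows "x \<otimes> y \<otimes> inv x \<otimes> inv y \<in> frattini_p p"
proof -
  have "x \<otimes> y \<otimes> inv x \<otimes> inv y \<in> derived G (carrier G)"
    unfolding derived_def by (rule generate.incl) (use assms in auto)
  then show ?thesis using derived_subset_frattini_p by blast
qed

lemma normal_frattini_p: "frattini_p p \<lhd> G"
proof (rule normal_invI[OF subgroup_frattini_p])
  fix x h assume x: "x \<in> carrier G" and h: "h \<in> frattini_p p"
  interpret F: subgroup "frattini_p p" G by (rule subgroup_frattini_p)
  have "(x \<otimes> h \<otimes> inv x \<otimes> inv h) \<otimes> h \<in> frattini_p p"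
    using commutator_in_frattini_p x h by simp
  then show "x \<otimes> h \<otimes> inv x \<in> frattini_p p" using x h by (simp add: m_assoc)
qed

lemma comm_group_Mod_frattini_p: "comm_group (G Mod frattini_p p)"
proof -
  interpret N: normal "frattini_p p" G by (rule normal_frattini_p)
  interpret Q: group "G Mod frattini_p p" by (rule N.factorgroup_is_group)
  show ?thesis
  proof (rule Q.group_comm_groupI)
    fix X Y assume "X \<in> carrier (G Mod frattini_p p)" "Y \<in> carrier (G Mod frattini_p p)"
    then obtain x y where xy: "x \<in> carrier G" "y \<in> carrier G" "X = frattini_p p #> x" "Y = frattini_p p #> y"
      by (auto simp: carrier_FactGroup)
    have "inv y \<otimes> (y \<otimes> x) = x" using xy by (simp flip: m_assoc)
    then have "x \<otimes> y = (x \<otimes> y \<otimes> inv x \<otimes> inv y) \<otimes> (y \<otimes> x)"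
      using xy by (simp add: m_assoc)
    then have "x \<otimes> y \<in> frattini_p p #> (y \<otimes> x)"
      using commutator_in_frattini_p[OF xy(1,2)] by (auto simp: r_coset_def)
    then have "frattini_p p #> (x \<otimes> y) = frattini_p p #> (y \<otimes> x)"
      using repr_independence[OF _ _ N.is_subgroup, of "x \<otimes> y" "y \<otimes> x"] xy by simp
    then show "X \<otimes>\<^bsub>G Mod frattini_p p\<^esub> Y = Y \<otimes>\<^bsub>G Mod frattini_p p\<^esub> X"
      using xy by (simp add: N.rcos_sum)
  qed
qed

lemma chars_frattini_p:
  assumes "p > 0" "\<chi> \<in> chars p G" "x \<in> frattini_p p"
  shows "\<chi> x = 1"
proof -
  let ?K = "{x\<in>carrier G. \<chi> x = 1}"
  note K = subgroup_chars_kernel[OF assms(1,2)]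
  have "derived G (carrier G) \<subseteq> ?K"
    unfolding derived_def
    by (rule generate_subgroup_incl[OF _ K])
      (auto simp: chars_mult[OF assms(2)] chars_inv[OF assms(1,2)] chars_nonzero[OF assms(1,2)] field_simps)
  moreover have "generate G ((\<lambda>h. h [^] p) ` carrier G) \<subseteq> ?K"
    by (rule generate_subgroup_incl[OF _ K]) (auto simp: chars_pow[OF assms(1,2)] chars_root[OF assms(2)])
  ultimately show ?thesis
    using assms(3) subgroup.m_closed[OF K] by (auto simp: frattini_p_def set_mult_def subset_iff)
qed

text \<open>\<open>d_p\<close> counts generators of Q = G/[G,G]G^p, and \<open>chars\<close> is the
  dual of Q. Characters are determined by their values on generators of Q, which gives one
  inequality. Conversely, a set of coordinates for the characters generates Q, since a proper
  subgroup is annihilated by some nontrivial character.\<close>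

lemma card_chars:
  assumes "prime p" "finite (chars p G)"
  shows "card (chars p G) = p ^ d_p p G"
proof -
  note p = prime_gt_0_nat[OF \<open>prime p\<close>]
  let ?\<Phi> = "frattini_p p" and ?Q = "G Mod frattini_p p"
  interpret N: normal ?\<Phi> G by (rule normal_frattini_p)
  interpret Q: comm_group ?Q by (rule comm_group_Mod_frattini_p)
  interpret \<pi>: group_hom G ?Q "\<lambda>x. ?\<Phi> #> x"
    by (intro group_hom.intro group_hom_axioms.intro N.r_coset_hom_Mod) (rule is_group Q.is_group)+
  have expQ: "X [^]\<^bsub>?Q\<^esub> p = \<one>\<^bsub>?Q\<^esub>" if "X \<in> carrier ?Q" for X
  proof -
    obtain x where x: "x \<in> carrier G" "X = ?\<Phi> #> x" using \<open>X \<in> carrier ?Q\<close> by (auto simp: carrier_FactGroup)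
    have "X [^]\<^bsub>?Q\<^esub> p = ?\<Phi> #> (x [^] p)" using x \<pi>.hom_nat_pow by simp
    also have "\<dots> = ?\<Phi>" using pow_in_frattini_p[OF x(1)] N.rcos_const[OF is_group] by simp
    finally show ?thesis by simp
  qed
  obtain E where E: "finite E" "card (chars p G) = p ^ card E"
    and det: "\<And>\<chi>. \<chi> \<in> chars p G \<Longrightarrow> (\<And>x. x \<in> E \<Longrightarrow> \<chi> x = 1) \<Longrightarrow> \<chi> = (\<lambda>_. 1)"
    using fun_group_coordinates[OF assms(1) fun_group_chars assms(2)] by blast
  have lower: "card E \<le> card S"
    if S: "finite S" "S \<subseteq> carrier ?Q" "generate ?Q S = carrier ?Q" for S
  proof -
    have "\<exists>x\<in>carrier G. s = ?\<Phi> #> x" if "s \<in> S" for s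
      using that S(2) by (auto simp: carrier_FactGroup)
    then obtain r where r: "\<And>s. s \<in> S \<Longrightarrow> r s \<in> carrier G" "\<And>s. s \<in> S \<Longrightarrow> s = ?\<Phi> #> r s" by metis
    have triv: "\<psi> = (\<lambda>_. 1)" if \<psi>: "\<psi> \<in> chars p G" "\<And>s. s \<in> S \<Longrightarrow> \<psi> (r s) = 1" for \<psi>
    proof (intro ext)
      fix x
      let ?K = "{x\<in>carrier G. \<psi> x = 1}"
      have K: "subgroup ((\<lambda>x. ?\<Phi> #> x) ` ?K) ?Q"
        by (rule \<pi>.subgroup_img_is_subgroup[OF subgroup_chars_kernel[OF p \<psi>(1)]])
      have "?\<Phi> #> r s \<in> (\<lambda>x. ?\<Phi> #> x) ` ?K" if "s \<in> S" for s
        using r(1) \<psi>(2) that by blast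
      then have "S \<subseteq> (\<lambda>x. ?\<Phi> #> x) ` ?K" by (intro subsetI) (simp only: r(2)[symmetric])
      then have "carrier ?Q \<subseteq> (\<lambda>x. ?\<Phi> #> x) ` ?K"
        using Q.generate_subgroup_incl[OF _ K] S(3) by blast
      show "\<psi> x = 1"
      proof (cases "x \<in> carrier G")
        case True
        then have "?\<Phi> #> x \<in> carrier ?Q" by (auto simp: carrier_FactGroup)
        then obtain k where k: "k \<in> carrier G" "\<psi> k = 1" "?\<Phi> #> x = ?\<Phi> #> k"
          using \<open>carrier ?Q \<subseteq> _\<close> by auto
        then have "x \<in> ?\<Phi> #> k" using rcos_self[OF True N.is_subgroup] by simp
        then obtain h where "h \<in> ?\<Phi>" "x = h \<otimes> k" by (auto simp: r_coset_def)
        then show ?thesis using k chars_mult[OF \<psi>(1)] chars_frattini_p[OF p \<psi>(1)] by simp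
      qed (use chars_outside[OF \<psi>(1)] in simp)
    qed
    let ?ev = "\<lambda>\<chi>. \<lambda>s\<in>S. \<chi> (r s)"
    have "inj_on ?ev (chars p G)"
    proof (rule inj_onI)
      fix \<chi> \<psi> assume *: "\<chi> \<in> chars p G" "\<psi> \<in> chars p G" "?ev \<chi> = ?ev \<psi>"
      have "\<chi> (r s) = \<psi> (r s)" if "s \<in> S" for s using fun_cong[OF *(3), of s] that by simp
      then show "\<chi> = \<psi>"
        using chars_nonzero[OF p *(2)]
        by (intro fun_group_eqI[OF fun_group_chars p *(2)] triv fun_group_divide[OF fun_group_chars p] *) auto
    qed
    moreover have "?ev ` chars p G \<subseteq> (S \<rightarrow>\<^sub>E {z. z ^ p = 1})" using chars_root by auto
    moreover have "finite (S \<rightarrow>\<^sub>E {z::complex. z ^ p = 1})"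
      using S(1) p by (intro finite_PiE) (auto intro: finite_roots_unity)
    ultimately have "card (chars p G) \<le> card (S \<rightarrow>\<^sub>E {z::complex. z ^ p = 1})"
      by (rule card_inj_on_le)
    then have "p ^ card E \<le> p ^ card S" using S(1) E(2) by (simp add: card_PiE card_roots_unity_eq[OF p])
    then show ?thesis using prime_gt_1_nat[OF assms(1)] by simp
  qed
  define S where "S = (\<lambda>x. ?\<Phi> #> x) ` (E \<inter> carrier G)"
  have S: "finite S" "S \<subseteq> carrier ?Q" using E by (auto simp: S_def carrier_FactGroup)
  have "generate ?Q S = carrier ?Q"
  proof (rule ccontr)
    assume "generate ?Q S \<noteq> carrier ?Q"
    then obtain X where X: "X \<in> carrier ?Q" "X \<notin> generate ?Q S" using Q.generate_incl[OF S(2)] by blast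
    obtain \<chi> where \<chi>: "\<chi> \<in> chars p ?Q" "\<And>b. b \<in> generate ?Q S \<Longrightarrow> \<chi> b = 1" "\<chi> X \<noteq> 1"
      using Q.exists_char_separating[OF assms(1) expQ Q.generate_is_subgroup[OF S(2)] X] by blast
    define \<psi> where "\<psi> x = (if x \<in> carrier G then \<chi> (?\<Phi> #> x) else 1)" for x
    have "\<psi> \<in> chars p G"
    proof (rule charsI)
      show "\<psi> x ^ p = 1" for x using chars_root[OF \<chi>(1)] by (simp add: \<psi>_def)
      fix x y assume "x \<in> carrier G" "y \<in> carrier G"
      then show "\<psi> (x \<otimes> y) = \<psi> x * \<psi> y"
        using chars_mult[OF \<chi>(1) \<pi>.hom_closed \<pi>.hom_closed] \<pi>.hom_mult by (simp add: \<psi>_def)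
    qed (simp add: \<psi>_def)
    moreover have "\<psi> x = 1" if "x \<in> E" for x
      using that \<chi>(2) by (auto simp: \<psi>_def S_def intro: generate.incl)
    ultimately have "\<psi> = (\<lambda>_. 1)" using det by blast
    moreover obtain x where "x \<in> carrier G" "X = ?\<Phi> #> x" using X by (auto simp: carrier_FactGroup)
    ultimately show False using \<chi>(3) by (auto simp: \<psi>_def dest: fun_cong[of _ _ x])
  qed
  then have ex: "\<exists>S. finite S \<and> S \<subseteq> carrier ?Q \<and> generate ?Q S = carrier ?Q \<and> card S \<le> card E"
    using S E(1) by (intro exI[of _ S]) (auto simp: S_def intro: order.trans[OF card_image_le] card_mono)
  have "d_p p G = Inf {card S | S. finite S \<and> S \<subseteq> carrier ?Q \<and> generate ?Q S = carrier ?Q}"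
    by (simp add: d_p_def min_generators_def frattini_p_def)
  also have "\<dots> = card E"
  proof (rule antisym)
    show "Inf {card S | S. finite S \<and> S \<subseteq> carrier ?Q \<and> generate ?Q S = carrier ?Q} \<le> card E"
    proof -
      obtain S where "finite S" "S \<subseteq> carrier ?Q" "generate ?Q S = carrier ?Q" "card S \<le> card E"
        using ex by blast
      then show ?thesis by (intro cInf_lower2[of "card S"]) auto
    qed
    show "card E \<le> Inf {card S | S. finite S \<and> S \<subseteq> carrier ?Q \<and> generate ?Q S = carrier ?Q}"
      using ex lower by (intro cInf_greatest) auto
  qed
  finally show ?thesis using E(2) by simp
qed

end

lemma finite_fun_group:
  assumes W: "fun_group p W" "p > 0" and "finite E"
    and det: "\<And>w. w \<in> W \<Longrightarrow> (\<And>x. x \<in> E \<Longrightarrow> w x = 1) \<Longrightarrow> w = (\<lambda>_. 1)"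
  shows "finite W"
proof -
  let ?ev = "\<lambda>w. \<lambda>x\<in>E. w x"
  have "inj_on ?ev W"
  proof (rule inj_onI)
    fix v w assume vw: "v \<in> W" "w \<in> W" "?ev v = ?ev w"
    have "v x = w x" if "x \<in> E" for x using fun_cong[OF vw(3), of x] that by simp
    then show "v = w"
      using fun_group_nonzero[OF W vw(2)] by (intro fun_group_eqI[OF W vw(2)] det fun_group_divide[OF W] vw) auto
  qed
  moreover have "?ev ` W \<subseteq> (E \<rightarrow>\<^sub>E {z. z ^ p = 1})" using fun_group_root[OF W(1)] by auto
  moreover have "finite (E \<rightarrow>\<^sub>E {z::complex. z ^ p = 1})"
    using assms(2,3) by (intro finite_PiE) (auto intro: finite_roots_unity)
  ultimately show ?thesis by (meson finite_imageD finite_subset)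
qed

section \<open>Cocycles on finite quotients\<close>

definition coset_rep :: "'a set \<Rightarrow> 'a" where
  "coset_rep D = (SOME x. x \<in> D)"

section \<open>Coset representatives, indices, and functions on coset spaces\<close>

context group
begin

lemma coset_rep_in:
  assumes "subgroup U G" "x \<in> carrier G"
  shows "coset_rep (U #> x) \<in> U #> x"
  unfolding coset_rep_def by (rule someI) (rule rcos_self[OF assms(2,1)])

lemma coset_rep_rcosets:
  assumes "subgroup U G" "D \<in> rcosets U"
  shows "coset_rep D \<in> carrier G" "U #> coset_rep D = D"
proof -
  obtain x where x: "x \<in> carrier G" "D = U #> x" using assms(2) by (auto simp: RCOSETS_def)
  then show "coset_rep D \<in> carrier G"
    using r_coset_subset_G[OF subgroup.subset[OF assms(1)] x(1)] coset_rep_in[OF assms(1)] by blast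
  show "U #> coset_rep D = D" using repr_independence[OF _ x(1) assms(1)] coset_rep_in[OF assms(1)] x by simp
qed

text \<open>Functions on the quotient are represented by functions on G that are invariant under
  left multiplication by H. For normal H this identity shows that multiplication by k descends to
  the quotient.\<close>

lemma mult_conj:
  assumes "k \<in> carrier G" "h \<in> carrier G" "x \<in> carrier G"
  shows "k \<otimes> (h \<otimes> x) = (k \<otimes> h \<otimes> inv k) \<otimes> (k \<otimes> x)"
proof -
  have "inv k \<otimes> (k \<otimes> x) = x" using assms by (simp flip: m_assoc)
  then show ?thesis using assms by (simp add: m_assoc)
qed

lemma subset_set_mult:
  assumes "subgroup H G" "subgroup K G"
  shows "H \<subseteq> H <#> K" "K \<subseteq> H <#> K"
proof -
  have "h \<otimes> \<one> \<in> H <#> K" if "h \<in> H" for h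
    using that subgroup.one_closed[OF assms(2)] unfolding set_mult_def by blast
  then show "H \<subseteq> H <#> K" using subgroup.mem_carrier[OF assms(1)] by fastforce
  have "\<one> \<otimes> k \<in> H <#> K" if "k \<in> K" for k
    using that subgroup.one_closed[OF assms(1)] unfolding set_mult_def by blast
  then show "K \<subseteq> H <#> K" using subgroup.mem_carrier[OF assms(2)] by fastforce
qed

lemma subgroup_set_mult_absorb:
  assumes "subgroup N G" "subgroup S G" "N \<subseteq> S"
  shows "N <#> S = S"
proof
  show "N <#> S \<subseteq> S" using assms(3) subgroup.m_closed[OF assms(2)] by (auto simp: set_mult_def)
  show "S \<subseteq> N <#> S" by (rule subset_set_mult(2)[OF assms(1,2)])
qed

text \<open>A coset of H K decomposes into the cosets H k b, with b its representative and k running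
  over K modulo K Int H. The identity comes from a bijection with a product, so it also holds for
  infinite indices, where \<open>card\<close> is 0.\<close>

lemma rcosets_factor:
  assumes "H \<lhd> G" "subgroup K G"
  defines "U \<equiv> H <#> K" and "M \<equiv> K \<inter> H"
  shows "card (rcosets H) = card (rcosets\<^bsub>G\<lparr>carrier := K\<rparr>\<^esub> M) * card (rcosets U)"
proof -
  interpret H: normal H G by fact
  interpret K: subgroup K G by fact
  interpret U: subgroup U G unfolding U_def by (rule mult_norm_subgroup[OF assms(1,2)])
  interpret GK: group "G\<lparr>carrier := K\<rparr>" by (rule subgroup_imp_group[OF assms(2)])
  have "subgroup M (G\<lparr>carrier := K\<rparr>)"
    unfolding M_def using subgroups_Inter_pair[OF assms(2) H.subgroup_axioms] by (intro subgroup_incl[OF _ assms(2)]) auto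
  then interpret M: subgroup M "G\<lparr>carrier := K\<rparr>" .
  have MG: "subgroup M G" unfolding M_def by (rule subgroups_Inter_pair[OF assms(2) H.subgroup_axioms])
  note b = coset_rep_rcosets[OF U.subgroup_axioms]
  have gK: "H <#> (M #>\<^bsub>G\<lparr>carrier := K\<rparr>\<^esub> k) #> y = H #> (k \<otimes> y)" if "k \<in> K" "y \<in> carrier G" for k y
  proof -
    have "H <#> M = H"
    proof
      show "H <#> M \<subseteq> H" by (auto simp: set_mult_def M_def)
      show "H \<subseteq> H <#> M"
      proof
        fix h assume "h \<in> H"
        then have "h \<otimes> \<one> \<in> H <#> M" using subgroup.one_closed[OF MG] unfolding set_mult_def by blast
        then show "h \<in> H <#> M" using \<open>h \<in> H\<close> by simp
      qed
    qed
    then have "H <#> (M #> k) = H #> k"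
      using setmult_rcos_assoc[OF H.subset subgroup.subset[OF MG], of k] that by simp
    then show ?thesis using that by (simp add: coset_mult_assoc H.subset)
  qed
  let ?g = "\<lambda>(C, D). H <#> C #> coset_rep D"
  let ?X = "rcosets\<^bsub>G\<lparr>carrier := K\<rparr>\<^esub> M"
  have X: "\<exists>k\<in>K. C = M #>\<^bsub>G\<lparr>carrier := K\<rparr>\<^esub> k" if "C \<in> ?X" for C
    using that by (auto simp: RCOSETS_def)
  have HU: "h \<in> U" if "h \<in> H" for h
    using that subset_set_mult(1)[OF H.subgroup_axioms assms(2)] by (auto simp: U_def)
  have KU: "k \<in> U" if "k \<in> K" for k
    using that subset_set_mult(2)[OF H.subgroup_axioms assms(2)] by (auto simp: U_def)
  have "bij_betw ?g (?X \<times> rcosets U) (rcosets H)"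
  proof (rule bij_betw_imageI)
    show "inj_on ?g (?X \<times> rcosets U)"
    proof (rule inj_onI, clarify)
      fix C D C' D' assume CD: "C \<in> ?X" "D \<in> rcosets U" "C' \<in> ?X" "D' \<in> rcosets U"
        and eq: "H <#> C #> coset_rep D = H <#> C' #> coset_rep D'"
      obtain k where k: "k \<in> K" "C = M #>\<^bsub>G\<lparr>carrier := K\<rparr>\<^esub> k" using X CD by blast
      obtain l where l: "l \<in> K" "C' = M #>\<^bsub>G\<lparr>carrier := K\<rparr>\<^esub> l" using X CD by blast
      have "H #> (k \<otimes> coset_rep D) = H #> (l \<otimes> coset_rep D')" using eq k l gK b CD by simp
      then have "k \<otimes> coset_rep D \<in> H #> (l \<otimes> coset_rep D')"
        using rcos_self[OF _ H.subgroup_axioms, of "k \<otimes> coset_rep D"] k b CD by simp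
      then obtain h where h: "h \<in> H" "k \<otimes> coset_rep D = h \<otimes> (l \<otimes> coset_rep D')" by (auto simp: r_coset_def)
      have "U #> (k \<otimes> coset_rep D) = U #> coset_rep D"
        using k b(1) CD KU by (simp add: coset_mult_assoc[symmetric] U.subset U.rcos_const)
      moreover have "U #> (h \<otimes> (l \<otimes> coset_rep D')) = U #> coset_rep D'"
        using h(1) l b(1) CD KU HU by (simp add: coset_mult_assoc[symmetric] U.subset U.rcos_const)
      ultimately have DD: "D = D'" using b(2) CD h(2) by metis
      then have "k \<otimes> coset_rep D = (h \<otimes> l) \<otimes> coset_rep D" using h k l b CD by (simp add: m_assoc)
      then have kl: "k = h \<otimes> l" using h(1) k l b CD by simp
      then have "h = k \<otimes> inv l" using h(1) k l by (simp add: inv_solve_right)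
      then have "h \<in> M" using h(1) k l by (simp add: M_def)
      then have "k \<in> M #>\<^bsub>G\<lparr>carrier := K\<rparr>\<^esub> l" using kl by (auto simp: r_coset_def)
      then have "C = C'" using GK.repr_independence[OF _ _ M.subgroup_axioms] k l by simp
      then show "C = C' \<and> D = D'" using DD by simp
    qed
    show "?g ` (?X \<times> rcosets U) = rcosets H"
    proof
      have "H <#> C #> coset_rep D \<in> rcosets H" if CD: "C \<in> ?X" "D \<in> rcosets U" for C D
      proof -
        obtain k where k: "k \<in> K" "C = M #>\<^bsub>G\<lparr>carrier := K\<rparr>\<^esub> k" using X CD by blast
        then show ?thesis using gK b(1)[OF CD(2)] rcosetsI[OF H.subset] by simp
      qed
      then show "?g ` (?X \<times> rcosets U) \<subseteq> rcosets H" by auto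
      show "rcosets H \<subseteq> ?g ` (?X \<times> rcosets U)"
      proof
        fix E assume "E \<in> rcosets H"
        then obtain x where x: "x \<in> carrier G" "E = H #> x" by (auto simp: RCOSETS_def)
        let ?D = "U #> x"
        have D: "?D \<in> rcosets U" using x U.subset by (intro rcosetsI) auto
        then have "x \<in> U #> coset_rep ?D" using b rcos_self[OF x(1) U.subgroup_axioms] by simp
        then obtain h k where hk: "h \<in> H" "k \<in> K" "x = h \<otimes> k \<otimes> coset_rep ?D"
          by (auto simp: r_coset_def U_def set_mult_def)
        have "x = h \<otimes> (k \<otimes> coset_rep ?D)" using hk(1,2) b(1)[OF D] by (subst hk(3)) (simp add: m_assoc)
        then have "H #> x = H #> (k \<otimes> coset_rep ?D)"
          using hk(1,2) b(1)[OF D] by (metis H.rcos_const H.mem_carrier K.mem_carrier H.subset coset_mult_assoc is_group m_closed)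
        also have "\<dots> = ?g (M #>\<^bsub>G\<lparr>carrier := K\<rparr>\<^esub> k, ?D)" using gK hk(2) b(1)[OF D] by simp
        finally show "E \<in> ?g ` (?X \<times> rcosets U)"
          using x(2) D hk(2) by (auto simp: RCOSETS_def intro!: image_eqI[of _ _ "(M #>\<^bsub>G\<lparr>carrier := K\<rparr>\<^esub> k, ?D)"])
      qed
    qed
  qed
  then show ?thesis by (metis bij_betw_same_card card_cartesian_product)
qed

definition invariant_funs :: "nat \<Rightarrow> 'a set \<Rightarrow> ('a \<Rightarrow> complex) set" where
  "invariant_funs p U = {l. (\<forall>x. l x ^ p = 1) \<and> (\<forall>x. x \<notin> carrier G \<longrightarrow> l x = 1) \<and>
     (\<forall>u\<in>U. \<forall>x\<in>carrier G. l (u \<otimes> x) = l x)}"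

lemma fun_group_invariant_funs: "fun_group p (invariant_funs p U)"
  unfolding fun_group_def invariant_funs_def by (simp add: power_mult_distrib)

lemma card_invariant_funs:
  assumes "subgroup U G" "finite (rcosets U)" "p > 0"
  shows "finite (invariant_funs p U)" "card (invariant_funs p U) = p ^ card (rcosets U)"
proof -
  interpret U: subgroup U G by fact
  note b = coset_rep_in[OF assms(1)] and bU = coset_rep_rcosets[OF assms(1)]
  let ?P = "rcosets U \<rightarrow>\<^sub>E {z::complex. z ^ p = 1}"
  have bij: "bij_betw (\<lambda>l. \<lambda>D\<in>rcosets U. l (coset_rep D)) (invariant_funs p U) ?P"
  proof (rule bij_betw_byWitness[where f' = "\<lambda>g x. if x \<in> carrier G then g (U #> x) else 1"])
    show "\<forall>l\<in>invariant_funs p U. (\<lambda>x. if x \<in> carrier G then (\<lambda>D\<in>rcosets U. l (coset_rep D)) (U #> x) else 1) = l"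
    proof (intro ballI ext)
      fix l x assume l: "l \<in> invariant_funs p U"
      show "(if x \<in> carrier G then (\<lambda>D\<in>rcosets U. l (coset_rep D)) (U #> x) else 1) = l x"
      proof (cases "x \<in> carrier G")
        case True
        then obtain u where "u \<in> U" "coset_rep (U #> x) = u \<otimes> x" using b by (auto simp: r_coset_def)
        then show ?thesis using True l U.subset by (simp add: invariant_funs_def rcosetsI)
      qed (use l in \<open>simp add: invariant_funs_def\<close>)
    qed
    show "\<forall>g\<in>?P. (\<lambda>D\<in>rcosets U. if coset_rep D \<in> carrier G then g (U #> coset_rep D) else 1) = g"
      using bU by (auto simp: fun_eq_iff restrict_def PiE_def extensional_def)
    show "(\<lambda>l. \<lambda>D\<in>rcosets U. l (coset_rep D)) ` invariant_funs p U \<subseteq> ?P"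
      by (auto simp: invariant_funs_def)
    have "U #> (u \<otimes> x) = U #> x" if "u \<in> U" "x \<in> carrier G" for u x
      using that by (simp add: coset_mult_assoc[symmetric] U.subset U.rcos_const)
    moreover have "g (U #> x) ^ p = 1" if "g \<in> ?P" "x \<in> carrier G" for g x
      using that U.subset by (auto simp: PiE_def Pi_def rcosetsI)
    ultimately show "(\<lambda>g x. if x \<in> carrier G then g (U #> x) else 1) ` ?P \<subseteq> invariant_funs p U"
      by (auto simp: invariant_funs_def)
  qed
  have "finite ?P" using assms by (intro finite_PiE) (auto intro: finite_roots_unity)
  then show "finite (invariant_funs p U)" using bij bij_betw_finite by blast
  show "card (invariant_funs p U) = p ^ card (rcosets U)"
    using bij_betw_same_card[OF bij] assms(2,3) by (simp add: card_PiE card_roots_unity_eq)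
qed

text \<open>Cocycles for the action of \<open>K\<close> on \<open>H\<backslash>G\<close>, i.e. derivations from \<open>K\<close> to functions on the
  quotient. By Shapiro's lemma they carry the same information as the characters of \<open>K \<inter> H\<close>.\<close>

definition cocycles :: "nat \<Rightarrow> 'a set \<Rightarrow> 'a set \<Rightarrow> ('a \<times> 'a \<Rightarrow> complex) set" where
  "cocycles p K H = {c. (\<forall>q. c q ^ p = 1) \<and>
     (\<forall>k x. k \<notin> K \<or> x \<notin> carrier G \<longrightarrow> c (k, x) = 1) \<and>
     (\<forall>k\<in>K. \<forall>l\<in>K. \<forall>x\<in>carrier G. c (k \<otimes> l, x) = c (k, l \<otimes> x) * c (l, x)) \<and>
     (\<forall>k\<in>K. \<forall>h\<in>H. \<forall>x\<in>carrier G. c (k, h \<otimes> x) = c (k, x))}"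

lemma cocycle_root: "c \<in> cocycles p K H \<Longrightarrow> c q ^ p = 1"
  and cocycle_outside: "c \<in> cocycles p K H \<Longrightarrow> k \<notin> K \<or> x \<notin> carrier G \<Longrightarrow> c (k, x) = 1"
  and cocycle_mult: "c \<in> cocycles p K H \<Longrightarrow> k \<in> K \<Longrightarrow> l \<in> K \<Longrightarrow> x \<in> carrier G \<Longrightarrow>
    c (k \<otimes> l, x) = c (k, l \<otimes> x) * c (l, x)"
  and cocycle_invariant: "c \<in> cocycles p K H \<Longrightarrow> k \<in> K \<Longrightarrow> h \<in> H \<Longrightarrow> x \<in> carrier G \<Longrightarrow>
    c (k, h \<otimes> x) = c (k, x)"
  unfolding cocycles_def by blast+

lemma cocyclesI:
  assumes "\<And>k x. k \<in> K \<Longrightarrow> x \<in> carrier G \<Longrightarrow> c (k, x) ^ p = 1"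
    and "\<And>k x. k \<notin> K \<or> x \<notin> carrier G \<Longrightarrow> c (k, x) = 1"
    and "\<And>k l x. k \<in> K \<Longrightarrow> l \<in> K \<Longrightarrow> x \<in> carrier G \<Longrightarrow> c (k \<otimes> l, x) = c (k, l \<otimes> x) * c (l, x)"
    and "\<And>k h x. k \<in> K \<Longrightarrow> h \<in> H \<Longrightarrow> x \<in> carrier G \<Longrightarrow> c (k, h \<otimes> x) = c (k, x)"
  shows "c \<in> cocycles p K H"
proof -
  have "c (k, x) ^ p = 1" for k x
    using assms(1,2)[of k x] by (cases "k \<in> K \<and> x \<in> carrier G") auto
  then have "c q ^ p = 1" for q by (cases q) simp
  then show ?thesis using assms(2-4) unfolding cocycles_def by simp
qed

lemma fun_group_cocycles: "fun_group p (cocycles p K H)"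
  unfolding fun_group_def
proof (intro conjI ballI allI)
  show "(\<lambda>_. 1) \<in> cocycles p K H" by (rule cocyclesI) auto
  fix c assume c: "c \<in> cocycles p K H"
  show "c q ^ p = 1" for q by (rule cocycle_root[OF c])
  fix d assume d: "d \<in> cocycles p K H"
  show "(\<lambda>q. c q * d q) \<in> cocycles p K H"
    by (rule cocyclesI)
      (simp_all add: power_mult_distrib cocycle_root[OF c] cocycle_root[OF d] cocycle_outside[OF c]
        cocycle_outside[OF d] cocycle_mult[OF c] cocycle_mult[OF d] cocycle_invariant[OF c]
        cocycle_invariant[OF d])
qed

lemma cocycle_nonzero: "p > 0 \<Longrightarrow> c \<in> cocycles p K H \<Longrightarrow> c q \<noteq> 0"
  by (rule fun_group_nonzero[OF fun_group_cocycles])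

lemma cocycle_one:
  "p > 0 \<Longrightarrow> subgroup K G \<Longrightarrow> c \<in> cocycles p K H \<Longrightarrow> c (\<one>, x) = 1"
proof (cases "x \<in> carrier G")
  case True
  assume c: "p > 0" "subgroup K G" "c \<in> cocycles p K H"
  then show ?thesis
    using cocycle_mult[OF c(3) subgroup.one_closed[OF c(2)] subgroup.one_closed[OF c(2)] True]
      cocycle_nonzero[OF c(1,3), of "(\<one>, x)"] True by simp
qed (simp add: cocycle_outside)

lemma cocycle_determined:
  assumes "p > 0" "subgroup K G" "H \<lhd> G" and S: "S \<subseteq> K" "generate G S = K"
    and c: "c \<in> cocycles p K H" and triv: "\<And>s x. s \<in> S \<Longrightarrow> x \<in> carrier G \<Longrightarrow> c (s, x) = 1"
  shows "c = (\<lambda>_. 1)"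
proof -
  interpret K: subgroup K G by fact
  let ?L = "{k\<in>K. \<forall>x\<in>carrier G. c (k, x) = 1}"
  have "subgroup ?L G"
  proof (rule subgroupI)
    show "?L \<subseteq> carrier G" using K.subset by blast
    show "?L \<noteq> {}" using K.one_closed cocycle_one[OF assms(1,2) c] by blast
    show "k \<otimes> l \<in> ?L" if "k \<in> ?L" "l \<in> ?L" for k l
      using that by (auto simp: cocycle_mult[OF c])
    show "inv k \<in> ?L" if "k \<in> ?L" for k
    proof -
      have k: "k \<in> K" "\<And>x. x \<in> carrier G \<Longrightarrow> c (k, x) = 1" using that by auto
      have "c (inv k, x) = 1" if x: "x \<in> carrier G" for x
        using cocycle_mult[OF c k(1) K.m_inv_closed[OF k(1)] x] cocycle_one[OF assms(1,2) c] k x by simp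
      then show ?thesis using k by simp
    qed
  qed
  moreover have "S \<subseteq> ?L" using S triv by auto
  ultimately have "K \<subseteq> ?L" using generate_subgroup_incl[of S ?L] S(2) by simp
  then show "c = (\<lambda>_. 1)" using cocycle_outside[OF c] by (intro ext) auto
qed

lemma finite_cocycles:
  assumes "p > 0" "subgroup K G" "H \<lhd> G" "finite (rcosets H)"
    and S: "finite S" "S \<subseteq> K" "generate G S = K"
  shows "finite (cocycles p K H)"
proof -
  interpret H: normal H G by fact
  note b = coset_rep_in[OF H.subgroup_axioms]
  show ?thesis
  proof (rule finite_fun_group[OF fun_group_cocycles \<open>p > 0\<close>, of "S \<times> coset_rep ` (rcosets H)"])
    show "finite (S \<times> coset_rep ` (rcosets H))" using S assms(4) by simp
    fix c assume c: "c \<in> cocycles p K H" and triv: "\<And>q. q \<in> S \<times> coset_rep ` (rcosets H) \<Longrightarrow> c q = 1"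
    show "c = (\<lambda>_. 1)"
    proof (rule cocycle_determined[OF assms(1-3) S(2,3) c])
      fix s x assume s: "s \<in> S" and x: "x \<in> carrier G"
      obtain h where h: "h \<in> H" "coset_rep (H #> x) = h \<otimes> x" using b[OF x] by (auto simp: r_coset_def)
      have "c (s, coset_rep (H #> x)) = 1" using s x H.subset by (intro triv) (auto intro: rcosetsI)
      then show "c (s, x) = 1" using h cocycle_invariant[OF c _ h(1) x] s S by auto
    qed
  qed
qed

section \<open>Coboundaries and Shapiro's lemma\<close>

definition coboundary :: "'a set \<Rightarrow> ('a \<Rightarrow> complex) \<Rightarrow> 'a \<times> 'a \<Rightarrow> complex" where
  "coboundary K l = (\<lambda>(k, x). if k \<in> K \<and> x \<in> carrier G then l (k \<otimes> x) / l x else 1)"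

lemma coboundary_cocycle:
  assumes "p > 0" "subgroup K G" "H \<lhd> G" "l \<in> invariant_funs p H"
  shows "coboundary K l \<in> cocycles p K H"
proof -
  interpret H: normal H G by fact
  interpret K: subgroup K G by fact
  have nz: "l x \<noteq> 0" for x by (rule fun_group_nonzero[OF fun_group_invariant_funs assms(1,4)])
  have root: "l x ^ p = 1" for x by (rule fun_group_root[OF fun_group_invariant_funs assms(4)])
  have inv: "l (h \<otimes> x) = l x" if "h \<in> H" "x \<in> carrier G" for h x
    using assms(4) that by (simp add: invariant_funs_def)
  have inv': "l (k \<otimes> (h \<otimes> x)) = l (k \<otimes> x)" if "k \<in> carrier G" "h \<in> H" "x \<in> carrier G" for k h x
  proof -
    have "k \<otimes> (h \<otimes> x) = (k \<otimes> h \<otimes> inv k) \<otimes> (k \<otimes> x)" using that by (intro mult_conj) auto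
    then show ?thesis using inv[OF H.inv_op_closed2[OF that(1,2)], of "k \<otimes> x"] that(1,3) by simp
  qed
  show ?thesis
    by (rule cocyclesI) (auto simp: coboundary_def power_divide root nz inv inv' m_assoc)
qed

text \<open>The kernel of \<open>coboundary K\<close> consists of the functions invariant under all
  of H K, so the coboundaries have dimension [G:H] - [G:HK]. The product form avoids a subtraction
  of exponents.\<close>

lemma card_coboundaries:
  assumes "p > 0" "subgroup K G" "H \<lhd> G" "finite (rcosets H)"
  shows "card (coboundary K ` invariant_funs p H) * p ^ card (rcosets (H <#> K)) = p ^ card (rcosets H)"
proof -
  interpret H: normal H G by fact
  interpret K: subgroup K G by fact
  have U: "subgroup (H <#> K) G" by (rule mult_norm_subgroup[OF assms(3,2)])
  have fU: "finite (rcosets (H <#> K))"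
  proof -
    have "card (rcosets H) \<noteq> 0"
      using assms(4) H.subset rcosetsI[of H \<one>] by (auto simp: card_eq_0_iff)
    then have "card (rcosets (H <#> K)) \<noteq> 0" using rcosets_factor[OF assms(3,2)] by simp
    then show ?thesis by (intro card_ge_0_finite) simp
  qed
  note nz = fun_group_nonzero[OF fun_group_invariant_funs assms(1)]
  have "card (invariant_funs p H) = card (coboundary K ` invariant_funs p H) *
      card {l\<in>invariant_funs p H. coboundary K l = (\<lambda>_. 1)}"
    by (rule card_image_kernel[OF fun_group_invariant_funs \<open>p > 0\<close> card_invariant_funs(1)[OF H.subgroup_axioms assms(4,1)]])
      (auto simp: coboundary_def fun_eq_iff nz split: if_splits)
  moreover have "{l\<in>invariant_funs p H. coboundary K l = (\<lambda>_. 1)} = invariant_funs p (H <#> K)"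
  proof (intro equalityI subsetI)
    fix l assume "l \<in> {l\<in>invariant_funs p H. coboundary K l = (\<lambda>_. 1)}"
    then have l: "l \<in> invariant_funs p H" "\<And>q. coboundary K l q = 1" by auto
    have "l (k \<otimes> x) = l x" if "k \<in> K" "x \<in> carrier G" for k x
      using l(2)[of "(k, x)"] that nz[OF l(1), of x] by (simp add: coboundary_def)
    then show "l \<in> invariant_funs p (H <#> K)"
      using l(1) by (auto simp: invariant_funs_def set_mult_def m_assoc)
  next
    fix l assume l: "l \<in> invariant_funs p (H <#> K)"
    have "h \<otimes> k \<in> H <#> K" if "h \<in> H" "k \<in> K" for h k using that by (auto simp: set_mult_def)
    then have inv: "l ((h \<otimes> k) \<otimes> x) = l x" if "h \<in> H" "k \<in> K" "x \<in> carrier G" for h k x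
      using l that unfolding invariant_funs_def by blast
    have "l (h \<otimes> x) = l x" if "h \<in> H" "x \<in> carrier G" for h x
      using inv[OF that(1) K.one_closed that(2)] that by simp
    then have "l \<in> invariant_funs p H" using l by (simp add: invariant_funs_def)
    moreover have "l (k \<otimes> x) = l x" if "k \<in> K" "x \<in> carrier G" for k x
      using inv[OF H.one_closed that] that by simp
    then have "coboundary K l = (\<lambda>_. 1)"
      using nz[OF l] by (auto simp: coboundary_def fun_eq_iff)
    ultimately show "l \<in> {l\<in>invariant_funs p H. coboundary K l = (\<lambda>_. 1)}" by simp
  qed
  ultimately show ?thesis
    using card_invariant_funs(2)[OF H.subgroup_axioms assms(4,1)] card_invariant_funs(2)[OF U fU assms(1)]
    by simp
qed

text \<open>Shapiro's lemma, counted. The orbits of K on the cosets of H are indexed by the cosets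
  of U = H K, and all stabilisers are M. Restricting a cocycle to M at one representative per orbit
  gives a family of characters of M. The kernel of this restriction consists of the coboundaries,
  and every family occurs.\<close>

lemma card_cocycles:
  assumes "p > 0" "subgroup K G" "H \<lhd> G" "finite (rcosets H)" "finite (cocycles p K H)"
  defines "M \<equiv> K \<inter> H" and "U \<equiv> H <#> K"
  shows "finite (chars p (G\<lparr>carrier := M\<rparr>))" (is "finite ?X")
    and "card (cocycles p K H) =
      card (coboundary K ` invariant_funs p H) * card (chars p (G\<lparr>carrier := M\<rparr>)) ^ card (rcosets U)"
proof -
  interpret H: normal H G by fact
  interpret K: subgroup K G by fact
  interpret U: subgroup U G unfolding U_def by (rule mult_norm_subgroup[OF assms(3,2)])
  have MG: "subgroup M G" unfolding M_def by (rule subgroups_Inter_pair[OF assms(2) H.subgroup_axioms])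
  interpret M: subgroup M G by fact
  interpret GM: group "G\<lparr>carrier := M\<rparr>" by (rule subgroup_imp_group[OF MG])
  note bU = coset_rep_rcosets[OF U.subgroup_axioms]
  \<comment> \<open>\<open>\<kappa> x\<close> is an element of K that carries the representative of
    the orbit of x to the coset H x. It is unique up to right multiplication by M, and the choice
    depends only on H x, which is what \<open>\<kappa>H\<close> states.\<close>
  define \<kappa> where "\<kappa> x = (SOME k. k \<in> K \<and> (\<exists>h\<in>H. x = h \<otimes> (k \<otimes> coset_rep (U #> x))))" for x
  have \<kappa>: "\<kappa> x \<in> K" "\<exists>h\<in>H. x = h \<otimes> (\<kappa> x \<otimes> coset_rep (U #> x))" if x: "x \<in> carrier G" for x
  proof -
    have D: "U #> x \<in> rcosets U" using x U.subset by (intro rcosetsI) auto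
    then have "x \<in> U #> coset_rep (U #> x)" using bU rcos_self[OF x U.subgroup_axioms] by simp
    then obtain h k where hk: "h \<in> H" "k \<in> K" "x = h \<otimes> k \<otimes> coset_rep (U #> x)"
      by (auto simp: r_coset_def U_def set_mult_def)
    then have "x = h \<otimes> (k \<otimes> coset_rep (U #> x))" using bU(1)[OF D] by (simp add: m_assoc)
    then have "\<exists>k. k \<in> K \<and> (\<exists>h\<in>H. x = h \<otimes> (k \<otimes> coset_rep (U #> x)))" using hk by blast
    then have "\<kappa> x \<in> K \<and> (\<exists>h\<in>H. x = h \<otimes> (\<kappa> x \<otimes> coset_rep (U #> x)))" unfolding \<kappa>_def by (rule someI_ex)
    then show "\<kappa> x \<in> K" "\<exists>h\<in>H. x = h \<otimes> (\<kappa> x \<otimes> coset_rep (U #> x))" by blast+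
  qed
  have HU: "h \<in> U" if "h \<in> H" for h
    using that subset_set_mult(1)[OF H.subgroup_axioms assms(2)] by (auto simp: U_def)
  have KU: "k \<in> U" if "k \<in> K" for k
    using that subset_set_mult(2)[OF H.subgroup_axioms assms(2)] by (auto simp: U_def)
  have Ux: "U #> (u \<otimes> x) = U #> x" if "u \<in> U" "x \<in> carrier G" for u x
    using that by (simp add: coset_mult_assoc[symmetric] U.subset U.rcos_const)
  have bK: "U #> (k \<otimes> x) = U #> x" if "k \<in> K" "x \<in> carrier G" for k x
    using Ux KU that by blast
  have conjH: "k \<otimes> h \<otimes> inv k \<in> H" if "k \<in> carrier G" "h \<in> H" for k h
    using H.inv_op_closed2 that by blast
  have bcl: "coset_rep (U #> x) \<in> carrier G" if "x \<in> carrier G" for x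
    using bU(1) that U.subset by (auto intro: rcosetsI)
  have \<kappa>H: "\<kappa> (g \<otimes> y) = \<kappa> y" if g: "g \<in> H" and y: "y \<in> carrier G" for g y
  proof -
    have Ug: "U #> (g \<otimes> y) = U #> y" using Ux HU g y by blast
    have "(\<exists>h\<in>H. g \<otimes> y = h \<otimes> z) \<longleftrightarrow> (\<exists>h\<in>H. y = h \<otimes> z)" if z: "z \<in> carrier G" for z
    proof
      assume "\<exists>h\<in>H. g \<otimes> y = h \<otimes> z"
      then obtain h where "h \<in> H" "g \<otimes> y = h \<otimes> z" by blast
      then have "inv g \<otimes> h \<in> H" "y = (inv g \<otimes> h) \<otimes> z"
        using g y z by (simp_all add: m_assoc inv_solve_left)
      then show "\<exists>h\<in>H. y = h \<otimes> z" by blast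
    next
      assume "\<exists>h\<in>H. y = h \<otimes> z"
      then obtain h where "h \<in> H" "y = h \<otimes> z" by blast
      then have "g \<otimes> h \<in> H" "g \<otimes> y = (g \<otimes> h) \<otimes> z" using g z by (simp_all add: m_assoc)
      then show "\<exists>h\<in>H. g \<otimes> y = h \<otimes> z" by blast
    qed
    then have "(k \<in> K \<and> (\<exists>h\<in>H. g \<otimes> y = h \<otimes> (k \<otimes> coset_rep (U #> y)))) =
        (k \<in> K \<and> (\<exists>h\<in>H. y = h \<otimes> (k \<otimes> coset_rep (U #> y))))" for k
      using bcl[OF y] K.mem_carrier by (metis m_closed)
    then show ?thesis unfolding \<kappa>_def Ug by simp
  qed
  have unique_mod_M: "inv k \<otimes> l \<in> M"
    if kl: "k \<in> K" "l \<in> K" "h \<in> H" "h' \<in> H" "y \<in> carrier G" "h \<otimes> (k \<otimes> y) = h' \<otimes> (l \<otimes> y)" for k l h h' y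
  proof -
    have "(h \<otimes> k) \<otimes> y = (h' \<otimes> l) \<otimes> y" using kl by (simp add: m_assoc)
    then have "h \<otimes> k = h' \<otimes> l" using kl by simp
    then have "l = inv h' \<otimes> (h \<otimes> k)" using kl by (simp add: inv_solve_left)
    then have "inv k \<otimes> l = inv k \<otimes> (inv h' \<otimes> h) \<otimes> inv (inv k)" using kl by (simp add: m_assoc)
    then have "inv k \<otimes> l \<in> H" using conjH[of "inv k" "inv h' \<otimes> h"] kl by simp
    then show ?thesis using kl by (simp add: M_def)
  qed
  let ?\<phi> = "\<lambda>c (m, D). if m \<in> M \<and> D \<in> rcosets U then c (m, coset_rep D) else (1 :: complex)"
  define I where "I = ?\<phi> ` cocycles p K H"
  note nz = cocycle_nonzero[OF \<open>p > 0\<close>]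
  have prod: "card (cocycles p K H) = card I * card {c\<in>cocycles p K H. ?\<phi> c = (\<lambda>_. 1)}"
    unfolding I_def
    by (rule card_image_kernel[OF fun_group_cocycles \<open>p > 0\<close> assms(5)]) (auto simp: fun_eq_iff nz split: if_splits)
  have ker: "{c\<in>cocycles p K H. ?\<phi> c = (\<lambda>_. 1)} = coboundary K ` invariant_funs p H"
  proof (intro equalityI subsetI)
    fix c assume "c \<in> {c\<in>cocycles p K H. ?\<phi> c = (\<lambda>_. 1)}"
    then have c: "c \<in> cocycles p K H" and triv: "\<And>q. ?\<phi> c q = 1" by (auto dest: fun_cong)
    have triv: "c (m, coset_rep D) = 1" if "m \<in> M" "D \<in> rcosets U" for m D
      using triv[of "(m, D)"] that by simp
    \<comment> \<open>A potential for c: the transport from the representative of the orbit to x. It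
      does not depend on the path, since c is trivial on M at the representative.\<close>
    define l where "l x = (if x \<in> carrier G then c (\<kappa> x, coset_rep (U #> x)) else 1)" for x
    have l: "l x = c (k, coset_rep (U #> x))"
      if x: "x \<in> carrier G" and k: "k \<in> K" "h \<in> H" "x = h \<otimes> (k \<otimes> coset_rep (U #> x))" for x k h
    proof -
      let ?y = "coset_rep (U #> x)"
      obtain h' where h': "h' \<in> H" "x = h' \<otimes> (\<kappa> x \<otimes> ?y)" using \<kappa>(2)[OF x] by blast
      define m where "m = inv k \<otimes> \<kappa> x"
      have m: "m \<in> M"
        unfolding m_def by (rule unique_mod_M[OF k(1) \<kappa>(1)[OF x] k(2) h'(1) bcl[OF x]])
          (use k(3) h'(2) in simp)
      have mKH: "m \<in> K" "m \<in> H" using m by (auto simp: M_def)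
      have "\<kappa> x = k \<otimes> m" using k(1) \<kappa>(1)[OF x] by (simp add: m_def inv_solve_left flip: m_assoc)
      then have "l x = c (k, m \<otimes> ?y) * c (m, ?y)"
        using x cocycle_mult[OF c k(1) mKH(1) bcl[OF x]] by (simp add: l_def)
      also have "\<dots> = c (k, ?y)"
        using cocycle_invariant[OF c k(1) mKH(2) bcl[OF x]] triv[OF m] x U.subset by (simp add: rcosetsI)
      finally show ?thesis .
    qed
    have "l \<in> invariant_funs p H"
    proof -
      have "l (h \<otimes> x) = l x" if h: "h \<in> H" and x: "x \<in> carrier G" for h x
      proof -
        obtain h' where h': "h' \<in> H" "x = h' \<otimes> (\<kappa> x \<otimes> coset_rep (U #> x))" using \<kappa>(2)[OF x] by blast
        have Uh: "U #> (h \<otimes> x) = U #> x" using Ux HU h x by blast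
        have hx: "h \<otimes> x = (h \<otimes> h') \<otimes> (\<kappa> x \<otimes> coset_rep (U #> (h \<otimes> x)))"
          using h h'(1) \<kappa>(1)[OF x] bcl[OF x] unfolding Uh by (subst h'(2)) (simp add: m_assoc)
        have "l (h \<otimes> x) = c (\<kappa> x, coset_rep (U #> (h \<otimes> x)))"
          by (rule l[OF _ \<kappa>(1)[OF x] _ hx]) (use h h'(1) x in simp_all)
        also have "\<dots> = l x" using x Uh by (simp add: l_def)
        finally show ?thesis .
      qed
      moreover have "l x ^ p = 1" for x using cocycle_root[OF c] by (simp add: l_def)
      ultimately show ?thesis by (simp add: invariant_funs_def l_def)
    qed
    moreover have "c = coboundary K l"
    proof (intro ext, clarify)
      fix k x
      show "c (k, x) = coboundary K l (k, x)"
      proof (cases "k \<in> K \<and> x \<in> carrier G")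
        case True
        then have k: "k \<in> K" and x: "x \<in> carrier G" by auto
        let ?y = "coset_rep (U #> x)"
        obtain h where h: "h \<in> H" "x = h \<otimes> (\<kappa> x \<otimes> ?y)" using \<kappa>(2)[OF x] by blast
        note y = bcl[OF x] and kx = \<kappa>(1)[OF x]
        have "k \<otimes> (h \<otimes> (\<kappa> x \<otimes> ?y)) = (k \<otimes> h \<otimes> inv k) \<otimes> ((k \<otimes> \<kappa> x) \<otimes> ?y)"
          using mult_conj[of k h "\<kappa> x \<otimes> ?y"] k h(1) kx y by (simp add: m_assoc)
        then have kx_eq: "k \<otimes> x = (k \<otimes> h \<otimes> inv k) \<otimes> ((k \<otimes> \<kappa> x) \<otimes> coset_rep (U #> (k \<otimes> x)))"
          using h(2) bK[OF k x] by simp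
        have "l (k \<otimes> x) = c (k \<otimes> \<kappa> x, coset_rep (U #> (k \<otimes> x)))"
          by (rule l[OF _ _ _ kx_eq]) (use k kx x conjH[of k h] h(1) in simp_all)
        also have "\<dots> = c (k \<otimes> \<kappa> x, ?y)" by (simp only: bK[OF k x])
        also have "\<dots> = c (k, \<kappa> x \<otimes> ?y) * l x"
          using cocycle_mult[OF c k kx y] x by (simp add: l_def)
        also have "c (k, \<kappa> x \<otimes> ?y) = c (k, x)"
          using cocycle_invariant[OF c k h(1), of "\<kappa> x \<otimes> ?y"] kx y h(2) by simp
        finally show ?thesis using k x nz[OF c] by (simp add: coboundary_def l_def)
      next
        case False
        then show ?thesis using cocycle_outside[OF c] by (auto simp: coboundary_def)
      qed
    qed
    ultimately show "c \<in> coboundary K ` invariant_funs p H" by blast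
  next
    fix c assume "c \<in> coboundary K ` invariant_funs p H"
    then obtain l where l: "l \<in> invariant_funs p H" "c = coboundary K l" by blast
    have "l (m \<otimes> x) / l x = 1" if "m \<in> M" "x \<in> carrier G" for m x
      using l(1) that fun_group_nonzero[OF fun_group_invariant_funs assms(1) l(1)]
      by (simp add: invariant_funs_def M_def)
    then have "?\<phi> c = (\<lambda>_. 1)" using bU(1) by (auto simp: fun_eq_iff l(2) coboundary_def)
    then show "c \<in> {c\<in>cocycles p K H. ?\<phi> c = (\<lambda>_. 1)}"
      using coboundary_cocycle[OF assms(1,2,3) l(1)] l(2) by blast
  qed
  define J where "J = {f. (\<forall>D\<in>rcosets U. (\<lambda>m. f (m, D)) \<in> ?X) \<and> (\<forall>m D. D \<notin> rcosets U \<longrightarrow> f (m, D) = 1)}"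
  have IJ: "I = J"
  proof (intro equalityI subsetI)
    fix f assume "f \<in> I"
    then obtain c where c: "c \<in> cocycles p K H" "f = ?\<phi> c" by (auto simp: I_def)
    have "(\<lambda>m. f (m, D)) \<in> ?X" if D: "D \<in> rcosets U" for D
    proof (rule charsI)
      show "f (m, D) ^ p = 1" for m using cocycle_root[OF c(1)] c(2) by simp
      show "f (m, D) = 1" if "m \<notin> carrier (G\<lparr>carrier := M\<rparr>)" for m using that c(2) by simp
      fix m n assume "m \<in> carrier (G\<lparr>carrier := M\<rparr>)" "n \<in> carrier (G\<lparr>carrier := M\<rparr>)"
      then have mn: "m \<in> M" "n \<in> M" "m \<in> K" "n \<in> K" "n \<in> H" by (auto simp: M_def)
      then show "f (m \<otimes>\<^bsub>G\<lparr>carrier := M\<rparr>\<^esub> n, D) = f (m, D) * f (n, D)"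
        using D bU(1)[OF D] cocycle_mult[OF c(1) mn(3,4) bU(1)[OF D]]
          cocycle_invariant[OF c(1) mn(3,5) bU(1)[OF D]] by (simp add: c(2))
    qed
    then show "f \<in> J" using c(2) by (simp add: J_def)
  next
    fix f assume f: "f \<in> J"
    have fX: "(\<lambda>m. f (m, D)) \<in> ?X" if "D \<in> rcosets U" for D using f that by (simp add: J_def)
    have f_mult: "f (m \<otimes> n, D) = f (m, D) * f (n, D)" if "m \<in> M" "n \<in> M" "D \<in> rcosets U" for m n D
      using chars_mult[OF fX[OF that(3)]] that by simp
    \<comment> \<open>The inverse of the restriction: go from the representative to x by
      \<open>\<kappa> x\<close>, apply k, and return by the inverse of
      \<open>\<kappa> (k \<otimes> x)\<close>. This loop lies in M, where a character is
      given.\<close>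
    define c where "c = (\<lambda>(k, x). if k \<in> K \<and> x \<in> carrier G
      then f (inv (\<kappa> (k \<otimes> x)) \<otimes> (k \<otimes> \<kappa> x), U #> x) else 1)"
    have in_M: "inv (\<kappa> (k \<otimes> x)) \<otimes> (k \<otimes> \<kappa> x) \<in> M" if k: "k \<in> K" and x: "x \<in> carrier G" for k x
    proof -
      let ?y = "coset_rep (U #> x)"
      obtain h where h: "h \<in> H" "x = h \<otimes> (\<kappa> x \<otimes> ?y)" using \<kappa>(2)[OF x] by blast
      note y = bcl[OF x] and kx = \<kappa>(1)[OF x]
      have kxG: "k \<otimes> x \<in> carrier G" using k x by simp
      obtain h' where h': "h' \<in> H" "k \<otimes> x = h' \<otimes> (\<kappa> (k \<otimes> x) \<otimes> ?y)"
        using \<kappa>(2)[OF kxG] bK[OF k x] by auto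
      have "k \<otimes> (h \<otimes> (\<kappa> x \<otimes> ?y)) = (k \<otimes> h \<otimes> inv k) \<otimes> ((k \<otimes> \<kappa> x) \<otimes> ?y)"
        using mult_conj[of k h "\<kappa> x \<otimes> ?y"] k h(1) kx y by (simp add: m_assoc)
      then have "k \<otimes> x = (k \<otimes> h \<otimes> inv k) \<otimes> ((k \<otimes> \<kappa> x) \<otimes> ?y)" using h(2) by simp
      then show ?thesis
        by (intro unique_mod_M[OF \<kappa>(1)[OF kxG] _ h'(1) conjH[OF K.mem_carrier[OF k] h(1)] y])
          (use k kx h'(2) in simp_all)
    qed
    have "c \<in> cocycles p K H"
    proof (rule cocyclesI)
      show "c (k, x) ^ p = 1" if "k \<in> K" "x \<in> carrier G" for k x
        using chars_root[OF fX] that U.subset by (simp add: c_def rcosetsI)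
      show "c (k, x) = 1" if "k \<notin> K \<or> x \<notin> carrier G" for k x using that by (auto simp: c_def)
      fix k x assume k: "k \<in> K" and x: "x \<in> carrier G"
      have D: "U #> x \<in> rcosets U" using x U.subset by (simp add: rcosetsI)
      show "c (k \<otimes> l, x) = c (k, l \<otimes> x) * c (l, x)" if l: "l \<in> K" for l
      proof -
        have lx: "l \<otimes> x \<in> carrier G" using l x by simp
        have klx: "k \<otimes> (l \<otimes> x) \<in> carrier G" using k l x by simp
        note cl = K.mem_carrier[OF \<kappa>(1)[OF x]] K.mem_carrier[OF \<kappa>(1)[OF lx]] K.mem_carrier[OF \<kappa>(1)[OF klx]]
        have "\<kappa> (l \<otimes> x) \<otimes> (inv (\<kappa> (l \<otimes> x)) \<otimes> (l \<otimes> \<kappa> x)) = l \<otimes> \<kappa> x"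
          using cl l by (simp flip: m_assoc)
        then have "inv (\<kappa> (k \<otimes> (l \<otimes> x))) \<otimes> (k \<otimes> l \<otimes> \<kappa> x) =
            (inv (\<kappa> (k \<otimes> (l \<otimes> x))) \<otimes> (k \<otimes> \<kappa> (l \<otimes> x))) \<otimes> (inv (\<kappa> (l \<otimes> x)) \<otimes> (l \<otimes> \<kappa> x))"
          using cl k l by (simp add: m_assoc)
        then show ?thesis
          using f_mult[OF in_M[OF k lx] in_M[OF l x] D] k l x lx bK[OF l x] by (simp add: c_def m_assoc)
      qed
      show "c (k, h \<otimes> x) = c (k, x)" if h: "h \<in> H" for h
      proof -
        have "k \<otimes> (h \<otimes> x) = (k \<otimes> h \<otimes> inv k) \<otimes> (k \<otimes> x)" using k h x by (intro mult_conj) auto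
        then have "\<kappa> (k \<otimes> (h \<otimes> x)) = \<kappa> (k \<otimes> x)" using \<kappa>H conjH k h x by simp
        moreover have "U #> (h \<otimes> x) = U #> x" using Ux HU h x by blast
        ultimately show ?thesis using \<kappa>H[OF h x] k h x by (simp add: c_def)
      qed
    qed
    moreover have "f = ?\<phi> c"
    proof (intro ext, clarify)
      fix m D
      show "f (m, D) = (if m \<in> M \<and> D \<in> rcosets U then c (m, coset_rep D) else 1)"
      proof (cases "m \<in> M \<and> D \<in> rcosets U")
        case True
        then have m: "m \<in> M" "m \<in> K" "m \<in> H" and D: "D \<in> rcosets U" by (auto simp: M_def)
        note y = bU[OF D]
        \<comment> \<open>At a representative \<open>\<kappa>\<close> need not be \<one>, it only
          lies in M; its contribution cancels because the values of characters commute.\<close>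
        obtain h where h: "h \<in> H" "coset_rep D = h \<otimes> (\<kappa> (coset_rep D) \<otimes> coset_rep D)" using \<kappa>(2)[OF y(1)] y(2) by auto
        have "inv \<one> \<otimes> \<kappa> (coset_rep D) \<in> M"
          by (rule unique_mod_M[OF K.one_closed \<kappa>(1)[OF y(1)] H.one_closed h(1) y(1)]) (use h(2) y(1) in simp)
        then have *: "\<kappa> (coset_rep D) \<in> M" using \<kappa>(1)[OF y(1)] by simp
        have "\<kappa> (m \<otimes> coset_rep D) = \<kappa> (coset_rep D)" by (rule \<kappa>H[OF m(3) y(1)])
        then have "c (m, coset_rep D) = f (inv (\<kappa> (coset_rep D)) \<otimes> (m \<otimes> \<kappa> (coset_rep D)), D)"
          using m y by (simp add: c_def)
        also have "\<dots> = f (inv (\<kappa> (coset_rep D)), D) * (f (m, D) * f (\<kappa> (coset_rep D), D))"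
          using f_mult D m(1) * by simp
        also have "f (inv (\<kappa> (coset_rep D)), D) = inverse (f (\<kappa> (coset_rep D), D))"
          using GM.chars_inv[OF \<open>p > 0\<close> fX[OF D], of "\<kappa> (coset_rep D)"] * m_inv_consistent[OF MG *] by simp
        finally show ?thesis
          using True GM.chars_nonzero[OF \<open>p > 0\<close> fX[OF D], of "\<kappa> (coset_rep D)"] by simp
      next
        case False
        then have "f (m, D) = 1" using f chars_outside[OF fX[of D], of m] by (auto simp: J_def)
        then show ?thesis using False by auto
      qed
    qed
    ultimately show "f \<in> I" by (auto simp: I_def)
  qed
  have finI: "finite I" using assms(5) by (simp add: I_def)
  have U1: "U \<in> rcosets U" by (rule U.subgroup_in_rcosets[OF is_group])
  have bijJ: "bij_betw (\<lambda>f. \<lambda>D\<in>rcosets U. \<lambda>m. f (m, D)) J (rcosets U \<rightarrow>\<^sub>E ?X)"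
    by (rule bij_betw_byWitness[where f' = "\<lambda>g (m, D). if D \<in> rcosets U then g D m else 1"])
      (auto simp: J_def fun_eq_iff PiE_def extensional_def Pi_def restrict_def)
  have bij: "card I = card (rcosets U \<rightarrow>\<^sub>E ?X)" "finite (rcosets U \<rightarrow>\<^sub>E ?X)"
    using bij_betw_same_card[OF bijJ] bij_betw_finite[OF bijJ] finI IJ by simp_all
  have "?X \<subseteq> (\<lambda>g. g U) ` (rcosets U \<rightarrow>\<^sub>E ?X)"
  proof
    fix \<chi> assume "\<chi> \<in> ?X"
    then show "\<chi> \<in> (\<lambda>g. g U) ` (rcosets U \<rightarrow>\<^sub>E ?X)"
      using U1 by (intro image_eqI[of _ _ "\<lambda>D\<in>rcosets U. \<chi>"]) auto
  qed
  then show "finite ?X" using bij(2) finite_surj by blast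
  have "finite (rcosets U)"
  proof -
    have "card (rcosets H) \<noteq> 0"
      using assms(4) H.subset rcosetsI[of H \<one>] by (auto simp: card_eq_0_iff)
    then have "card (rcosets U) \<noteq> 0" using rcosets_factor[OF assms(3,2)] by (simp add: U_def)
    then show ?thesis by (intro card_ge_0_finite) simp
  qed
  then show "card (cocycles p K H) =
      card (coboundary K ` invariant_funs p H) * card ?X ^ card (rcosets U)"
    using prod ker bij(1) by (simp add: card_PiE)
qed

text \<open>With N = [G:H], u = [G:HK] and m = [K : K Int H], the dimension is (N - u) + d u: the
  coboundaries and u copies of the dual of M/[M,M]M^p. Since N = m u, division by N gives 1 + (d -
  1)/m.\<close>

lemma log_card_cocycles:
  assumes "prime p" "subgroup K G" "H \<lhd> G" "finite (rcosets H)" "finite (cocycles p K H)"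
  defines "M \<equiv> K \<inter> H"
  shows "log p (card (cocycles p K H)) / card (rcosets H) =
    1 + (real (d_p p (G\<lparr>carrier := M\<rparr>)) - 1) / card (rcosets\<^bsub>G\<lparr>carrier := K\<rparr>\<^esub> M)"
proof -
  interpret H: normal H G by fact
  note p = prime_gt_0_nat[OF \<open>prime p\<close>] prime_gt_1_nat[OF \<open>prime p\<close>]
  let ?U = "H <#> K" and ?d = "d_p p (G\<lparr>carrier := M\<rparr>)"
  let ?N = "card (rcosets H)" and ?u = "card (rcosets ?U)" and ?m = "card (rcosets\<^bsub>G\<lparr>carrier := K\<rparr>\<^esub> M)"
  have N: "?N \<noteq> 0" using assms(4) H.subset rcosetsI[of H \<one>] by (auto simp: card_eq_0_iff)
  have fac: "?N = ?m * ?u" unfolding M_def by (rule rcosets_factor[OF assms(3,2)])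
  have MG: "subgroup M G" unfolding M_def by (rule subgroups_Inter_pair[OF assms(2) H.subgroup_axioms])
  interpret GM: group "G\<lparr>carrier := M\<rparr>" by (rule subgroup_imp_group[OF MG])
  have "card (chars p (G\<lparr>carrier := M\<rparr>)) = p ^ ?d"
    using card_cocycles(1)[OF p(1) assms(2-5)] unfolding M_def[symmetric] by (rule GM.card_chars[OF assms(1)])
  then have "card (cocycles p K H) = card (coboundary K ` invariant_funs p H) * (p ^ ?d) ^ ?u"
    using card_cocycles(2)[OF p(1) assms(2-5)] by (simp add: M_def)
  then have "card (cocycles p K H) * p ^ ?u = p ^ ?N * (p ^ ?d) ^ ?u"
    using card_coboundaries[OF p(1) assms(2-4)] by (simp add: mult.assoc mult.left_commute flip: mult.commute[of "p ^ ?u"])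
  then have "real (card (cocycles p K H)) * p ^ ?u = p ^ (?N + ?d * ?u)"
    by (metis of_nat_mult of_nat_power power_add power_mult)
  then have "card (cocycles p K H) = p powr (real ?N + real ?d * ?u - ?u)"
    using p by (simp add: powr_diff powr_realpow field_simps flip: of_nat_mult of_nat_add)
  then have "log p (card (cocycles p K H)) = real ?N + real ?d * ?u - ?u" using p by simp
  then show ?thesis using N fac by (simp add: field_simps)
qed

end

section \<open>Bounds for spaces of cocycles\<close>

lemma card_image_le_if_determined:
  assumes "finite (g ` W)" "\<And>v w. v \<in> W \<Longrightarrow> w \<in> W \<Longrightarrow> g v = g w \<Longrightarrow> f v = f w"
  shows "card (f ` W) \<le> card (g ` W)"
proof -
  have "f w = f (SOME v. v \<in> W \<and> g v = g w)" if "w \<in> W" for w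
    using someI[of "\<lambda>v. v \<in> W \<and> g v = g w" w] that assms(2) by metis
  then have "f ` W \<subseteq> (\<lambda>y. f (SOME v. v \<in> W \<and> g v = y)) ` g ` W" by (auto simp: image_image)
  then show ?thesis by (rule surj_card_le[OF assms(1)])
qed

text \<open>The action factors through the finite p-group G/N, so the size of an orbit is a power of
  p, and without fixed points it is divisible by p. Stabilisers contain N and so have finite index,
  although G may be infinite.\<close>

lemma (in group) prime_dvd_card_if_no_fixed_point:
  fixes act :: "'a \<Rightarrow> 'x \<Rightarrow> 'x"
  assumes "prime p" "N \<lhd> G" "card (rcosets N) = p ^ j" "finite X"
    and closed: "\<And>g x. g \<in> carrier G \<Longrightarrow> x \<in> X \<Longrightarrow> act g x \<in> X"
    and one: "\<And>x. x \<in> X \<Longrightarrow> act \<one> x = x"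
    and mult: "\<And>g h x. g \<in> carrier G \<Longrightarrow> h \<in> carrier G \<Longrightarrow> x \<in> X \<Longrightarrow> act (g \<otimes> h) x = act g (act h x)"
    and trivial: "\<And>g x. g \<in> N \<Longrightarrow> x \<in> X \<Longrightarrow> act g x = x"
    and moved: "\<And>x. x \<in> X \<Longrightarrow> \<exists>g\<in>carrier G. act g x \<noteq> x"
  shows "p dvd card X"
proof -
  interpret N: normal N G by fact
  define \<phi> where "\<phi> g = (\<lambda>x\<in>X. act g x)" for g
  have inv: "act (inv g) (act g x) = x" "act g (act (inv g) x) = x" if "g \<in> carrier G" "x \<in> X" for g x
    using that mult[of "inv g" g x] mult[of g "inv g" x] one by simp_all
  have bij: "bij_betw (\<phi> g) X X" if "g \<in> carrier G" for g
    by (rule bij_betw_byWitness[where f' = "\<phi> (inv g)"]) (use that closed inv in \<open>auto simp: \<phi>_def\<close>)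
  have "\<phi> \<in> hom G (BijGroup X)"
  proof (rule homI)
    show "\<phi> g \<in> carrier (BijGroup X)" if "g \<in> carrier G" for g
      using bij[OF that] by (auto simp: BijGroup_def Bij_def \<phi>_def)
    show "\<phi> (g \<otimes> h) = \<phi> g \<otimes>\<^bsub>BijGroup X\<^esub> \<phi> h" if "g \<in> carrier G" "h \<in> carrier G" for g h
      using that bij[OF that(1)] bij[OF that(2)] closed mult
      by (auto simp: BijGroup_def Bij_def \<phi>_def compose_def fun_eq_iff)
  qed
  then interpret group_action G X \<phi>
    by (intro group_action.intro group_hom.intro group_hom_axioms.intro is_group group_BijGroup)
  have dvd_orb: "p dvd card orb" if orb: "orb \<in> orbits G X \<phi>" for orb
  proof -
    obtain x where x: "x \<in> X" "orb = orbit G \<phi> x" using orb by (auto simp: orbits_def)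
    let ?S = "stabilizer G \<phi> x"
    have S: "subgroup ?S G" by (rule stabilizer_subgroup[OF x(1)])
    have NS: "N \<subseteq> ?S" using trivial x(1) N.subset by (auto simp: stabilizer_def \<phi>_def)
    have "N <#> ?S = ?S" by (rule subgroup_set_mult_absorb[OF N.subgroup_axioms S NS])
    then have "card (rcosets ?S) dvd p ^ j"
      using rcosets_factor[OF \<open>N \<lhd> G\<close> S] assms(3) by simp
    then have "card orb dvd p ^ j"
      using bij_betw_same_card[OF orbit_stab_fun_is_bij[OF x(1)]] x(2) by simp
    moreover have "card orb \<noteq> 1"
    proof
      assume "card orb = 1"
      then obtain y where y: "orb = {y}" by (auto simp: card_1_singleton_iff)
      obtain g where g: "g \<in> carrier G" "act g x \<noteq> x" using moved[OF x(1)] by blast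
      have "\<phi> g x \<in> orb" "\<phi> \<one> x \<in> orb" using g x(2) by (auto simp: orbit_def)
      then show False using y g x(1) one by (simp add: \<phi>_def)
    qed
    ultimately obtain i where i: "card orb = p ^ i" "i \<noteq> 0"
      using divides_primepow_nat[OF \<open>prime p\<close>] by (metis power_0)
    then show ?thesis by (simp add: dvd_power)
  qed
  have "p dvd (\<Sum>orb\<in>orbits G X \<phi>. \<Sum>x\<in>orb. 1)" by (rule dvd_sum) (simp add: dvd_orb)
  then show ?thesis using disjoint_sum[OF \<open>finite X\<close>, of "\<lambda>_. 1::nat"] by simp
qed

context group
begin

text \<open>Right translation commutes with the left multiplications that occur in cocycles. On
  functions that are left invariant under a normal H' it is trivial for h in H', so it induces an
  action of quotients by H'. The index i is carried along so that cocycles and pairs of cocycles are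
  treated at once.\<close>

definition translate :: "'a \<Rightarrow> ('i \<times> 'a \<Rightarrow> complex) \<Rightarrow> 'i \<times> 'a \<Rightarrow> complex" where
  "translate h w = (\<lambda>(i, x). if x \<in> carrier G then w (i, x \<otimes> h) else 1)"

text \<open>A finite \<open>p\<close>-group fixes a nonzero vector of every nonzero finite representation over \<open>\<F>\<^sub>p\<close>, hence
  such a representation \<open>W\<close> of \<open>H / H'\<close> embeds into a power of the regular one, with as many copies
  as the dimension of the invariants.\<close>

lemma card_le_card_invariants_power:
  fixes W :: "('i \<times> 'a \<Rightarrow> complex) set"
  assumes "prime p" "H' \<lhd> G" "subgroup H G" "H' \<subseteq> H" "card (rcosets\<^bsub>G\<lparr>carrier := H\<rparr>\<^esub> H') = p ^ j"
    and W: "fun_group p W" "finite W"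
    and out: "\<And>w i x. w \<in> W \<Longrightarrow> x \<notin> carrier G \<Longrightarrow> w (i, x) = 1"
    and inv: "\<And>w i h x. w \<in> W \<Longrightarrow> h \<in> H' \<Longrightarrow> x \<in> carrier G \<Longrightarrow> w (i, h \<otimes> x) = w (i, x)"
    and trans: "\<And>w h. w \<in> W \<Longrightarrow> h \<in> H \<Longrightarrow> translate h w \<in> W"
  shows "card W \<le> card {w\<in>W. \<forall>h\<in>H. translate h w = w} ^ p ^ j"
proof -
  note p = prime_gt_0_nat[OF \<open>prime p\<close>]
  interpret H': normal H' G by fact
  interpret H: subgroup H G by fact
  let ?GH = "G\<lparr>carrier := H\<rparr>"
  interpret GH: group ?GH by (rule subgroup_imp_group[OF assms(3)])
  have H'H: "H' \<lhd> ?GH" by (rule normal_restrict_supergroup[OF assms(3,2,4)])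
  have tr_mult: "translate (g \<otimes> h) w = translate g (translate h w)" if "g \<in> H" "h \<in> H" for g h and w :: "'i \<times> 'a \<Rightarrow> complex"
    using that by (auto simp: translate_def fun_eq_iff m_assoc)
  have tr_one: "translate \<one> w = w" if "w \<in> W" for w
    using out[OF that] by (auto simp: translate_def fun_eq_iff)
  have tr_triv: "translate h w = w" if w: "w \<in> W" and h: "h \<in> H'" for w h
  proof -
    have "w (i, x \<otimes> h) = w (i, x)" if x: "x \<in> carrier G" for i x
    proof -
      have "x \<otimes> h = (x \<otimes> h \<otimes> inv x) \<otimes> x" using x h by (simp add: m_assoc)
      then show ?thesis using inv[OF w H'.inv_op_closed2[OF x h] x] by simp
    qed
    then show ?thesis using out[OF w] by (auto simp: translate_def fun_eq_iff)
  qed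
  have tr_fun_mult: "translate h (\<lambda>q. v q * w q) = (\<lambda>q. translate h v q * translate h w q)"
    for h and v w :: "'i \<times> 'a \<Rightarrow> complex"
    by (auto simp: translate_def fun_eq_iff)
  let ?V = "{w\<in>W. \<forall>h\<in>H. translate h w = w}"
  have V: "fun_group p ?V"
    using fun_group_one[OF W(1)] fun_group_root[OF W(1)] fun_group_mult[OF W(1)]
    unfolding fun_group_def by (auto simp: tr_fun_mult) (auto simp: translate_def)
  have "finite ?V" using W(2) by simp
  then obtain E where E: "finite E" "card ?V = p ^ card E"
    and det: "\<And>v. v \<in> ?V \<Longrightarrow> (\<And>e. e \<in> E \<Longrightarrow> v e = 1) \<Longrightarrow> v = (\<lambda>_. 1)"
    using fun_group_coordinates[OF \<open>prime p\<close> V] by blast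
  define R where "R = rcosets\<^bsub>?GH\<^esub> H'"
  have finR: "finite R" using assms(5) p by (intro card_ge_0_finite) (simp add: R_def)
  have b: "coset_rep (H' #> h) \<in> H' #> h" if "h \<in> H" for h
    using that by (intro coset_rep_in H'.subgroup_axioms) simp
  have bR: "coset_rep C \<in> H" if "C \<in> R" for C
  proof -
    obtain h where h: "h \<in> H" "C = H' #> h" using \<open>C \<in> R\<close> by (auto simp: R_def RCOSETS_def r_coset_def)
    then show ?thesis using b[OF h(1)] assms(4) by (auto simp: r_coset_def)
  qed
  have tr_b: "translate (coset_rep (H' #> h)) w = translate h w" if w: "w \<in> W" and h: "h \<in> H" for w h
  proof -
    obtain g where g: "g \<in> H'" "coset_rep (H' #> h) = g \<otimes> h" using b[OF h] by (auto simp: r_coset_def)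
    then show ?thesis using tr_mult[of g h w] tr_triv[OF trans[OF w h] g(1)] assms(4) h by auto
  qed
  \<comment> \<open>The map to a power of the regular representation: the coordinates of the
    invariants, evaluated on all translates.\<close>
  let ?\<phi> = "\<lambda>w (C, e). if C \<in> R \<and> e \<in> E then translate (coset_rep C) w e else 1"
  let ?U = "{w\<in>W. ?\<phi> w = (\<lambda>_. 1)}"
  have nz: "translate h w q \<noteq> 0" if "w \<in> W" for h w q
    using fun_group_nonzero[OF W(1) p that] by (auto simp: translate_def split: prod.splits)
  have card: "card W = card (?\<phi> ` W) * card ?U"
    by (rule card_image_kernel[OF W(1) p W(2)])
      (auto simp: fun_eq_iff tr_fun_mult nz split: if_splits)
  have U_iff: "w \<in> ?U \<longleftrightarrow> w \<in> W \<and> (\<forall>h\<in>H. \<forall>e\<in>E. translate h w e = 1)" for w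
  proof
    assume w: "w \<in> ?U"
    have "translate h w e = 1" if h: "h \<in> H" and e: "e \<in> E" for h e
    proof -
      have "H' #> h \<in> R" using h by (auto simp: R_def RCOSETS_def r_coset_def)
      moreover have "?\<phi> w (H' #> h, e) = 1" using w by (auto dest: fun_cong)
      ultimately show ?thesis using e tr_b[of w h] w h by simp
    qed
    then show "w \<in> W \<and> (\<forall>h\<in>H. \<forall>e\<in>E. translate h w e = 1)" using w by blast
  next
    assume "w \<in> W \<and> (\<forall>h\<in>H. \<forall>e\<in>E. translate h w e = 1)"
    then show "w \<in> ?U" using bR by (auto simp: fun_eq_iff)
  qed
  have U: "fun_group p ?U"
    unfolding fun_group_def
  proof (intro conjI ballI allI)
    show "(\<lambda>_. 1) \<in> ?U" using fun_group_one[OF W(1)] unfolding U_iff by (simp add: translate_def split: prod.splits)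
    fix v assume v: "v \<in> ?U"
    show "v q ^ p = 1" for q using v fun_group_root[OF W(1)] by blast
    show "(\<lambda>q. v q * w q) \<in> ?U" if "w \<in> ?U" for w
      using v that fun_group_mult[OF W(1)] unfolding U_iff by (simp add: tr_fun_mult)
  qed
  have finU: "finite ?U" using W(2) by simp
  have U_trans: "translate h w \<in> ?U" if w: "w \<in> ?U" and h: "h \<in> H" for w h
  proof -
    have "translate g (translate h w) e = 1" if "g \<in> H" "e \<in> E" for g e
      using w that h tr_mult[of g h w] unfolding U_iff by (metis H.m_closed)
    then show ?thesis using w h trans unfolding U_iff by blast
  qed
  have U_fixed: "w = (\<lambda>_. 1)" if w: "w \<in> ?U" and fixed: "\<And>h. h \<in> H \<Longrightarrow> translate h w = w" for w
  proof (rule det)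
    show "w \<in> ?V" using w fixed by blast
    show "w e = 1" if "e \<in> E" for e
      using w that fixed[OF H.one_closed] unfolding U_iff by (metis H.one_closed)
  qed
  \<comment> \<open>A fixed vector in the kernel is an invariant that vanishes on E, hence trivial.
    So p divides the number of nontrivial elements of the kernel, whose order is a power of p; the
    kernel must be trivial.\<close>
  have p_dvd: "p dvd card (?U - {\<lambda>_. 1})"
  proof (rule GH.prime_dvd_card_if_no_fixed_point[OF \<open>prime p\<close> H'H assms(5), of _ translate])
    show "finite (?U - {\<lambda>_. 1})" using finU by simp
    fix w assume w: "w \<in> ?U - {\<lambda>_. 1}"
    then have wW: "w \<in> W" by blast
    show "translate \<one>\<^bsub>?GH\<^esub> w = w" using tr_one[OF wW] by simp
    show "translate h w = w" if "h \<in> H'" for h using tr_triv[OF wW that] .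
    show "\<exists>h\<in>carrier ?GH. translate h w \<noteq> w" using U_fixed[of w] w by auto
    fix h assume h: "h \<in> carrier ?GH"
    show "translate (g \<otimes>\<^bsub>?GH\<^esub> h) w = translate g (translate h w)" if "g \<in> carrier ?GH" for g
      using tr_mult h that by simp
    have "translate h w \<noteq> (\<lambda>_. 1)"
    proof
      assume "translate h w = (\<lambda>_. 1)"
      then have "translate (inv h) (translate h w) = (\<lambda>_. 1)" by (auto simp: translate_def fun_eq_iff)
      then have "translate (inv h \<otimes> h) w = (\<lambda>_. 1)" using tr_mult[of "inv h" h w] h by simp
      then show False using tr_one[OF wW] h w by simp
    qed
    then show "translate h w \<in> ?U - {\<lambda>_. 1}" using U_trans w h by simp
  qed
  have card_U: "card ?U = Suc (card (?U - {\<lambda>_. 1}))"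
    by (rule card.remove[OF finU fun_group_one[OF U]])
  obtain E' :: "('i \<times> 'a) set" where E': "card ?U = p ^ card E'"
    by (rule fun_group_coordinates[OF \<open>prime p\<close> U finU]) blast
  have "card E' = 0"
  proof (rule ccontr)
    assume "card E' \<noteq> 0"
    then have "p dvd card ?U" unfolding E' by (intro dvd_power) simp
    then have "p dvd card (?U - {\<lambda>_. 1}) + 1" using card_U by (metis Suc_eq_plus1)
    then have "p dvd 1" by (rule dvd_add_right_iff[OF p_dvd, THEN iffD1])
    then show False using prime_gt_1_nat[OF \<open>prime p\<close>] by simp
  qed
  then have cU: "card ?U = 1" using E' by simp
  have "card (?\<phi> ` W) \<le> card (R \<times> E \<rightarrow>\<^sub>E {z::complex. z ^ p = 1})"
  proof -
    let ?r = "\<lambda>w. \<lambda>q\<in>R \<times> E. ?\<phi> w q"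
    have sub: "?r ` W \<subseteq> (R \<times> E \<rightarrow>\<^sub>E {z. z ^ p = 1})"
      using fun_group_root[OF W(1)] by (auto simp: translate_def split: if_splits)
    have fin: "finite (R \<times> E \<rightarrow>\<^sub>E {z::complex. z ^ p = 1})"
      using finR E(1) p by (intro finite_PiE) (auto intro: finite_roots_unity)
    have "card (?\<phi> ` W) \<le> card (?r ` W)"
    proof (rule card_image_le_if_determined)
      show "finite (?r ` W)" using W(2) by simp
      fix v w assume eq: "?r v = ?r w"
      show "?\<phi> v = ?\<phi> w"
      proof (rule ext)
        fix q
        show "?\<phi> v q = ?\<phi> w q" using fun_cong[OF eq, of q] by (cases q) (auto split: if_splits)
      qed
    qed
    also have "\<dots> \<le> card (R \<times> E \<rightarrow>\<^sub>E {z::complex. z ^ p = 1})" by (rule card_mono[OF fin sub])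
    finally show ?thesis .
  qed
  also have "\<dots> = p ^ (card E * p ^ j)"
    using finR E(1) assms(5) by (simp add: card_PiE card_roots_unity_eq[OF p] card_cartesian_product R_def mult.commute)
  finally show ?thesis using card cU E(2) by (simp add: power_mult)
qed

text \<open>Shearer's inequality for the windows \<open>F x\<close>: on a window, a cocycle is the coboundary of a
  potential that vanishes at a base point, hence takes at most \<open>p ^ (card F - 1)\<close> values.\<close>

lemma card_cocycles_window_bound:
  assumes "p > 0" "subgroup B G" "H \<lhd> G" "finite (rcosets H)"
    and S: "finite S" "S \<subseteq> B" "generate G S = B"
    and F: "finite F" "F \<subseteq> B" "F \<noteq> {}"
    and cover: "\<And>s. s \<in> S \<Longrightarrow> k \<le> card {f\<in>F. s \<otimes> f \<in> F}"
    and sep: "\<And>f g. f \<in> F \<Longrightarrow> g \<in> F \<Longrightarrow> inv f \<otimes> g \<in> H \<Longrightarrow> f = g"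
  shows "card (cocycles p B H) ^ k \<le> p ^ ((card F - 1) * card (rcosets H))"
proof -
  interpret H: normal H G by fact
  interpret B: subgroup B G by fact
  let ?W = "cocycles p B H" and ?J = "rcosets H"
  note W = fun_group_cocycles[of p B H] \<open>p > 0\<close> finite_cocycles[OF assms(1-4) S]
  note b = coset_rep_in[OF H.subgroup_axioms] and bJ = coset_rep_rcosets[OF H.subgroup_axioms]
  have cb: "c (l, coset_rep (H #> x)) = c (l, x)" if c: "c \<in> ?W" "l \<in> B" and x: "x \<in> carrier G" for c l x
  proof -
    obtain h where "h \<in> H" "coset_rep (H #> x) = h \<otimes> x" using b[OF x] by (auto simp: r_coset_def)
    then show ?thesis using cocycle_invariant[OF c _ x] by simp
  qed
  define E where "E = S \<times> coset_rep ` ?J"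
  \<comment> \<open>Think of (s, x) as the edge from x to s x in a graph on the cosets of H.
    \<open>D j\<close> consists of the edges of the window F y, with y the representative of j, that
    have both ends in the window.\<close>
  define D where "D j = {(s, coset_rep (H #> (f \<otimes> coset_rep j))) | s f. s \<in> S \<and> f \<in> F \<and> s \<otimes> f \<in> F}" for j
  have "inj_on (restr E) ?W"
  proof (rule inj_onI)
    fix c d assume cd: "c \<in> ?W" "d \<in> ?W" "restr E c = restr E d"
    have "(\<lambda>q. c q / d q) = (\<lambda>_. 1)"
    proof (rule cocycle_determined[OF assms(1-3) S(2,3)])
      show "(\<lambda>q. c q / d q) \<in> ?W" by (rule fun_group_divide[OF W(1,2) cd(1,2)])
      fix s x assume sx: "s \<in> S" "x \<in> carrier G"
      then have "(s, coset_rep (H #> x)) \<in> E" using H.subset by (auto simp: E_def intro: rcosetsI)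
      then have "c (s, coset_rep (H #> x)) = d (s, coset_rep (H #> x))" using cd(3) by (simp add: restr_eq_iff)
      then have "c (s, x) = d (s, x)" using cb[OF cd(1) _ sx(2)] cb[OF cd(2) _ sx(2)] sx(1) S(2) by auto
      then show "c (s, x) / d (s, x) = 1" using cocycle_nonzero[OF assms(1) cd(2)] by simp
    qed
    then show "c = d" by (rule fun_group_eqI[OF W(1,2) cd(2)])
  qed
  then have "card ?W ^ k = card (restr E ` ?W) ^ k" by (simp add: card_image)
  also have "\<dots> \<le> (\<Prod>j\<in>?J. card (restr (D j \<inter> E) ` ?W))"
  proof (rule shearer_card[OF W assms(4)])
    show "finite E" using S(1) assms(4) by (simp add: E_def)
    fix e assume "e \<in> E"
    then obtain s C where e: "s \<in> S" "C \<in> ?J" "e = (s, coset_rep C)" by (auto simp: E_def)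
    let ?x = "coset_rep C"
    have x: "?x \<in> carrier G" by (rule bJ(1)[OF e(2)])
    \<comment> \<open>The edge at x labelled s lies in the window based at f^-1 x for every f with
      both f and s f in F; \<open>sep\<close> makes these windows different.\<close>
    let ?j = "\<lambda>f. H #> (inv f \<otimes> ?x)"
    have "inj_on ?j {f\<in>F. s \<otimes> f \<in> F}"
    proof (rule inj_onI)
      fix f g assume fg: "f \<in> {f\<in>F. s \<otimes> f \<in> F}" "g \<in> {f\<in>F. s \<otimes> f \<in> F}" "?j f = ?j g"
      then have fgB: "f \<in> carrier G" "g \<in> carrier G" using F(2) by auto
      then have "inv f \<otimes> ?x \<in> ?j g"
        using fg(3) rcos_self[OF _ H.subgroup_axioms, of "inv f \<otimes> ?x"] x by simp
      then obtain h where h: "h \<in> H" "inv f \<otimes> ?x = h \<otimes> (inv g \<otimes> ?x)" by (auto simp: r_coset_def)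
      then have "inv f \<otimes> ?x = (h \<otimes> inv g) \<otimes> ?x" using x fgB by (simp add: m_assoc)
      then have "inv f = h \<otimes> inv g" using x fgB h(1) by simp
      then have "inv f \<otimes> g \<in> H" using h(1) fgB by (simp add: m_assoc)
      then show "f = g" using sep fg(1,2) by blast
    qed
    moreover have "?j f \<in> {j\<in>?J. e \<in> D j}" if f: "f \<in> {f\<in>F. s \<otimes> f \<in> F}" for f
    proof -
      have fG: "f \<in> carrier G" using f F(2) by auto
      have jJ: "?j f \<in> ?J" using fG x H.subset by (intro rcosetsI) auto
      obtain h where h: "h \<in> H" "coset_rep (?j f) = h \<otimes> (inv f \<otimes> ?x)"
        using b[of "inv f \<otimes> ?x"] fG x by (auto simp: r_coset_def)
      have "f \<otimes> coset_rep (?j f) = (f \<otimes> h \<otimes> inv f) \<otimes> ?x" using h fG x by (simp add: m_assoc)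
      then have "f \<otimes> coset_rep (?j f) \<in> H #> ?x"
        using H.inv_op_closed2[OF fG h(1)] by (auto simp: r_coset_def)
      then have "H #> (f \<otimes> coset_rep (?j f)) = C"
        using repr_independence[OF _ x H.subgroup_axioms] bJ(2)[OF e(2)] by metis
      then have "e = (s, coset_rep (H #> (f \<otimes> coset_rep (?j f))))" using e(3) by simp
      then have "e \<in> D (?j f)" unfolding D_def using e(1) f by blast
      then show ?thesis using jJ by blast
    qed
    ultimately have "card {f\<in>F. s \<otimes> f \<in> F} \<le> card {j\<in>?J. e \<in> D j}"
      using assms(4) by (intro card_inj_on_le[of ?j]) auto
    then show "k \<le> card {j\<in>?J. e \<in> D j}" using cover[OF e(1)] by simp
  qed
  also have "\<dots> \<le> (\<Prod>j\<in>?J. p ^ (card F - 1))"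
  proof (rule prod_mono, safe)
    fix j assume j: "j \<in> ?J"
    \<comment> \<open>The base point of the window is g y. The values c(f g^-1, g y) form a
      potential whose value at f = g is 1, which leaves \<open>card F - 1\<close> free values; by
      \<open>edge\<close>, c on an edge of the window is a quotient of two values of the
      potential.\<close>
    obtain g where g: "g \<in> F" using F(3) by blast
    have gB: "g \<in> B" using g F(2) by blast
    let ?y = "coset_rep j"
    have y: "?y \<in> carrier G" by (rule bJ(1)[OF j])
    let ?P = "F - {g} \<rightarrow>\<^sub>E {z::complex. z ^ p = 1}"
    let ?l = "\<lambda>c. \<lambda>f\<in>F - {g}. c (f \<otimes> inv g, g \<otimes> ?y)"
    have sub: "?l ` ?W \<subseteq> ?P" using cocycle_root by (auto split: if_splits)
    have fin: "finite ?P" using F(1) assms(1) by (intro finite_PiE) (auto intro: finite_roots_unity)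
    have "card (restr (D j \<inter> E) ` ?W) \<le> card (?l ` ?W)"
    proof (rule card_image_le_if_determined)
      show "finite (?l ` ?W)" using sub fin finite_subset by blast
      fix c d assume cd: "c \<in> ?W" "d \<in> ?W" "?l c = ?l d"
      have pot: "c (f \<otimes> inv g, g \<otimes> ?y) = d (f \<otimes> inv g, g \<otimes> ?y)" if f: "f \<in> F" for f
      proof (cases "f = g")
        case True
        then show ?thesis using gB cocycle_one[OF assms(1,2) cd(1)] cocycle_one[OF assms(1,2) cd(2)] by simp
      next
        case False
        then show ?thesis using fun_cong[OF cd(3), of f] f by simp
      qed
      have edge: "w (s, coset_rep (H #> (f \<otimes> ?y))) * w (f \<otimes> inv g, g \<otimes> ?y) = w ((s \<otimes> f) \<otimes> inv g, g \<otimes> ?y)"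
        if w: "w \<in> ?W" and sf: "s \<in> S" "f \<in> F" for w s f
      proof -
        have sfB: "s \<in> B" "f \<in> B" using sf S(2) F(2) by auto
        have fy: "f \<otimes> inv g \<otimes> (g \<otimes> ?y) = f \<otimes> ?y"
        proof -
          have "inv g \<otimes> (g \<otimes> ?y) = ?y" using gB y by (simp flip: m_assoc)
          then show ?thesis using sfB gB y by (simp add: m_assoc)
        qed
        have "w (s \<otimes> (f \<otimes> inv g), g \<otimes> ?y) = w (s, f \<otimes> inv g \<otimes> (g \<otimes> ?y)) * w (f \<otimes> inv g, g \<otimes> ?y)"
          using sfB gB y by (intro cocycle_mult[OF w]) auto
        then show ?thesis using cb[OF w sfB(1), of "f \<otimes> ?y"] fy sfB gB y by (simp add: m_assoc)
      qed
      show "restr (D j \<inter> E) c = restr (D j \<inter> E) d"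
        unfolding restr_eq_iff
      proof
        fix e assume "e \<in> D j \<inter> E"
        then obtain s f where e: "e = (s, coset_rep (H #> (f \<otimes> ?y)))" "s \<in> S" "f \<in> F" "s \<otimes> f \<in> F"
          by (auto simp: D_def)
        have "c e * c (f \<otimes> inv g, g \<otimes> ?y) = d e * d (f \<otimes> inv g, g \<otimes> ?y)"
          using edge[OF cd(1) e(2,3)] edge[OF cd(2) e(2,3)] pot[OF e(4)] e(1) by simp
        then show "c e = d e" using pot[OF e(3)] cocycle_nonzero[OF assms(1) cd(2)] by simp
      qed
    qed
    also have "\<dots> \<le> card ?P" by (rule card_mono[OF fin sub])
    also have "\<dots> = p ^ (card F - 1)" using F(1) g by (simp add: card_PiE card_roots_unity_eq[OF assms(1)])
    finally show "card (restr (D j \<inter> E) ` ?W) \<le> p ^ (card F - 1)" .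
  qed
  also have "\<dots> = p ^ ((card F - 1) * card ?J)" by (simp add: power_mult)
  finally show ?thesis .
qed

end

section \<open>Cocycles of amalgamated products\<close>

lemma amalgam_eq_in_lists:
  assumes "group G1" "group G2" "i1 \<in> carrier A \<rightarrow> carrier G1" "i2 \<in> carrier A \<rightarrow> carrier G2"
    and "amalgam_eq G1 G2 A i1 i2 u v"
  shows "u \<in> lists (carrier G1 <+> carrier G2) \<and> v \<in> lists (carrier G1 <+> carrier G2)"
proof -
  interpret G1: group G1 by fact
  interpret G2: group G2 by fact
  show ?thesis
    using assms(5) by induction (use assms(3,4) in \<open>auto simp: Pi_iff\<close>)
qed

lemma amalgam_eq_append1:
  assumes "amalgam_eq G1 G2 A i1 i2 u u'" "w \<in> lists (carrier G1 <+> carrier G2)"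
  shows "amalgam_eq G1 G2 A i1 i2 (u @ w) (u' @ w)"
  using assms
proof induction
  case (refl v)
  then show ?case by (intro amalgam_eq.refl) simp
next
  case (sym u v)
  then show ?case by (blast intro: amalgam_eq.sym)
next
  case (trans u v v')
  then show ?case by (blast intro: amalgam_eq.trans)
next
  case (mult1 u v x y)
  then show ?case using amalgam_eq.mult1[of u G1 G2 "v @ w" x y A i1 i2] by simp
next
  case (mult2 u v x y)
  then show ?case using amalgam_eq.mult2[of u G1 G2 "v @ w" x y A i1 i2] by simp
next
  case (one1 u v )
  then show ?case using amalgam_eq.one1[of u G1 G2 "v @ w" A i1 i2] by simp
next
  case (one2 u v )
  then show ?case using amalgam_eq.one2[of u G1 G2 "v @ w" A i1 i2] by simp
next
  case (glue u v a)
  then show ?case using amalgam_eq.glue[of u G1 G2 "v @ w" a A i1 i2] by simp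
qed

lemma amalgam_eq_append2:
  assumes "amalgam_eq G1 G2 A i1 i2 u u'" "w \<in> lists (carrier G1 <+> carrier G2)"
  shows "amalgam_eq G1 G2 A i1 i2 (w @ u) (w @ u')"
  using assms
proof induction
  case (refl v)
  then show ?case by (intro amalgam_eq.refl) simp
next
  case (sym u v)
  then show ?case by (blast intro: amalgam_eq.sym)
next
  case (trans u v v')
  then show ?case by (blast intro: amalgam_eq.trans)
next
  case (mult1 u v x y)
  then show ?case using amalgam_eq.mult1[of "w @ u" G1 G2 v x y A i1 i2] by simp
next
  case (mult2 u v x y)
  then show ?case using amalgam_eq.mult2[of "w @ u" G1 G2 v x y A i1 i2] by simp
next
  case (one1 u v )
  then show ?case using amalgam_eq.one1[of "w @ u" G1 G2 v A i1 i2] by simp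
next
  case (one2 u v )
  then show ?case using amalgam_eq.one2[of "w @ u" G1 G2 v A i1 i2] by simp
next
  case (glue u v a)
  then show ?case using amalgam_eq.glue[of "w @ u" G1 G2 v a A i1 i2] by simp
qed

lemma amalgam_class_eq:
  "amalgam_eq G1 G2 A i1 i2 u v \<Longrightarrow> amalgam_class G1 G2 A i1 i2 u = amalgam_class G1 G2 A i1 i2 v"
  unfolding amalgam_class_def by (blast intro: amalgam_eq.trans amalgam_eq.sym)

text \<open>The relation is a congruence for concatenation, so all classes in the union that defines
  the product coincide.\<close>

lemma mult_amalgam_class:
  assumes "group G1" "group G2" "i1 \<in> carrier A \<rightarrow> carrier G1" "i2 \<in> carrier A \<rightarrow> carrier G2"
    and uv: "u \<in> lists (carrier G1 <+> carrier G2)" "v \<in> lists (carrier G1 <+> carrier G2)"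
  shows "amalgam_class G1 G2 A i1 i2 u \<otimes>\<^bsub>amalgam G1 G2 A i1 i2\<^esub> amalgam_class G1 G2 A i1 i2 v =
    amalgam_class G1 G2 A i1 i2 (u @ v)"
proof -
  let ?c = "amalgam_class G1 G2 A i1 i2"
  have "?c (u' @ v') = ?c (u @ v)" if "u' \<in> ?c u" "v' \<in> ?c v" for u' v'
  proof -
    have eq: "amalgam_eq G1 G2 A i1 i2 u u'" "amalgam_eq G1 G2 A i1 i2 v v'"
      using that by (auto simp: amalgam_class_def)
    have "u' \<in> lists (carrier G1 <+> carrier G2)" using amalgam_eq_in_lists[OF assms(1-4) eq(1)] by blast
    then have "amalgam_eq G1 G2 A i1 i2 (u @ v) (u' @ v')"
      using amalgam_eq.trans[OF amalgam_eq_append1[OF eq(1) uv(2)] amalgam_eq_append2[OF eq(2)]] by blast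
    then show ?thesis using amalgam_class_eq by metis
  qed
  moreover have "u \<in> ?c u" "v \<in> ?c v" using uv by (auto simp: amalgam_class_def intro: amalgam_eq.refl)
  ultimately have "(\<Union>u'\<in>?c u. \<Union>v'\<in>?c v. ?c (u' @ v')) = ?c (u @ v)"
    by (intro equalityI UN_least subsetI) blast+
  then show ?thesis by (simp add: amalgam_def)
qed

section \<open>Words, and pairs of cocycles that agree on a subgroup\<close>

context group
begin

primrec word_eval :: "('a + 'a) list \<Rightarrow> 'a" where
  "word_eval [] = \<one>"
| "word_eval (l # w) = case_sum id id l \<otimes> word_eval w"

text \<open>This extends a pair of cocycles to words by the cocycle identity: a word acts from right
  to left, and each letter is evaluated at the point to which the letters on its right have moved
  x.\<close>

primrec word_cocycle :: "(('a + 'a) \<times> 'a \<Rightarrow> complex) \<Rightarrow> ('a + 'a) list \<Rightarrow> 'a \<Rightarrow> complex" where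
  "word_cocycle c [] x = 1"
| "word_cocycle c (l # w) x = c (l, word_eval w \<otimes> x) * word_cocycle c w x"

lemma word_eval_closed:
  "subgroup K1 G \<Longrightarrow> subgroup K2 G \<Longrightarrow> w \<in> lists (K1 <+> K2) \<Longrightarrow> word_eval w \<in> carrier G"
  by (induction w) (auto dest: subgroup.mem_carrier)

lemma word_eval_append:
  assumes "subgroup K1 G" "subgroup K2 G" "u \<in> lists (K1 <+> K2)" "v \<in> lists (K1 <+> K2)"
  shows "word_eval (u @ v) = word_eval u \<otimes> word_eval v"
  using assms(3)
proof (induction u)
  case (Cons l u)
  then have "case_sum id id l \<in> carrier G" using assms(1,2) by (auto dest: subgroup.mem_carrier)
  then show ?case
    using Cons word_eval_closed[OF assms(1,2)] assms(4) by (auto simp: m_assoc)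
qed (use word_eval_closed[OF assms(1,2,4)] in simp)

lemma word_cocycle_append:
  assumes "subgroup K1 G" "subgroup K2 G" "u \<in> lists (K1 <+> K2)" "v \<in> lists (K1 <+> K2)" "x \<in> carrier G"
  shows "word_cocycle c (u @ v) x = word_cocycle c u (word_eval v \<otimes> x) * word_cocycle c v x"
  using assms(3)
proof (induction u)
  case (Cons l u)
  then have "word_eval u \<in> carrier G" "u \<in> lists (K1 <+> K2)" using word_eval_closed[OF assms(1,2)] by auto
  then show ?case
    using Cons word_eval_closed[OF assms(1,2,4)] assms(5) word_eval_append[OF assms(1,2) _ assms(4)]
    by (simp add: m_assoc)
qed simp

text \<open>The fibre product over B, encoded as one function with a tagged first argument so that
  the results on \<open>fun_group\<close> and \<open>translate\<close> apply directly. For empty B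
  it is the full product.\<close>

definition pair_cocycles ::
  "nat \<Rightarrow> 'a set \<Rightarrow> 'a set \<Rightarrow> 'a set \<Rightarrow> 'a set \<Rightarrow> (('a + 'a) \<times> 'a \<Rightarrow> complex) set" where
  "pair_cocycles p K1 K2 B H = {c.
     (\<lambda>(k, x). c (Inl k, x)) \<in> cocycles p K1 H \<and> (\<lambda>(k, x). c (Inr k, x)) \<in> cocycles p K2 H \<and>
     (\<forall>b\<in>B. \<forall>x\<in>carrier G. c (Inl b, x) = c (Inr b, x))}"

lemma pair_cocycles_iff:
  "c \<in> pair_cocycles p K1 K2 B H \<longleftrightarrow>
    c \<in> pair_cocycles p K1 K2 {} H \<and> (\<forall>b\<in>B. \<forall>x\<in>carrier G. c (Inl b, x) = c (Inr b, x))"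
  by (auto simp: pair_cocycles_def)

lemma fun_group_pair_cocycles: "fun_group p (pair_cocycles p K1 K2 B H)"
  unfolding fun_group_def
proof (intro conjI ballI allI)
  show "(\<lambda>_. 1) \<in> pair_cocycles p K1 K2 B H"
    using fun_group_one[OF fun_group_cocycles] by (simp add: pair_cocycles_def case_prod_unfold)
  fix c assume c: "c \<in> pair_cocycles p K1 K2 B H"
  then have c': "(\<lambda>(k, x). c (Inl k, x)) \<in> cocycles p K1 H" "(\<lambda>(k, x). c (Inr k, x)) \<in> cocycles p K2 H"
    by (auto simp: pair_cocycles_def)
  have "c (i, x) ^ p = 1" for i x
    using cocycle_root[OF c'(1), of "(projl i, x)"] cocycle_root[OF c'(2), of "(projr i, x)"] by (cases i) auto
  then show "c q ^ p = 1" for q by (cases q) simp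
  fix d assume d: "d \<in> pair_cocycles p K1 K2 B H"
  then have d': "(\<lambda>(k, x). d (Inl k, x)) \<in> cocycles p K1 H" "(\<lambda>(k, x). d (Inr k, x)) \<in> cocycles p K2 H"
    by (auto simp: pair_cocycles_def)
  show "(\<lambda>q. c q * d q) \<in> pair_cocycles p K1 K2 B H"
    using fun_group_mult[OF fun_group_cocycles c'(1) d'(1)] fun_group_mult[OF fun_group_cocycles c'(2) d'(2)] c d
    by (simp add: pair_cocycles_def case_prod_unfold)
qed

lemma pair_cocycle_outside:
  assumes "c \<in> pair_cocycles p K1 K2 B H" "x \<notin> carrier G"
  shows "c (i, x) = 1"
proof -
  have c: "(\<lambda>(k, x). c (Inl k, x)) \<in> cocycles p K1 H" "(\<lambda>(k, x). c (Inr k, x)) \<in> cocycles p K2 H"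
    using assms(1) by (auto simp: pair_cocycles_def)
  show ?thesis
    using cocycle_outside[OF c(1), of "projl i" x] cocycle_outside[OF c(2), of "projr i" x] assms(2)
    by (cases i) auto
qed

lemma pair_cocycle_invariant:
  assumes "c \<in> pair_cocycles p K1 K2 B H" "h \<in> H" "x \<in> carrier G"
  shows "c (i, h \<otimes> x) = c (i, x)"
proof -
  have c: "(\<lambda>(k, x). c (Inl k, x)) \<in> cocycles p K1 H" "(\<lambda>(k, x). c (Inr k, x)) \<in> cocycles p K2 H"
    using assms(1) by (auto simp: pair_cocycles_def)
  have "c (Inl k, h \<otimes> x) = c (Inl k, x)" for k
    using cocycle_invariant[OF c(1) _ assms(2,3), of k] cocycle_outside[OF c(1), of k] by (cases "k \<in> K1") auto
  moreover have "c (Inr k, h \<otimes> x) = c (Inr k, x)" for k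
    using cocycle_invariant[OF c(2) _ assms(2,3), of k] cocycle_outside[OF c(2), of k] by (cases "k \<in> K2") auto
  ultimately show ?thesis by (cases i) auto
qed

lemma card_pair_cocycles_empty:
  "card (pair_cocycles p K1 K2 {} H) = card (cocycles p K1 H) * card (cocycles p K2 H)"
  "finite (cocycles p K1 H) \<Longrightarrow> finite (cocycles p K2 H) \<Longrightarrow> finite (pair_cocycles p K1 K2 B H)"
proof -
  let ?g = "\<lambda>(c1, c2) (i, x). case i of Inl k \<Rightarrow> c1 (k, x) | Inr k \<Rightarrow> c2 (k, x)"
  have bij: "bij_betw (\<lambda>c. (\<lambda>(k, x). c (Inl k, x), \<lambda>(k, x). c (Inr k, x)))
      (pair_cocycles p K1 K2 {} H) (cocycles p K1 H \<times> cocycles p K2 H)"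
  proof (rule bij_betw_byWitness[where f' = ?g])
    show "\<forall>c\<in>pair_cocycles p K1 K2 {} H. ?g (\<lambda>(k, x). c (Inl k, x), \<lambda>(k, x). c (Inr k, x)) = c"
      by (auto simp: fun_eq_iff split: sum.splits)
    show "?g ` (cocycles p K1 H \<times> cocycles p K2 H) \<subseteq> pair_cocycles p K1 K2 {} H"
      by (auto simp: pair_cocycles_def)
  qed (auto simp: pair_cocycles_def)
  show "card (pair_cocycles p K1 K2 {} H) = card (cocycles p K1 H) * card (cocycles p K2 H)"
    using bij_betw_same_card[OF bij] by (simp add: card_cartesian_product)
  assume "finite (cocycles p K1 H)" "finite (cocycles p K2 H)"
  then have "finite (pair_cocycles p K1 K2 {} H)" using bij_betw_finite[OF bij] by simp
  then show "finite (pair_cocycles p K1 K2 B H)"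
    by (rule rev_finite_subset) (auto simp: pair_cocycles_def)
qed

text \<open>\<open>I\<close> is the image of the difference map, which restricts both members of a
  pair to B and divides them; its kernel is the fibre product. A coboundary on B is the image of the
  coboundary of the same function on K1, paired with the trivial cocycle on K2.\<close>

lemma card_pair_cocycles:
  assumes "p > 0" "subgroup B G" "B \<subseteq> K1" "B \<subseteq> K2" "subgroup K1 G" "subgroup K2 G" "H \<lhd> G"
    and fin: "finite (cocycles p K1 H)" "finite (cocycles p K2 H)"
  obtains I where "coboundary B ` invariant_funs p H \<subseteq> I" "I \<subseteq> cocycles p B H" "finite I"
    "card (pair_cocycles p K1 K2 B H) * card I = card (cocycles p K1 H) * card (cocycles p K2 H)"
proof -
  let ?W = "pair_cocycles p K1 K2 {} H"
  let ?\<phi> = "\<lambda>c (b, x). if b \<in> B \<and> x \<in> carrier G then c (Inl b, x) / c (Inr b, x) else (1 :: complex)"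
  note W = fun_group_pair_cocycles[of p K1 K2 "{}" H]
  note nz = fun_group_nonzero[OF W assms(1)]
  interpret B: subgroup B G by fact
  have "card ?W = card (?\<phi> ` ?W) * card {c\<in>?W. ?\<phi> c = (\<lambda>_. 1)}"
    by (rule card_image_kernel[OF W assms(1) card_pair_cocycles_empty(2)[OF fin]])
      (auto simp: fun_eq_iff nz split: if_splits)
  moreover have "{c\<in>?W. ?\<phi> c = (\<lambda>_. 1)} = pair_cocycles p K1 K2 B H"
  proof (intro equalityI subsetI)
    fix c assume "c \<in> {c\<in>?W. ?\<phi> c = (\<lambda>_. 1)}"
    then have c: "c \<in> ?W" "?\<phi> c = (\<lambda>_. 1)" by blast+
    have "c (Inl b, x) = c (Inr b, x)" if bx: "b \<in> B" "x \<in> carrier G" for b x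
    proof -
      have "?\<phi> c (b, x) = 1" using c(2) by (rule fun_cong)
      then show ?thesis using bx nz[OF c(1), of "(Inr b, x)"] by simp
    qed
    then show "c \<in> pair_cocycles p K1 K2 B H" using c(1) pair_cocycles_iff[of c p K1 K2 B H] by blast
  next
    fix c assume "c \<in> pair_cocycles p K1 K2 B H"
    then have c: "c \<in> ?W" "\<And>b x. b \<in> B \<Longrightarrow> x \<in> carrier G \<Longrightarrow> c (Inl b, x) = c (Inr b, x)"
      using pair_cocycles_iff[of c p K1 K2 B H] by blast+
    then have "?\<phi> c = (\<lambda>_. 1)" using nz[OF c(1)] by (auto simp: fun_eq_iff)
    then show "c \<in> {c\<in>?W. ?\<phi> c = (\<lambda>_. 1)}" using c(1) by blast
  qed
  ultimately have card: "card (pair_cocycles p K1 K2 B H) * card (?\<phi> ` ?W) =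
      card (cocycles p K1 H) * card (cocycles p K2 H)"
    by (simp add: card_pair_cocycles_empty mult.commute)
  have "coboundary B ` invariant_funs p H \<subseteq> ?\<phi> ` ?W"
  proof
    fix d assume "d \<in> coboundary B ` invariant_funs p H"
    then obtain l where l: "l \<in> invariant_funs p H" "d = coboundary B l" by blast
    define c where "c = (\<lambda>(i, x). case i of Inl k \<Rightarrow> coboundary K1 l (k, x) | Inr (k :: 'a) \<Rightarrow> 1)"
    have "c \<in> ?W"
      using coboundary_cocycle[OF assms(1,5,7) l(1)] fun_group_one[OF fun_group_cocycles]
      by (simp add: c_def pair_cocycles_def case_prod_unfold)
    moreover have "d = ?\<phi> c" using assms(3) by (auto simp: l(2) c_def coboundary_def fun_eq_iff)
    ultimately show "d \<in> ?\<phi> ` ?W" by blast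
  qed
  moreover have "?\<phi> ` ?W \<subseteq> cocycles p B H"
  proof
    fix d assume "d \<in> ?\<phi> ` ?W"
    then obtain c where c: "c \<in> ?W" "d = ?\<phi> c" by blast
    then have c1: "(\<lambda>(k, x). c (Inl k, x)) \<in> cocycles p K1 H" and c2: "(\<lambda>(k, x). c (Inr k, x)) \<in> cocycles p K2 H"
      by (auto simp: pair_cocycles_def)
    show "d \<in> cocycles p B H"
    proof (rule cocyclesI)
      fix k x assume k: "k \<in> B" and x: "x \<in> carrier G"
      then have k12: "k \<in> K1" "k \<in> K2" using assms(3,4) by auto
      show "d (k, x) ^ p = 1" using k x fun_group_root[OF W c(1)] by (simp add: c(2) power_divide)
      show "d (k \<otimes> l, x) = d (k, l \<otimes> x) * d (l, x)" if l: "l \<in> B" for l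
      proof -
        have l12: "l \<in> K1" "l \<in> K2" using l assms(3,4) by auto
        show ?thesis
          using k l x cocycle_mult[OF c1 k12(1) l12(1) x] cocycle_mult[OF c2 k12(2) l12(2) x] by (simp add: c(2))
      qed
      show "d (k, h \<otimes> x) = d (k, x)" if h: "h \<in> H" for h
        using k x h normal_imp_subgroup[OF assms(7)] cocycle_invariant[OF c1 k12(1) h x] cocycle_invariant[OF c2 k12(2) h x]
        by (simp add: c(2) subgroup.mem_carrier)
    qed (auto simp: c(2))
  qed
  moreover have "finite (?\<phi> ` ?W)" using card_pair_cocycles_empty(2)[OF fin] by blast
  ultimately show ?thesis using that card by blast
qed

section \<open>Passage to a smaller normal subgroup by right translation\<close>

lemma translate_cocycle:
  assumes "c \<in> cocycles p K H'" "subgroup K G" "H' \<lhd> G" "h \<in> carrier G"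
  shows "translate h c \<in> cocycles p K H'"
proof (rule cocyclesI)
  interpret K: subgroup K G by fact
  interpret H': normal H' G by fact
  fix k x assume k: "k \<in> K" and x: "x \<in> carrier G"
  show "translate h c (k, x) ^ p = 1" using cocycle_root[OF assms(1)] x by (simp add: translate_def)
  show "translate h c (k \<otimes> l, x) = translate h c (k, l \<otimes> x) * translate h c (l, x)" if l: "l \<in> K" for l
    using cocycle_mult[OF assms(1) k l, of "x \<otimes> h"] k l x assms(4) by (simp add: translate_def m_assoc)
  show "translate h c (k, g \<otimes> x) = translate h c (k, x)" if g: "g \<in> H'" for g
    using cocycle_invariant[OF assms(1) k g, of "x \<otimes> h"] g x assms(4) by (simp add: translate_def m_assoc)
qed (use cocycle_outside[OF assms(1)] in \<open>auto simp: translate_def\<close>)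

lemma cocycles_mono:
  "H' \<subseteq> H \<Longrightarrow> cocycles p K H \<subseteq> cocycles p K H'"
  by (auto simp: cocycles_def)

text \<open>For normal H, x H = H x turns invariance under right translation by H into the left
  invariance required of cocycles.\<close>

lemma translate_fixed_cocycle:
  assumes "c \<in> cocycles p K H'" "subgroup K G" "H \<lhd> G" "\<And>h. h \<in> H \<Longrightarrow> translate h c = c"
  shows "c \<in> cocycles p K H"
proof -
  interpret H: normal H G by fact
  have "c (k, h \<otimes> x) = c (k, x)" if "h \<in> H" "x \<in> carrier G" for k h x
  proof -
    have "translate (inv x \<otimes> h \<otimes> x) c (k, x) = c (k, x)"
      using assms(4) H.inv_op_closed1[OF that(2,1)] by simp
    moreover have "x \<otimes> (inv x \<otimes> h \<otimes> x) = h \<otimes> x" using that by (simp add: m_assoc[symmetric])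
    ultimately show ?thesis using that by (simp add: translate_def)
  qed
  then show ?thesis
    by (intro cocyclesI) (use cocycle_root[OF assms(1)] cocycle_outside[OF assms(1)] cocycle_mult[OF assms(1)] in auto)
qed

text \<open>H acts by right translation on the pairs for H', through a quotient of order p^j, and
  the fixed points are exactly the pairs for H; the bound by invariants then applies.\<close>

lemma card_pair_cocycles_le_power:
  assumes "prime p" "H' \<lhd> G" "H \<lhd> G" "H' \<subseteq> H" "card (rcosets\<^bsub>G\<lparr>carrier := H\<rparr>\<^esub> H') = p ^ j"
    and K: "subgroup K1 G" "subgroup K2 G"
    and fin: "finite (cocycles p K1 H')" "finite (cocycles p K2 H')"
  shows "card (pair_cocycles p K1 K2 B H') \<le> card (pair_cocycles p K1 K2 B H) ^ p ^ j"
proof -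
  let ?W = "pair_cocycles p K1 K2 B H'"
  interpret H': normal H' G by fact
  interpret H: normal H G by fact
  have proj: "(\<lambda>(k, x). c (Inl k, x)) \<in> cocycles p K1 H'" "(\<lambda>(k, x). c (Inr k, x)) \<in> cocycles p K2 H'"
    "\<And>b x. b \<in> B \<Longrightarrow> x \<in> carrier G \<Longrightarrow> c (Inl b, x) = c (Inr b, x)" if "c \<in> ?W" for c
    using that by (auto simp: pair_cocycles_def)
  have tr: "(\<lambda>(k, x). translate h c (Inl k, x)) = translate h (\<lambda>(k, x). c (Inl k, x))"
    "(\<lambda>(k, x). translate h c (Inr k, x)) = translate h (\<lambda>(k, x). c (Inr k, x))" for h and c :: "('a + 'a) \<times> 'a \<Rightarrow> complex"
    by (auto simp: translate_def fun_eq_iff)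
  have "card ?W \<le> card {c\<in>?W. \<forall>h\<in>H. translate h c = c} ^ p ^ j"
  proof (rule card_le_card_invariants_power[OF assms(1,2) H.subgroup_axioms assms(4,5) fun_group_pair_cocycles
        card_pair_cocycles_empty(2)[OF fin]])
    fix c assume c: "c \<in> ?W"
    note c12 = proj(1,2)[OF c]
    show "c (i, x) = 1" if "x \<notin> carrier G" for i x by (rule pair_cocycle_outside[OF c that])
    show "c (i, h \<otimes> x) = c (i, x)" if "h \<in> H'" "x \<in> carrier G" for i h x
      by (rule pair_cocycle_invariant[OF c that])
    show "translate h c \<in> ?W" if h: "h \<in> H" for h
    proof -
      have "translate h (\<lambda>(k, x). c (Inl k, x)) \<in> cocycles p K1 H'" "translate h (\<lambda>(k, x). c (Inr k, x)) \<in> cocycles p K2 H'"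
        using h by (auto intro!: translate_cocycle c12 K assms(2))
      moreover have "translate h c (Inl b, x) = translate h c (Inr b, x)" if "b \<in> B" "x \<in> carrier G" for b x
        using proj(3)[OF c that(1)] that h by (simp add: translate_def)
      ultimately show ?thesis by (simp add: pair_cocycles_def tr)
    qed
  qed
  also have "{c\<in>?W. \<forall>h\<in>H. translate h c = c} = pair_cocycles p K1 K2 B H"
  proof (intro equalityI subsetI)
    fix c assume "c \<in> {c\<in>?W. \<forall>h\<in>H. translate h c = c}"
    then have c: "c \<in> ?W" "\<And>h. h \<in> H \<Longrightarrow> translate h c = c" by auto
    have "translate h (\<lambda>(k, x). c (Inl k, x)) = (\<lambda>(k, x). c (Inl k, x))"
      "translate h (\<lambda>(k, x). c (Inr k, x)) = (\<lambda>(k, x). c (Inr k, x))" if "h \<in> H" for h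
      using c(2)[OF that] by (simp_all flip: tr)
    then have "(\<lambda>(k, x). c (Inl k, x)) \<in> cocycles p K1 H" "(\<lambda>(k, x). c (Inr k, x)) \<in> cocycles p K2 H"
      using translate_fixed_cocycle[OF proj(1)[OF c(1)] K(1) assms(3)]
        translate_fixed_cocycle[OF proj(2)[OF c(1)] K(2) assms(3)] by blast+
    then show "c \<in> pair_cocycles p K1 K2 B H" using proj(3)[OF c(1)] by (auto simp: pair_cocycles_def)
  next
    fix c assume c: "c \<in> pair_cocycles p K1 K2 B H"
    then have c12: "(\<lambda>(k, x). c (Inl k, x)) \<in> cocycles p K1 H" "(\<lambda>(k, x). c (Inr k, x)) \<in> cocycles p K2 H"
      by (auto simp: pair_cocycles_def)
    have "(\<lambda>(k, x). c (Inl k, x)) \<in> cocycles p K1 H'" "(\<lambda>(k, x). c (Inr k, x)) \<in> cocycles p K2 H'"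
      using c12 cocycles_mono[OF assms(4)] by (meson subsetD)+
    then have cW: "c \<in> ?W" using c by (simp add: pair_cocycles_def)
    have "translate h c (i, x) = c (i, x)" if h: "h \<in> H" for h i x
    proof (cases "x \<in> carrier G")
      case x: True
      have xh: "x \<otimes> h \<otimes> inv x \<in> H" using H.inv_op_closed2[OF x h] .
      have "x \<otimes> h = (x \<otimes> h \<otimes> inv x) \<otimes> x" using x h by (simp add: m_assoc)
      then show ?thesis using pair_cocycle_invariant[OF c xh x] x by (simp add: translate_def)
    qed (simp add: translate_def pair_cocycle_outside[OF c])
    then show "c \<in> {c\<in>?W. \<forall>h\<in>H. translate h c = c}" using cW by (auto simp: fun_eq_iff)
  qed
  finally show ?thesis .
qed

section \<open>Cocycles of the amalgam as compatible pairs\<close>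

lemma word_cocycle_invariant:
  assumes "subgroup K1 G" "subgroup K2 G" "H \<lhd> G" "c \<in> pair_cocycles p K1 K2 B H"
    and "w \<in> lists (K1 <+> K2)" "h \<in> H" "x \<in> carrier G"
  shows "word_cocycle c w (h \<otimes> x) = word_cocycle c w x"
  using assms(5)
proof (induction w)
  case (Cons l w)
  interpret H: normal H G by fact
  have g: "word_eval w \<in> carrier G" using word_eval_closed[OF assms(1,2)] Cons by simp
  have "word_eval w \<otimes> (h \<otimes> x) = (word_eval w \<otimes> h \<otimes> inv (word_eval w)) \<otimes> (word_eval w \<otimes> x)"
    using g assms(6,7) by (intro mult_conj) auto
  then show ?case
    using Cons pair_cocycle_invariant[OF assms(4) H.inv_op_closed2[OF g assms(6)], of "word_eval w \<otimes> x" l] g assms(7)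
    by simp
qed simp

text \<open>Both claims need a common induction: in a longer word the letters to the left of a
  rewritten segment are evaluated at points that depend on the value of the segment.\<close>

lemma word_cocycle_amalgam_eq:
  assumes "p > 0" "subgroup K1 G" "subgroup K2 G" "A \<subseteq> K1" "A \<subseteq> K2"
    and "amalgam_eq (G\<lparr>carrier := K1\<rparr>) (G\<lparr>carrier := K2\<rparr>) (G\<lparr>carrier := A\<rparr>) (\<lambda>a. a) (\<lambda>a. a) u v"
  shows "word_eval u = word_eval v \<and>
    (\<forall>c\<in>pair_cocycles p K1 K2 A H. \<forall>x\<in>carrier G. word_cocycle c u x = word_cocycle c v x)"
proof -
  interpret K1: subgroup K1 G by fact
  interpret K2: subgroup K2 G by fact
  let ?L = "lists (K1 <+> K2)"
  let ?eq = "\<lambda>u v. word_eval u = word_eval v \<and>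
    (\<forall>c\<in>pair_cocycles p K1 K2 A H. \<forall>x\<in>carrier G. word_cocycle c u x = word_cocycle c v x)"
  have cong: "?eq (u @ r @ v) (u @ s @ v)" if "?eq r s" "u \<in> ?L" "v \<in> ?L" "r \<in> ?L" "s \<in> ?L" for u v r s
  proof -
    have ru: "r @ v \<in> ?L" "s @ v \<in> ?L" using that by simp_all
    have "word_eval v \<otimes> x \<in> carrier G" if "x \<in> carrier G" for x
      using word_eval_closed[OF assms(2,3) \<open>v \<in> ?L\<close>] that by simp
    then show ?thesis
      using that word_eval_append[OF assms(2,3)] word_cocycle_append[OF assms(2,3)] ru by simp
  qed
  have c12: "(\<lambda>(k, x). c (Inl k, x)) \<in> cocycles p K1 H" "(\<lambda>(k, x). c (Inr k, x)) \<in> cocycles p K2 H"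
    "\<And>b x. b \<in> A \<Longrightarrow> x \<in> carrier G \<Longrightarrow> c (Inl b, x) = c (Inr b, x)"
    if "c \<in> pair_cocycles p K1 K2 A H" for c
    using that by (auto simp: pair_cocycles_def)
  have m1: "c (Inl (k \<otimes> l), x) = c (Inl k, l \<otimes> x) * c (Inl l, x)"
    if "c \<in> pair_cocycles p K1 K2 A H" "k \<in> K1" "l \<in> K1" "x \<in> carrier G" for c k l x
    using cocycle_mult[OF c12(1)[OF that(1)] that(2-4)] by simp
  have m2: "c (Inr (k \<otimes> l), x) = c (Inr k, l \<otimes> x) * c (Inr l, x)"
    if "c \<in> pair_cocycles p K1 K2 A H" "k \<in> K2" "l \<in> K2" "x \<in> carrier G" for c k l x
    using cocycle_mult[OF c12(2)[OF that(1)] that(2-4)] by simp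
  have o1: "c (Inl \<one>, x) = 1" and o2: "c (Inr \<one>, x) = 1" if "c \<in> pair_cocycles p K1 K2 A H" for c x
    using cocycle_one[OF assms(1,2) c12(1)[OF that], of x] cocycle_one[OF assms(1,3) c12(2)[OF that], of x] by simp_all
  show ?thesis
    using assms(6)
  proof induction
    case (refl w)
    then show ?case by simp
  next
    case (sym v w)
    then show ?case by simp
  next
    case (trans u v w)
    then show ?case by simp
  next
    case (mult1 u v x y)
    have "?eq [Inl x, Inl y] [Inl (x \<otimes>\<^bsub>G\<lparr>carrier := K1\<rparr>\<^esub> y)]" using mult1 by (simp add: m1)
    then show ?case by (rule cong) (use mult1 in auto)
  next
    case (mult2 u v x y)
    have "?eq [Inr x, Inr y] [Inr (x \<otimes>\<^bsub>G\<lparr>carrier := K2\<rparr>\<^esub> y)]" using mult2 by (simp add: m2)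
    then show ?case by (rule cong) (use mult2 in auto)
  next
    case (one1 u v)
    have "?eq [Inl \<one>\<^bsub>G\<lparr>carrier := K1\<rparr>\<^esub>] []" by (simp add: o1)
    from cong[OF this, of u v] show ?case using one1 InlI[OF K1.one_closed, of K2] by simp
  next
    case (one2 u v)
    have "?eq [Inr \<one>\<^bsub>G\<lparr>carrier := K2\<rparr>\<^esub>] []" by (simp add: o2)
    from cong[OF this, of u v] show ?case using one2 InrI[OF K2.one_closed, of K1] by simp
  next
    case (glue u v a)
    have "?eq [Inl a] [Inr a]" using glue by (simp add: c12(3))
    then show ?case by (rule cong) (use glue assms(4,5) in auto)
  qed
qed

text \<open>The isomorphism sends the class of a word to the value of the word. Surjectivity
  provides words for all elements, and injectivity makes words with equal values congruent.\<close>

lemma amalgamated_free_product_words: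
  assumes "is_amalgamated_free_product G K1 K2 A"
  defines "congr \<equiv> amalgam_eq (G\<lparr>carrier := K1\<rparr>) (G\<lparr>carrier := K2\<rparr>) (G\<lparr>carrier := A\<rparr>) (\<lambda>a. a) (\<lambda>a. a)"
  shows "g \<in> carrier G \<Longrightarrow> \<exists>w\<in>lists (K1 <+> K2). word_eval w = g"
    and "u \<in> lists (K1 <+> K2) \<Longrightarrow> v \<in> lists (K1 <+> K2) \<Longrightarrow> word_eval u = word_eval v \<Longrightarrow> congr u v"
proof -
  let ?G1 = "G\<lparr>carrier := K1\<rparr>" and ?G2 = "G\<lparr>carrier := K2\<rparr>" and ?A = "G\<lparr>carrier := A\<rparr>"
  let ?C = "amalgam_class ?G1 ?G2 ?A (\<lambda>a. a) (\<lambda>a. a)"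
  let ?P = "amalgam ?G1 ?G2 ?A (\<lambda>a. a) (\<lambda>a. a)"
  let ?L = "lists (K1 <+> K2)"
  have sub: "subgroup K1 G" "subgroup K2 G" "A \<subseteq> K1" "A \<subseteq> K2"
    using assms(1) by (auto simp: is_amalgamated_free_product_def)
  obtain \<phi> where \<phi>: "\<phi> \<in> iso ?P G" and \<phi>1: "\<And>x. x \<in> K1 \<Longrightarrow> \<phi> (?C [Inl x]) = x"
    and \<phi>2: "\<And>y. y \<in> K2 \<Longrightarrow> \<phi> (?C [Inr y]) = y"
    using assms(1) by (auto simp: is_amalgamated_free_product_def Let_def)
  have carr: "carrier ?P = ?C ` ?L" by (simp add: amalgam_def)
  have hom: "\<phi> \<in> hom ?P G" and bij: "bij_betw \<phi> (carrier ?P) (carrier G)" using \<phi> by (auto simp: iso_def)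
  note G12 = subgroup_imp_group[OF sub(1)] subgroup_imp_group[OF sub(2)]
  have mult: "\<phi> (?C (u @ v)) = \<phi> (?C u) \<otimes> \<phi> (?C v)" if "u \<in> ?L" "v \<in> ?L" for u v
  proof -
    have "?C u \<otimes>\<^bsub>?P\<^esub> ?C v = ?C (u @ v)"
      by (rule mult_amalgam_class[OF G12]) (use sub that in auto)
    then show ?thesis using hom_mult[OF hom, of "?C u" "?C v"] that carr by simp
  qed
  have eval: "\<phi> (?C w) = word_eval w" if "w \<in> ?L" for w
    using that
  proof (induction w)
    case Nil
    have "\<phi> (?C []) \<in> carrier G" using hom carr by (intro hom_in_carrier[OF hom]) auto
    then show ?case using mult[of "[]" "[]"] by simp
  next
    case (Cons l w)
    then have "\<phi> (?C [l]) = case_sum id id l" using \<phi>1 \<phi>2 by auto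
    then show ?case using mult[of "[l]" w] Cons by simp
  qed
  show "\<exists>w\<in>?L. word_eval w = g" if "g \<in> carrier G"
  proof -
    have "g \<in> \<phi> ` ?C ` ?L" using bij that carr by (simp add: bij_betw_def)
    then obtain w where w: "w \<in> ?L" "g = \<phi> (?C w)" by (elim imageE) simp
    then show ?thesis using eval[OF w(1)] by (intro bexI[of _ w]) simp_all
  qed
  show "congr u v" if uv: "u \<in> ?L" "v \<in> ?L" "word_eval u = word_eval v"
  proof -
    have "?C u = ?C v"
      using uv carr eval by (intro inj_onD[OF bij_betw_imp_inj_on[OF bij]]) auto
    moreover have "v \<in> ?C v" using uv(2) by (auto simp: amalgam_class_def intro: amalgam_eq.refl)
    ultimately have "v \<in> ?C u" by simp
    then show ?thesis by (simp add: amalgam_class_def congr_def)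
  qed
qed

text \<open>The universal property of the amalgamated product, for cocycles instead of homomorphisms.\<close>

lemma card_cocycles_amalgamated_free_product:
  assumes "p > 0" "is_amalgamated_free_product G K1 K2 A" "H \<lhd> G"
  shows "card (cocycles p (carrier G) H) = card (pair_cocycles p K1 K2 A H)"
proof -
  have sub: "subgroup K1 G" "subgroup K2 G" "A \<subseteq> K1" "A \<subseteq> K2"
    using assms(2) by (auto simp: is_amalgamated_free_product_def)
  interpret K1: subgroup K1 G by fact
  interpret K2: subgroup K2 G by fact
  interpret H: normal H G by fact
  let ?Z = "cocycles p (carrier G) H" and ?W = "pair_cocycles p K1 K2 A H" and ?L = "lists (K1 <+> K2)"
  define res where "res c = (\<lambda>(i, x). case i of Inl k \<Rightarrow> if k \<in> K1 then c (k, x) else 1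
    | Inr k \<Rightarrow> if k \<in> K2 then c (k, x) else 1)" for c :: "'a \<times> 'a \<Rightarrow> complex"
  \<comment> \<open>A cocycle of G is rebuilt from a pair by expanding elements into words. Any
    choice of words will do, since words with equal values are congruent and congruent words have
    equal word cocycles.\<close>
  define wd where "wd g = (SOME w. w \<in> ?L \<and> word_eval w = g)" for g
  define ext where "ext c = (\<lambda>(g, x). if g \<in> carrier G \<and> x \<in> carrier G then word_cocycle c (wd g) x else 1)"
    for c :: "('a + 'a) \<times> 'a \<Rightarrow> complex"
  have wd: "wd g \<in> ?L" "word_eval (wd g) = g" if "g \<in> carrier G" for g
  proof -
    have "\<exists>w. w \<in> ?L \<and> word_eval w = g" using amalgamated_free_product_words(1)[OF assms(2) that] by blast
    then have "wd g \<in> ?L \<and> word_eval (wd g) = g" unfolding wd_def by (rule someI_ex)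
    then show "wd g \<in> ?L" "word_eval (wd g) = g" by auto
  qed
  have ext_eval: "ext c (word_eval w, x) = word_cocycle c w x"
    if c: "c \<in> ?W" and w: "w \<in> ?L" and x: "x \<in> carrier G" for c w x
  proof -
    have g: "word_eval w \<in> carrier G" by (rule word_eval_closed[OF sub(1,2) w])
    have "word_cocycle c (wd (word_eval w)) x = word_cocycle c w x"
      using word_cocycle_amalgam_eq[OF assms(1) sub amalgamated_free_product_words(2)[OF assms(2) wd(1)[OF g] w wd(2)[OF g]], of H] c x
      by blast
    then show ?thesis using g x by (simp add: ext_def)
  qed
  have res_eval: "word_cocycle (res c) w x = c (word_eval w, x)"
    if c: "c \<in> ?Z" and w: "w \<in> ?L" and x: "x \<in> carrier G" for c w x
    using w
  proof (induction w)
    case Nil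
    then show ?case using cocycle_one[OF assms(1) subgroup_self c] by simp
  next
    case (Cons l w)
    have "word_eval w \<in> carrier G" using word_eval_closed[OF sub(1,2)] Cons by simp
    then show ?case using Cons x cocycle_mult[OF c _ _ x] by (auto simp: res_def)
  qed
  have "bij_betw res ?Z ?W"
  proof (rule bij_betw_byWitness[where f' = ext])
    show "\<forall>c\<in>?Z. ext (res c) = c"
    proof (intro ballI ext)
      fix c and q :: "'a \<times> 'a" assume c: "c \<in> ?Z"
      obtain g x where q: "q = (g, x)" by fastforce
      show "ext (res c) q = c q"
        using res_eval[OF c wd(1)] wd(2) cocycle_outside[OF c, of g x] by (auto simp: q ext_def)
    qed
    show "\<forall>c\<in>?W. res (ext c) = c"
    proof (intro ballI ext)
      fix c and q :: "('a + 'a) \<times> 'a" assume c: "c \<in> ?W"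
      then have c12: "(\<lambda>(k, x). c (Inl k, x)) \<in> cocycles p K1 H" "(\<lambda>(k, x). c (Inr k, x)) \<in> cocycles p K2 H"
        by (auto simp: pair_cocycles_def)
      obtain i x where q: "q = (i, x)" by fastforce
      have ext1: "ext c (k, x) = c (i, x)" if "i \<in> K1 <+> K2" "case_sum id id i = k" "x \<in> carrier G" for k
        using ext_eval[OF c, of "[i]" x] that by auto
      show "res (ext c) q = c q"
      proof (cases "x \<in> carrier G")
        case True
        then show ?thesis
          using ext1 cocycle_outside[OF c12(1), of "projl i" x] cocycle_outside[OF c12(2), of "projr i" x]
          by (cases i) (auto simp: q res_def)
      next
        case False
        then show ?thesis
          using cocycle_outside[OF c12(1), of "projl i" x] cocycle_outside[OF c12(2), of "projr i" x]
          by (cases i) (auto simp: q res_def ext_def)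
      qed
    qed
    show "res ` ?Z \<subseteq> ?W"
    proof
      fix d assume "d \<in> res ` ?Z"
      then obtain c where c: "c \<in> ?Z" "d = res c" by blast
      have cK: "(\<lambda>(k, x). if k \<in> K then c (k, x) else 1) \<in> cocycles p K H" if "subgroup K G" for K
      proof -
        interpret K: subgroup K G by fact
        show ?thesis
          by (rule cocyclesI)
            (auto simp: cocycle_root[OF c(1)] cocycle_outside[OF c(1)] cocycle_mult[OF c(1)] cocycle_invariant[OF c(1)])
      qed
      show "d \<in> ?W" using cK[OF sub(1)] cK[OF sub(2)] sub(3,4) c(2) by (auto simp: pair_cocycles_def res_def)
    qed
    show "ext ` ?W \<subseteq> ?Z"
    proof
      fix d assume "d \<in> ext ` ?W"
      then obtain c where c: "c \<in> ?W" "d = ext c" by blast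
      have root: "word_cocycle c w x ^ p = 1" for w x
        by (induction w) (simp_all add: power_mult_distrib fun_group_root[OF fun_group_pair_cocycles c(1)])
      show "d \<in> ?Z"
      proof (rule cocyclesI)
        fix g x assume g: "g \<in> carrier G" and x: "x \<in> carrier G"
        show "d (g, x) ^ p = 1" using g x root by (simp add: c(2) ext_def)
        show "d (g, h \<otimes> x) = d (g, x)" if h: "h \<in> H" for h
          using g x h word_cocycle_invariant[OF sub(1,2) assms(3) c(1) wd(1)[OF g] h x] by (simp add: c(2) ext_def)
        show "d (g \<otimes> h, x) = d (g, h \<otimes> x) * d (h, x)" if h: "h \<in> carrier G" for h
        proof -
          have "word_eval (wd g @ wd h) = g \<otimes> h"
            using word_eval_append[OF sub(1,2) wd(1)[OF g] wd(1)[OF h]] wd(2)[OF g] wd(2)[OF h] by simp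
          then have "ext c (g \<otimes> h, x) = word_cocycle c (wd g @ wd h) x"
            using ext_eval[OF c(1) _ x, of "wd g @ wd h"] wd(1)[OF g] wd(1)[OF h] by simp
          also have "\<dots> = word_cocycle c (wd g) (h \<otimes> x) * word_cocycle c (wd h) x"
            using word_cocycle_append[OF sub(1,2) wd(1)[OF g] wd(1)[OF h] x] wd(2)[OF h] by simp
          finally show ?thesis using g h x by (simp add: c(2) ext_def)
        qed
      qed (auto simp: c(2) ext_def)
    qed
  qed
  then show ?thesis by (rule bij_betw_same_card)
qed

end

section \<open>Gradients\<close>

context group
begin

lemma normal_p_power_indexD:
  assumes "prime p" "H \<in> normal_p_power_index p G"
  shows "H \<lhd> G" "finite (rcosets H)" "card (rcosets H) > 0"
proof -
  obtain k where k: "H \<lhd> G" "card (rcosets H) = p ^ k"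
    using assms(2) by (auto simp: normal_p_power_index_def)
  then show "H \<lhd> G" "card (rcosets H) > 0" using prime_gt_0_nat[OF assms(1)] by auto
  then show "finite (rcosets H)" by (intro card_ge_0_finite)
qed

lemma normal_p_power_index_restrict:
  assumes "prime p" "H \<in> normal_p_power_index p G" "subgroup K G"
  shows "K \<inter> H \<in> normal_p_power_index p (G\<lparr>carrier := K\<rparr>)"
proof -
  obtain k where k: "H \<lhd> G" "card (rcosets H) = p ^ k"
    using assms(2) by (auto simp: normal_p_power_index_def)
  have "K \<inter> H \<lhd> G\<lparr>carrier := K\<rparr>" using normal_Int_subgroup[OF assms(3) k(1)] by (simp add: Int_commute)
  moreover have "card (rcosets\<^bsub>G\<lparr>carrier := K\<rparr>\<^esub> (K \<inter> H)) dvd p ^ k"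
    using rcosets_factor[OF k(1) assms(3)] k(2) by (metis dvd_triv_left)
  ultimately show ?thesis
    using divides_primepow_nat[OF assms(1)] by (auto simp: normal_p_power_index_def)
qed

lemma rcosets_tower:
  assumes "H' \<lhd> G" "subgroup H G" "H' \<subseteq> H"
  shows "card (rcosets H') = card (rcosets\<^bsub>G\<lparr>carrier := H\<rparr>\<^esub> H') * card (rcosets H)"
  using rcosets_factor[OF assms(1,2)] subgroup_set_mult_absorb[OF normal_imp_subgroup[OF assms(1)] assms(2,3)]
    assms(3) by (simp add: Int_absorb1)

lemma normal_p_power_index_Int:
  assumes "prime p" "H \<in> normal_p_power_index p G" "K \<in> normal_p_power_index p G"
  shows "H \<inter> K \<in> normal_p_power_index p G"
proof -
  obtain k where k: "H \<lhd> G" "card (rcosets H) = p ^ k"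
    using assms(2) by (auto simp: normal_p_power_index_def)
  have K: "K \<lhd> G" using assms(3) by (auto simp: normal_p_power_index_def)
  have HK: "H \<inter> K \<lhd> G" by (rule normal_subgroup_intersect[OF k(1) K])
  obtain l where "card (rcosets\<^bsub>G\<lparr>carrier := H\<rparr>\<^esub> (H \<inter> K)) = p ^ l"
    using normal_p_power_index_restrict[OF assms(1,3) normal_imp_subgroup[OF k(1)]]
    by (auto simp: normal_p_power_index_def)
  then have "card (rcosets (H \<inter> K)) = p ^ (l + k)"
    using rcosets_tower[OF HK normal_imp_subgroup[OF k(1)]] k(2) by (simp add: power_add)
  then show ?thesis using HK by (auto simp: normal_p_power_index_def)
qed

lemma carrier_in_normal_p_power_index: "carrier G \<in> normal_p_power_index p G"
proof -
  have "rcosets (carrier G) = {carrier G}"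
    using coset_join2[OF _ subgroup_self] one_closed by (auto simp: RCOSETS_def)
  then have "card (rcosets (carrier G)) = p ^ 0" by simp
  then show ?thesis using normal_self unfolding normal_p_power_index_def by blast
qed

text \<open>Indexed by H rather than by K Int H, so that the infima for G, K1 and K2 run over the
  same lattice.\<close>

definition relative_gradient :: "nat \<Rightarrow> 'a set \<Rightarrow> 'a set \<Rightarrow> real" where
  "relative_gradient p K H =
    (real (d_p p (G\<lparr>carrier := K \<inter> H\<rparr>)) - 1) / card (rcosets\<^bsub>G\<lparr>carrier := K\<rparr>\<^esub> (K \<inter> H))"

lemma p_gradient_eq_INF:
  "p_gradient p (G\<lparr>carrier := K\<rparr>) ((\<lambda>H. K \<inter> H) ` L) = (INF H\<in>L. relative_gradient p K H)"
  by (simp add: p_gradient_def relative_gradient_def image_image)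

text \<open>A real \<open>INF\<close> is meaningful only for a set bounded below. For infinite index
  \<open>card\<close> is 0 and the quotient is 0, so the bound holds without exception.\<close>

lemma relative_gradient_ge: "relative_gradient p K H \<ge> - 1"
proof -
  let ?n = "card (rcosets\<^bsub>G\<lparr>carrier := K\<rparr>\<^esub> (K \<inter> H))"
  have "- 1 \<le> (real d - 1) / real n" for d n :: nat
  proof (cases "n = 0")
    case False
    then have "- real n \<le> real d - 1" by linarith
    then show ?thesis using False by (simp add: le_divide_eq)
  qed simp
  then show ?thesis by (simp add: relative_gradient_def)
qed

lemma bdd_below_relative_gradient: "bdd_below (relative_gradient p K ` L)"
  using relative_gradient_ge by (intro bdd_belowI2[of _ "- 1"])

lemma finite_cocycles_p:
  assumes "prime p" "H \<in> normal_p_power_index p G" "subgroup K G" "finitely_generated (G\<lparr>carrier := K\<rparr>)"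
  shows "finite (cocycles p K H)"
proof -
  obtain S where "finite S" "S \<subseteq> K" "generate G S = K"
    using assms(4) generate_consistent[OF _ assms(3)] by (auto simp: finitely_generated_def)
  then show ?thesis
    using finite_cocycles[OF prime_gt_0_nat[OF assms(1)] assms(3)] normal_p_power_indexD[OF assms(1,2)] by blast
qed

lemma log_card_cocycles_gradient:
  assumes "prime p" "H \<in> normal_p_power_index p G" "subgroup K G" "finite (cocycles p K H)"
  shows "log p (card (cocycles p K H)) / card (rcosets H) = 1 + relative_gradient p K H"
  unfolding relative_gradient_def
  using log_card_cocycles[OF assms(1,3) normal_p_power_indexD(1,2)[OF assms(1,2)] assms(4)] .

lemma log_card_pair_cocycles_antimono:
  assumes "prime p" "H \<in> normal_p_power_index p G" "H' \<in> normal_p_power_index p G" "H' \<subseteq> H"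
    and K: "subgroup K1 G" "subgroup K2 G"
    and fin: "finite (cocycles p K1 H')" "finite (cocycles p K2 H')"
      "finite (cocycles p K1 H)" "finite (cocycles p K2 H)"
  shows "log p (card (pair_cocycles p K1 K2 B H')) / card (rcosets H') \<le>
    log p (card (pair_cocycles p K1 K2 B H)) / card (rcosets H)"
proof -
  let ?W = "pair_cocycles p K1 K2 B"
  note H = normal_p_power_indexD[OF assms(1,2)] and H' = normal_p_power_indexD[OF assms(1,3)]
  note Hs = normal_imp_subgroup[OF H(1)]
  note p = prime_gt_1_nat[OF assms(1)]
  have "H \<inter> H' = H'" using assms(4) by blast
  then obtain j where j: "card (rcosets\<^bsub>G\<lparr>carrier := H\<rparr>\<^esub> H') = p ^ j"
    using normal_p_power_index_restrict[OF assms(1,3) Hs] by (auto simp: normal_p_power_index_def)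
  have N: "card (rcosets H') = p ^ j * card (rcosets H)" using rcosets_tower[OF H'(1) Hs assms(4)] j by simp
  have pos: "card (?W H') > 0" "card (?W H) > 0"
    using card_fun_group_pos[OF fun_group_pair_cocycles card_pair_cocycles_empty(2)] fin by auto
  have "card (?W H') \<le> card (?W H) ^ p ^ j"
    by (rule card_pair_cocycles_le_power[OF assms(1) H'(1) H(1) assms(4) j K fin(1,2)])
  then have "real (card (?W H')) \<le> real (card (?W H)) ^ p ^ j" by (metis of_nat_le_iff of_nat_power)
  then have "log p (card (?W H')) \<le> log p (real (card (?W H)) ^ p ^ j)"
    using pos p by (intro log_mono) auto
  also have "\<dots> = p ^ j * log p (card (?W H))" using pos by (simp add: log_nat_power)
  finally show ?thesis using N H(3) p by (simp add: field_simps)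
qed

text \<open>The trivial group has only the trivial cocycle, so a single K is recovered as the pair
  of K and the trivial group with nothing to glue, and monotonicity for pairs specialises.\<close>

lemma relative_gradient_antimono:
  assumes "prime p" "H \<in> normal_p_power_index p G" "H' \<in> normal_p_power_index p G" "H' \<subseteq> H"
    and K: "subgroup K G" "finitely_generated (G\<lparr>carrier := K\<rparr>)"
  shows "relative_gradient p K H' \<le> relative_gradient p K H"
proof -
  have one: "subgroup {\<one>} G" by (rule triv_subgroup)
  have "cocycles p {\<one>} H = {\<lambda>_. 1}" for H
  proof -
    have "c = (\<lambda>_. 1)" if c: "c \<in> cocycles p {\<one>} H" for c
    proof
      fix q :: "'a \<times> 'a"
      obtain k x where "q = (k, x)" by fastforce
      then show "c q = 1"
        using cocycle_one[OF prime_gt_0_nat[OF assms(1)] one c, of x] cocycle_outside[OF c, of k x]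
        by (cases "k = \<one>") auto
    qed
    then show ?thesis using fun_group_one[OF fun_group_cocycles] by blast
  qed
  then have "card (pair_cocycles p K {\<one>} {} H) = card (cocycles p K H)" "finite (cocycles p {\<one>} H)" for H
    by (simp_all add: card_pair_cocycles_empty(1))
  then show ?thesis
    using log_card_pair_cocycles_antimono[OF assms(1-4) K(1) one, of "{}"]
      finite_cocycles_p[OF assms(1,2) K] finite_cocycles_p[OF assms(1,3) K]
      log_card_cocycles_gradient[OF assms(1,2) K(1)] log_card_cocycles_gradient[OF assms(1,3) K(1)]
    by simp
qed

section \<open>Separation by the lattice, and Foelner windows\<close>

lemma card_le_index_if_separated:
  assumes "subgroup A G" "subgroup M G" "finite (rcosets\<^bsub>G\<lparr>carrier := A\<rparr>\<^esub> M)" "F \<subseteq> A" "M \<subseteq> A"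
    and sep: "\<And>f g. f \<in> F \<Longrightarrow> g \<in> F \<Longrightarrow> inv f \<otimes> g \<in> M \<Longrightarrow> f = g"
  shows "card F \<le> card (rcosets\<^bsub>G\<lparr>carrier := A\<rparr>\<^esub> M)"
proof (rule card_inj_on_le[of "\<lambda>f. M #> inv f"])
  interpret A: subgroup A G by fact
  interpret M: subgroup M G by fact
  show "inj_on (\<lambda>f. M #> inv f) F"
  proof (rule inj_onI)
    fix f g assume fg: "f \<in> F" "g \<in> F" "M #> inv f = M #> inv g"
    then have G: "f \<in> carrier G" "g \<in> carrier G" using assms(4) by auto
    have "inv f \<in> M #> inv g" using rcos_self[OF _ assms(2), of "inv f"] fg(3) G by simp
    then obtain m where "m \<in> M" "inv f = m \<otimes> inv g" by (auto simp: r_coset_def)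
    then have "inv f \<otimes> g \<in> M" using G by (simp add: m_assoc)
    then show "f = g" using sep fg by blast
  qed
  show "(\<lambda>f. M #> inv f) ` F \<subseteq> rcosets\<^bsub>G\<lparr>carrier := A\<rparr>\<^esub> M"
    using assms(4) A.m_inv_closed by (auto simp: RCOSETS_def r_coset_def)
qed (rule assms(3))

text \<open>Each nontrivial element f^-1 g is avoided by some member of the lattice, and finitely
  many members may be intersected. The smaller subgroup H' in the conclusion lets the separation
  survive further intersections.\<close>

lemma lattice_separates:
  assumes "subgroup_lattice G L" "\<Inter>L = {\<one>}" "finite F" "F \<subseteq> carrier G"
  obtains H where "H \<in> L" "\<And>f g H'. f \<in> F \<Longrightarrow> g \<in> F \<Longrightarrow> H' \<subseteq> H \<Longrightarrow> inv f \<otimes> g \<in> H' \<Longrightarrow> f = g"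
proof -
  have "\<exists>H\<in>L. H \<inter> E \<subseteq> {\<one>}" if "finite E" for E
    using that
  proof (induction E)
    case empty
    then show ?case using assms(1) by (auto simp: subgroup_lattice_def)
  next
    case (insert e E)
    then obtain H where H: "H \<in> L" "H \<inter> E \<subseteq> {\<one>}" by blast
    show ?case
    proof (cases "e = \<one>")
      case True
      then show ?thesis using H by (intro bexI[of _ H]) auto
    next
      case False
      then obtain K where K: "K \<in> L" "e \<notin> K" using assms(2) by (metis InterI singletonD)
      have "H \<inter> K \<in> L" using assms(1) H K by (auto simp: subgroup_lattice_def)
      then show ?thesis using H K by (intro bexI[of _ "H \<inter> K"]) auto
    qed
  qed
  moreover have "finite ((\<lambda>(f, g). inv f \<otimes> g) ` (F \<times> F))" using assms(3) by simp
  ultimately obtain H where H: "H \<in> L" "H \<inter> (\<lambda>(f, g). inv f \<otimes> g) ` (F \<times> F) \<subseteq> {\<one>}" by blast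
  have "f = g" if fg: "f \<in> F" "g \<in> F" "H' \<subseteq> H" "inv f \<otimes> g \<in> H'" for f g H'
  proof -
    have "inv f \<otimes> g \<in> H \<inter> (\<lambda>(f, g). inv f \<otimes> g) ` (F \<times> F)" using fg by force
    then have "inv f \<otimes> g = \<one>" using H(2) by blast
    then show "f = g" using fg assms(4) by (metis inv_equality inv_inv inv_closed subsetD)
  qed
  then show ?thesis using that H(1) by blast
qed

text \<open>For finite B the whole group is a perfect window, F = B and k = |B|, with the exact
  ratio 1 - 1/|B|. For infinite B, \<open>inverse_order B\<close> is 0 and a Foelner set brings the
  ratio below 1 + \<eta>.\<close>

lemma folner_ratio:
  assumes "amenable (G\<lparr>carrier := B\<rparr>)" "subgroup B G" "finite T" "T \<subseteq> B" "\<eta> > 0"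
  obtains F k where "finite F" "F \<subseteq> B" "F \<noteq> {}" "k > 0"
    "\<And>s. s \<in> T \<Longrightarrow> k \<le> card {f\<in>F. s \<otimes> f \<in> F}"
    "(real (card F) - 1) / real k \<le> 1 - inverse_order B + \<eta>"
proof (cases "finite B")
  case True
  interpret B: subgroup B G by fact
  have "B \<noteq> {}" using B.one_closed by blast
  then have "card B > 0" using True by (simp add: card_gt_0_iff)
  moreover have "{f\<in>B. s \<otimes> f \<in> B} = B" if "s \<in> T" for s using that assms(4) by auto
  moreover from calculation have "(real (card B) - 1) / real (card B) \<le> 1 - inverse_order B + \<eta>"
    using assms(5) by (simp add: inverse_order_def diff_divide_distrib)
  ultimately show ?thesis using that[of B "card B"] True \<open>B \<noteq> {}\<close> by auto
next
  case False
  interpret GB: group "G\<lparr>carrier := B\<rparr>" by (rule subgroup_imp_group[OF assms(2)])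
  \<comment> \<open>Chosen such that 1/(1 - \<epsilon>) = 1 + \<eta>; rounding (1 - \<epsilon>) |F|
    up to the integer k does not increase the ratio.\<close>
  define \<epsilon> where "\<epsilon> = \<eta> / (1 + \<eta>)"
  have \<epsilon>: "\<epsilon> > 0" "1 - \<epsilon> = 1 / (1 + \<eta>)" using assms(5) by (auto simp: \<epsilon>_def field_simps)
  obtain F where F: "finite F" "F \<subseteq> B" "F \<noteq> {}"
    "\<And>s. s \<in> T \<Longrightarrow> (1 - \<epsilon>) * card F \<le> card {f\<in>F. s \<otimes> f \<in> F}"
    using GB.folner[OF assms(1,3) _ \<epsilon>(1)] assms(4) by auto
  have cF: "card F > 0" using F by (simp add: card_gt_0_iff)
  define k where "k = nat \<lceil>(1 - \<epsilon>) * card F\<rceil>"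
  have pos: "(1 - \<epsilon>) * card F > 0" using \<epsilon>(2) assms(5) cF by simp
  then have k: "k > 0" "(1 - \<epsilon>) * card F \<le> k" by (auto simp: k_def)
  have "(real (card F) - 1) / real k \<le> card F / ((1 - \<epsilon>) * card F)"
    using pos k by (intro frac_le) auto
  also have "\<dots> = 1 + \<eta>" using \<epsilon>(2) cF assms(5) by simp
  finally have "(real (card F) - 1) / real k \<le> 1 - inverse_order B + \<eta>"
    using False by (simp add: inverse_order_def)
  moreover have "k \<le> card {f\<in>F. s \<otimes> f \<in> F}" if "s \<in> T" for s
    using F(4)[OF that] by (simp add: k_def nat_ceiling_le_eq)
  ultimately show ?thesis using that F k by blast
qed

text \<open>The amalgamated subgroup need not be finitely generated; for each single \<open>H\<close> it may be replaced
  by a finitely generated subgroup, to which Foelner sets apply.\<close>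

lemma pair_cocycles_finitely_generated:
  assumes "finite (pair_cocycles p K1 K2 {} H)" "subgroup A G"
  obtains T where "finite T" "T \<subseteq> A" "pair_cocycles p K1 K2 A H = pair_cocycles p K1 K2 (generate G T) H"
proof -
  \<comment> \<open>\<open>P c a\<close> says that a witnesses the failure of c to be compatible on
    A. One witness for each incompatible pair suffices, and there are only finitely many
    pairs.\<close>
  define P where "P c a \<longleftrightarrow> a \<in> A \<and> (\<exists>x\<in>carrier G. c (Inl a, x) \<noteq> c (Inr a, x))"
    for c :: "('a + 'a) \<times> 'a \<Rightarrow> complex" and a
  define C where "C = {c\<in>pair_cocycles p K1 K2 {} H. \<exists>a. P c a}"
  define T where "T = (\<lambda>c. SOME a. P c a) ` C"
  have P: "P c (SOME a. P c a)" if "c \<in> C" for c using that by (auto simp: C_def intro: someI_ex)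
  have TA: "T \<subseteq> A" using P by (auto simp: T_def P_def)
  then have BA: "generate G T \<subseteq> A" by (rule generate_subgroup_incl[OF _ assms(2)])
  have "pair_cocycles p K1 K2 A H = pair_cocycles p K1 K2 (generate G T) H"
  proof (intro equalityI subsetI)
    fix c assume "c \<in> pair_cocycles p K1 K2 A H"
    then show "c \<in> pair_cocycles p K1 K2 (generate G T) H" using BA by (auto simp: pair_cocycles_def)
  next
    fix c assume c: "c \<in> pair_cocycles p K1 K2 (generate G T) H"
    have "\<not> P c a" for a
    proof
      assume "P c a"
      then have cC: "c \<in> C" using c by (auto simp: C_def pair_cocycles_def)
      then have "(SOME a. P c a) \<in> generate G T" by (intro generate.incl) (auto simp: T_def)
      then show False using P[OF cC] c by (auto simp: P_def pair_cocycles_def)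
    qed
    then show "c \<in> pair_cocycles p K1 K2 A H" using c by (auto simp: P_def pair_cocycles_def)
  qed
  moreover have "finite T" using assms(1) by (simp add: T_def C_def)
  ultimately show ?thesis using that TA by blast
qed

section \<open>The two inequalities for the gradient of the amalgam\<close>

lemma relative_gradient_amalgam_le:
  assumes "prime p" "is_amalgamated_free_product G K1 K2 A" "H \<in> normal_p_power_index p G"
    and fg: "finitely_generated (G\<lparr>carrier := K1\<rparr>)" "finitely_generated (G\<lparr>carrier := K2\<rparr>)"
      "finitely_generated G"
  shows "relative_gradient p (carrier G) H \<le> relative_gradient p K1 H + relative_gradient p K2 H +
    1 / card (rcosets\<^bsub>G\<lparr>carrier := A\<rparr>\<^esub> (A \<inter> H))"
proof -
  have sub: "subgroup K1 G" "subgroup K2 G" "subgroup A G" "A \<subseteq> K1" "A \<subseteq> K2"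
    using assms(2) by (auto simp: is_amalgamated_free_product_def)
  note p = prime_gt_0_nat[OF assms(1)] prime_gt_1_nat[OF assms(1)]
  note H = normal_p_power_indexD[OF assms(1,3)]
  note fin = finite_cocycles_p[OF assms(1,3) sub(1) fg(1)] finite_cocycles_p[OF assms(1,3) sub(2) fg(2)]
  have finG: "finite (cocycles p (carrier G) H)"
    using finite_cocycles_p[OF assms(1,3) subgroup_self] fg(3) by simp
  let ?N = "real (card (rcosets H))" and ?u = "card (rcosets (H <#> A))" and ?C = "coboundary A ` invariant_funs p H"
  obtain I where I: "?C \<subseteq> I" "I \<subseteq> cocycles p A H" "finite I"
    "card (pair_cocycles p K1 K2 A H) * card I = card (cocycles p K1 H) * card (cocycles p K2 H)"
    by (rule card_pair_cocycles[OF p(1) sub(3,4,5,1,2) H(1) fin])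
  have C: "card ?C * p ^ ?u = p ^ card (rcosets H)" by (rule card_coboundaries[OF p(1) sub(3) H(1,2)])
  have C0: "card ?C > 0" using C p by (metis gr0I mult_0 power_not_zero not_less0)
  have I0: "card I > 0" using card_mono[OF I(3,1)] C0 by linarith
  have Z: "card (cocycles p (carrier G) H) > 0" "card (cocycles p K1 H) > 0" "card (cocycles p K2 H) > 0"
    using card_fun_group_pos[OF fun_group_cocycles] finG fin by auto
  \<comment> \<open>The coboundaries bound the dimension of I from below by N - u; after division by
    N the loss u / N becomes 1/[A : A Int H].\<close>
  have "log p (card ?C) = ?N - ?u"
  proof -
    have "real (card ?C) * p ^ ?u = p ^ card (rcosets H)" using C by (metis of_nat_mult of_nat_power)
    then have "log p (real (card ?C) * p ^ ?u) = ?N" using p by simp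
    then show ?thesis using C0 p by (simp add: log_mult)
  qed
  moreover have "log p (card ?C) \<le> log p (card I)" using card_mono[OF I(3,1)] C0 p by simp
  moreover have "log p (card (cocycles p (carrier G) H)) + log p (card I) =
      log p (card (cocycles p K1 H)) + log p (card (cocycles p K2 H))"
  proof -
    have eq: "real (card (cocycles p (carrier G) H)) * card I = real (card (cocycles p K1 H)) * card (cocycles p K2 H)"
      using I(4) card_cocycles_amalgamated_free_product[OF p(1) assms(2) H(1)] by (metis of_nat_mult)
    show ?thesis using Z I0 arg_cong[OF eq, of "log p"] by (simp add: log_mult)
  qed
  ultimately have "log p (card (cocycles p (carrier G) H)) \<le>
      log p (card (cocycles p K1 H)) + log p (card (cocycles p K2 H)) - ?N + ?u" by linarith
  then have "log p (card (cocycles p (carrier G) H)) / ?N \<le>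
      (log p (card (cocycles p K1 H)) + log p (card (cocycles p K2 H)) - ?N + ?u) / ?N"
    using H(3) by (intro divide_right_mono) auto
  also have "\<dots> = log p (card (cocycles p K1 H)) / ?N + log p (card (cocycles p K2 H)) / ?N - 1 + ?u / ?N"
    using H(3) by (simp add: add_divide_distrib diff_divide_distrib)
  finally have "1 + relative_gradient p (carrier G) H \<le>
      (1 + relative_gradient p K1 H) + (1 + relative_gradient p K2 H) - 1 + ?u / ?N"
    using log_card_cocycles_gradient[OF assms(1,3)] sub finG fin subgroup_self by simp
  moreover have "?u / ?N = 1 / card (rcosets\<^bsub>G\<lparr>carrier := A\<rparr>\<^esub> (A \<inter> H))"
    using rcosets_factor[OF H(1) sub(3)] H(3) by (simp add: divide_simps)
  ultimately show ?thesis by linarith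
qed

text \<open>Each of the two factors contributes a 1 by the gradient formula, hence the constant 2;
  the image of the difference map is bounded above by all cocycles of B.\<close>

lemma log_card_pair_cocycles_ge:
  assumes "prime p" "H \<in> normal_p_power_index p G"
    and sub: "subgroup K1 G" "subgroup K2 G" "subgroup B G" "B \<subseteq> K1" "B \<subseteq> K2"
    and fin: "finite (cocycles p K1 H)" "finite (cocycles p K2 H)" "finite (cocycles p B H)"
  shows "log p (card (pair_cocycles p K1 K2 B H)) / card (rcosets H) \<ge>
    2 + relative_gradient p K1 H + relative_gradient p K2 H - log p (card (cocycles p B H)) / card (rcosets H)"
proof -
  note p = prime_gt_0_nat[OF assms(1)] prime_gt_1_nat[OF assms(1)]
  note H = normal_p_power_indexD[OF assms(1,2)]
  let ?N = "real (card (rcosets H))" and ?W = "pair_cocycles p K1 K2 B H"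
  obtain I where "coboundary B ` invariant_funs p H \<subseteq> I" and I: "I \<subseteq> cocycles p B H" "finite I"
    "card ?W * card I = card (cocycles p K1 H) * card (cocycles p K2 H)"
    by (rule card_pair_cocycles[OF p(1) sub(3,4,5,1,2) H(1) fin(1,2)])
  have Z: "card ?W > 0" "card (cocycles p K1 H) > 0" "card (cocycles p K2 H) > 0"
    using card_fun_group_pos[OF fun_group_cocycles] card_fun_group_pos[OF fun_group_pair_cocycles]
      fin card_pair_cocycles_empty(2)[OF fin(1,2)] by auto
  have I0: "card I > 0" using I(3) Z by (metis gr0I mult_is_0 not_less0)
  have "log p (card I) \<le> log p (card (cocycles p B H))"
    using card_mono[OF fin(3) I(1)] I0 p by simp
  moreover have "log p (card ?W) + log p (card I) =
      log p (card (cocycles p K1 H)) + log p (card (cocycles p K2 H))"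
  proof -
    have eq: "real (card ?W) * card I = real (card (cocycles p K1 H)) * card (cocycles p K2 H)"
      using I(3) by (metis of_nat_mult)
    show ?thesis using Z I0 arg_cong[OF eq, of "log p"] by (simp add: log_mult)
  qed
  ultimately have "log p (card (cocycles p K1 H)) + log p (card (cocycles p K2 H)) - log p (card (cocycles p B H))
      \<le> log p (card ?W)" by linarith
  then have "(log p (card (cocycles p K1 H)) + log p (card (cocycles p K2 H)) - log p (card (cocycles p B H))) / ?N
      \<le> log p (card ?W) / ?N" using H(3) by (intro divide_right_mono) auto
  then show ?thesis
    using log_card_cocycles_gradient[OF assms(1,2) sub(1) fin(1)] log_card_cocycles_gradient[OF assms(1,2) sub(2) fin(2)]
    by (simp add: add_divide_distrib diff_divide_distrib)
qed

lemma log_card_cocycles_amenable_le: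
  assumes "prime p" "H \<in> normal_p_power_index p G" "subgroup B G"
    and T: "finite T" "T \<subseteq> B" "generate G T = B"
    and F: "finite F" "F \<subseteq> B" "F \<noteq> {}" "k > 0" "\<And>s. s \<in> T \<Longrightarrow> k \<le> card {f\<in>F. s \<otimes> f \<in> F}"
    and sep: "\<And>f g. f \<in> F \<Longrightarrow> g \<in> F \<Longrightarrow> inv f \<otimes> g \<in> H \<Longrightarrow> f = g"
  shows "log p (card (cocycles p B H)) / card (rcosets H) \<le> (real (card F) - 1) / k"
proof -
  note p = prime_gt_0_nat[OF assms(1)] prime_gt_1_nat[OF assms(1)]
  note H = normal_p_power_indexD[OF assms(1,2)]
  let ?Z = "card (cocycles p B H)"
  have Z: "?Z > 0" by (rule card_fun_group_pos[OF fun_group_cocycles finite_cocycles[OF p(1) assms(3) H(1,2) T]])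
  have cF: "card F > 0" using F by (simp add: card_gt_0_iff)
  have "?Z ^ k \<le> p ^ ((card F - 1) * card (rcosets H))"
    by (rule card_cocycles_window_bound[OF p(1) assms(3) H(1,2) T F(1-3,5) sep])
  then have "real ?Z ^ k \<le> real p ^ ((card F - 1) * card (rcosets H))" by (metis of_nat_le_iff of_nat_power)
  then have "log p (real ?Z ^ k) \<le> log p (real p ^ ((card F - 1) * card (rcosets H)))"
    using Z p by (intro log_mono) auto
  then have "k * log p ?Z \<le> (real (card F) - 1) * card (rcosets H)"
    using Z p cF by (simp add: log_nat_power of_nat_diff)
  then show ?thesis using H(3) F(4) by (simp add: divide_simps mult.commute)
qed

theorem p_gradient_amalgamated_free_product:
  assumes "prime p" "is_amalgamated_free_product G K1 K2 A"
    and fg: "finitely_generated (G\<lparr>carrier := K1\<rparr>)" "finitely_generated (G\<lparr>carrier := K2\<rparr>)"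
      "finitely_generated G"
    and amen: "amenable (G\<lparr>carrier := A\<rparr>)"
    and L: "subgroup_lattice G L" "L \<subseteq> normal_p_power_index p G" "\<Inter>L = {\<one>}"
  shows "p_gradient p G L = p_gradient p (G\<lparr>carrier := K1\<rparr>) ((\<lambda>H. K1 \<inter> H) ` L) +
    p_gradient p (G\<lparr>carrier := K2\<rparr>) ((\<lambda>H. K2 \<inter> H) ` L) + inverse_order A"
proof -
  have sub: "subgroup K1 G" "subgroup K2 G" "subgroup A G" "A \<subseteq> K1" "A \<subseteq> K2"
    using assms(2) by (auto simp: is_amalgamated_free_product_def)
  interpret A: subgroup A G by fact
  interpret GA: group "G\<lparr>carrier := A\<rparr>" by (rule subgroup_imp_group[OF sub(3)])
  note p = prime_gt_0_nat[OF assms(1)]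
  have L0: "L \<noteq> {}" and LI: "\<And>H K. H \<in> L \<Longrightarrow> K \<in> L \<Longrightarrow> H \<inter> K \<in> L"
    using L(1) by (auto simp: subgroup_lattice_def)
  have LN: "H \<in> normal_p_power_index p G" if "H \<in> L" for H using L(2) that by blast
  define r where "r K = (INF H\<in>L. relative_gradient p K H)" for K
  have r_le: "r K \<le> relative_gradient p K H" if "H \<in> L" for K H
    unfolding r_def using that by (intro cINF_lower bdd_below_relative_gradient)
  have anti: "relative_gradient p K H' \<le> relative_gradient p K H"
    if "H \<in> L" "H' \<in> L" "H' \<subseteq> H" "subgroup K G" "finitely_generated (G\<lparr>carrier := K\<rparr>)" for K H H'
    using relative_gradient_antimono[OF assms(1) LN LN] that by blast
  have "r (carrier G) \<le> r K1 + r K2 + inverse_order A"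
  proof (rule field_le_epsilon)
    fix e :: real assume "e > 0"
    \<comment> \<open>One third for each of the two infima, and one for the reciprocal of the order
      of A.\<close>
    define \<eta> where "\<eta> = e / 3"
    have \<eta>: "\<eta> > 0" using \<open>e > 0\<close> by (simp add: \<eta>_def)
    have ex: "\<exists>H\<in>L. relative_gradient p K H < r K + \<eta>" for K
      using cINF_less_iff[OF L0 bdd_below_relative_gradient, of p K "r K + \<eta>"] \<eta> by (simp add: r_def)
    obtain H1 where H1: "H1 \<in> L" "relative_gradient p K1 H1 < r K1 + \<eta>" using ex by blast
    obtain H2 where H2: "H2 \<in> L" "relative_gradient p K2 H2 < r K2 + \<eta>" using ex by blast
    \<comment> \<open>\<open>F\<close> forces the index of A Int H to be large: it is all of A for
      finite A and a large subset otherwise, and [A : A Int H] >= |F| as soon as H separates the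
      elements of F.\<close>
    have "\<exists>F. finite F \<and> F \<subseteq> A \<and> F \<noteq> {} \<and> 1 / real (card F) \<le> inverse_order A + \<eta>"
    proof (cases "finite A")
      case True
      moreover have "A \<noteq> {}" using A.one_closed by blast
      ultimately show ?thesis using \<eta> by (intro exI[of _ A]) (auto simp: inverse_order_def)
    next
      case False
      obtain n where n: "1 / \<eta> < real n" using reals_Archimedean2 by blast
      obtain F where F: "finite F" "card F = n" "F \<subseteq> A" using infinite_arbitrarily_large[OF False] by blast
      have n0: "n > 0" using n \<eta> by (metis divide_pos_pos gr0I less_numeral_extra(1) not_less_iff_gr_or_eq of_nat_0 order_less_trans)
      then have "1 / real n \<le> \<eta>" using n \<eta> by (simp add: field_simps)
      then show ?thesis using F False n0 by (intro exI[of _ F]) (auto simp: inverse_order_def)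
    qed
    then obtain F where F: "finite F" "F \<subseteq> A" "F \<noteq> {}" "1 / real (card F) \<le> inverse_order A + \<eta>" by blast
    have "F \<subseteq> carrier G" using F(2) A.subset by blast
    then obtain H3 where H3: "H3 \<in> L" "\<And>f g H'. f \<in> F \<Longrightarrow> g \<in> F \<Longrightarrow> H' \<subseteq> H3 \<Longrightarrow> inv f \<otimes> g \<in> H' \<Longrightarrow> f = g"
      using lattice_separates[OF L(1,3) F(1)] by blast
    define H where "H = H1 \<inter> (H2 \<inter> H3)"
    have HL: "H \<in> L" using H1 H2 H3 LI by (auto simp: H_def)
    have Hs: "subgroup H G" using L(1) HL by (auto simp: subgroup_lattice_def)
    note AH = GA.normal_p_power_indexD[OF assms(1) normal_p_power_index_restrict[OF assms(1) LN[OF HL] sub(3)]]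
    have "card F \<le> card (rcosets\<^bsub>G\<lparr>carrier := A\<rparr>\<^esub> (A \<inter> H))"
      by (rule card_le_index_if_separated[OF sub(3) subgroups_Inter_pair[OF sub(3) Hs] AH(2) F(2)])
        (use H3(2)[of _ _ "A \<inter> H"] in \<open>auto simp: H_def\<close>)
    then have "1 / real (card (rcosets\<^bsub>G\<lparr>carrier := A\<rparr>\<^esub> (A \<inter> H))) \<le> 1 / real (card F)"
      using F(1,3) by (intro frac_le) (auto simp: card_gt_0_iff)
    then have "1 / real (card (rcosets\<^bsub>G\<lparr>carrier := A\<rparr>\<^esub> (A \<inter> H))) \<le> inverse_order A + \<eta>" using F(4) by linarith
    moreover have "relative_gradient p K1 H \<le> relative_gradient p K1 H1"
      by (rule anti[OF H1(1) HL _ sub(1) fg(1)]) (auto simp: H_def)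
    moreover have "relative_gradient p K2 H \<le> relative_gradient p K2 H2"
      by (rule anti[OF H2(1) HL _ sub(2) fg(2)]) (auto simp: H_def)
    ultimately show "r (carrier G) \<le> r K1 + r K2 + inverse_order A + e"
      using relative_gradient_amalgam_le[OF assms(1,2) LN[OF HL] fg] r_le[OF HL, of "carrier G"] H1(2) H2(2)
      by (simp add: \<eta>_def)
  qed
  moreover have "r K1 + r K2 + inverse_order A \<le> r (carrier G)"
    unfolding r_def[of "carrier G"]
  proof (rule cINF_greatest[OF L0])
    fix H assume HL: "H \<in> L"
    note HN = LN[OF HL]
    note finH = finite_cocycles_p[OF assms(1) HN sub(1) fg(1)] finite_cocycles_p[OF assms(1) HN sub(2) fg(2)]
    obtain T where T: "finite T" "T \<subseteq> A" "pair_cocycles p K1 K2 A H = pair_cocycles p K1 K2 (generate G T) H"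
      using pair_cocycles_finitely_generated[OF card_pair_cocycles_empty(2)[OF finH] sub(3)] by blast
    define B where "B = generate G T"
    have TB: "T \<subseteq> B" by (auto simp: B_def intro: generate.incl)
    have BA: "B \<subseteq> A" unfolding B_def by (rule generate_subgroup_incl[OF T(2) sub(3)])
    have BG: "subgroup B G" unfolding B_def using T(2) A.subset by (intro generate_is_subgroup) blast
    have amB: "amenable (G\<lparr>carrier := B\<rparr>)"
      using GA.amenable_subgroup[OF amen subgroup_incl[OF BG sub(3) BA]] by simp
    \<comment> \<open>Replacing A by B goes in the right direction: a smaller subgroup has at least
      as large a reciprocal order, and for infinite A the left side is 0.\<close>
    have ord: "inverse_order A \<le> inverse_order B"
    proof (cases "finite A")
      case True
      have "B \<noteq> {}" using subgroup.one_closed[OF BG] by blast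
      then have "0 < card B" using finite_subset[OF BA True] by (simp add: card_gt_0_iff)
      then show ?thesis
        using card_mono[OF True BA] unfolding inverse_order_def by (intro frac_le) auto
    qed (simp add: inverse_order_def)
    show "r K1 + r K2 + inverse_order A \<le> relative_gradient p (carrier G) H"
    proof (rule field_le_epsilon)
      fix \<eta> :: real assume \<eta>: "\<eta> > 0"
      obtain F k where F: "finite F" "F \<subseteq> B" "F \<noteq> {}" "k > 0" "\<And>s. s \<in> T \<Longrightarrow> k \<le> card {f\<in>F. s \<otimes> f \<in> F}"
        "(real (card F) - 1) / real k \<le> 1 - inverse_order B + \<eta>"
        using folner_ratio[OF amB BG T(1) TB \<eta>] by blast
      have "F \<subseteq> carrier G" using F(2) BA A.subset by blast
      then obtain H3 where H3: "H3 \<in> L" "\<And>f g H'. f \<in> F \<Longrightarrow> g \<in> F \<Longrightarrow> H' \<subseteq> H3 \<Longrightarrow> inv f \<otimes> g \<in> H' \<Longrightarrow> f = g"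
        using lattice_separates[OF L(1,3) F(1)] by blast
      \<comment> \<open>B belongs to H, but H need not separate the elements of F. The estimate is
        made at H' and transferred to H by the monotonicity of the fibre product over B.\<close>
      define H' where "H' = H \<inter> H3"
      have HL': "H' \<in> L" using HL H3 LI by (auto simp: H'_def)
      note HN' = LN[OF HL']
      note finH' = finite_cocycles_p[OF assms(1) HN' sub(1) fg(1)] finite_cocycles_p[OF assms(1) HN' sub(2) fg(2)]
      have finB: "finite (cocycles p B H')"
        using finite_cocycles[OF p BG normal_p_power_indexD(1,2)[OF assms(1) HN'] T(1) TB] by (simp add: B_def)
      have "2 + relative_gradient p K1 H' + relative_gradient p K2 H' - log p (card (cocycles p B H')) / card (rcosets H')
          \<le> log p (card (pair_cocycles p K1 K2 B H')) / card (rcosets H')"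
        using BA sub by (intro log_card_pair_cocycles_ge[OF assms(1) HN' sub(1,2) BG _ _ finH' finB]) auto
      also have "\<dots> \<le> log p (card (pair_cocycles p K1 K2 B H)) / card (rcosets H)"
        by (rule log_card_pair_cocycles_antimono[OF assms(1) HN HN' _ sub(1,2) finH' finH]) (auto simp: H'_def)
      \<comment> \<open>Here the choice of T for this particular H is used: at H, agreement on B is
        agreement on A.\<close>
      also have "\<dots> = log p (card (cocycles p (carrier G) H)) / card (rcosets H)"
        using card_cocycles_amalgamated_free_product[OF p assms(2) normal_p_power_indexD(1)[OF assms(1) HN]] T(3)
        by (simp add: B_def)
      also have "\<dots> = 1 + relative_gradient p (carrier G) H"
        using finite_cocycles_p[OF assms(1) HN subgroup_self] fg(3)
        by (intro log_card_cocycles_gradient[OF assms(1) HN subgroup_self]) simp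
      finally have "1 + relative_gradient p K1 H' + relative_gradient p K2 H' \<le>
          log p (card (cocycles p B H')) / card (rcosets H') + relative_gradient p (carrier G) H" by simp
      moreover have "log p (card (cocycles p B H')) / card (rcosets H') \<le> (real (card F) - 1) / k"
        by (rule log_card_cocycles_amenable_le[OF assms(1) HN' BG T(1) TB _ F(1-5)])
          (use H3(2)[of _ _ H'] in \<open>auto simp: B_def H'_def\<close>)
      ultimately show "r K1 + r K2 + inverse_order A \<le> relative_gradient p (carrier G) H + \<eta>"
        using F(6) ord r_le[OF HL', of K1] r_le[OF HL', of K2] by linarith
    qed
  qed
  moreover have "carrier G \<inter> H = H" if "H \<in> L" for H
    using L(1) that subgroup.subset by (auto simp: subgroup_lattice_def)
  then have "(\<lambda>H. carrier G \<inter> H) ` L = L" by simp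
  then have "p_gradient p G L = r (carrier G)"
    using p_gradient_eq_INF[of p "carrier G" L] by (simp add: r_def)
  ultimately show ?thesis unfolding p_gradient_eq_INF r_def[symmetric] by linarith
qed

text \<open>The subgroups K Int H are some of the normal subgroups of p-power index in K, and an
  infimum over fewer of them is at least as large.\<close>

lemma abs_p_gradient_le_p_gradient_restrict:
  assumes "prime p" "subgroup K G" "L \<noteq> {}" "L \<subseteq> normal_p_power_index p G"
  shows "abs_p_gradient p (G\<lparr>carrier := K\<rparr>) \<le> p_gradient p (G\<lparr>carrier := K\<rparr>) ((\<lambda>H. K \<inter> H) ` L)"
proof -
  interpret GK: group "G\<lparr>carrier := K\<rparr>" by (rule subgroup_imp_group[OF assms(2)])
  let ?f = "\<lambda>H. (real (d_p p (G\<lparr>carrier := K, carrier := H\<rparr>)) - 1) / real (card (rcosets\<^bsub>G\<lparr>carrier := K\<rparr>\<^esub> H))"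
  have sub: "(\<lambda>H. K \<inter> H) ` L \<subseteq> normal_p_power_index p (G\<lparr>carrier := K\<rparr>)"
    using normal_p_power_index_restrict[OF assms(1) _ assms(2)] assms(4) by blast
  have "?f H \<ge> - 1" if "H \<in> normal_p_power_index p (G\<lparr>carrier := K\<rparr>)" for H
  proof -
    have "H \<subseteq> K" using subgroup.subset[OF normal_imp_subgroup[OF GK.normal_p_power_indexD(1)[OF assms(1) that]]] by simp
    then show ?thesis using relative_gradient_ge[of p K H] by (simp add: relative_gradient_def Int_absorb1)
  qed
  then have "bdd_below (?f ` normal_p_power_index p (G\<lparr>carrier := K\<rparr>))" by (intro bdd_belowI2[of _ "- 1"])
  then show ?thesis
    unfolding abs_p_gradient_def p_gradient_def using assms(3) sub by (intro cINF_superset_mono) auto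
qed

end

theorem theorem5p2:
  fixes \<Gamma> :: "('a, 'm) monoid_scheme" and \<Gamma>1 \<Gamma>2 A :: "'a set" and p :: nat
  assumes "prime p"
    and "is_amalgamated_free_product \<Gamma> \<Gamma>1 \<Gamma>2 A"
    and "finitely_generated (\<Gamma>\<lparr>carrier := \<Gamma>1\<rparr>)"
    and "finitely_generated (\<Gamma>\<lparr>carrier := \<Gamma>2\<rparr>)"
    and "finitely_generated \<Gamma>"
    and "residually_p p \<Gamma>"
    and "amenable (\<Gamma>\<lparr>carrier := A\<rparr>)"
  shows "(\<forall>L. subgroup_lattice \<Gamma> L \<and> L \<subseteq> normal_p_power_index p \<Gamma> \<and> \<Inter> L = {\<one>\<^bsub>\<Gamma>\<^esub>} \<longrightarrow>
            p_gradient p \<Gamma> L =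
              p_gradient p (\<Gamma>\<lparr>carrier := \<Gamma>1\<rparr>) ((\<lambda>H. \<Gamma>1 \<inter> H) ` L) +
              p_gradient p (\<Gamma>\<lparr>carrier := \<Gamma>2\<rparr>) ((\<lambda>H. \<Gamma>2 \<inter> H) ` L) +
              inverse_order A) \<and>
         abs_p_gradient p \<Gamma> \<ge>
           abs_p_gradient p (\<Gamma>\<lparr>carrier := \<Gamma>1\<rparr>) + abs_p_gradient p (\<Gamma>\<lparr>carrier := \<Gamma>2\<rparr>) +
           inverse_order A"
proof -
  interpret group \<Gamma> using assms(2) by (simp add: is_amalgamated_free_product_def)
  have sub: "subgroup \<Gamma>1 \<Gamma>" "subgroup \<Gamma>2 \<Gamma>" using assms(2) by (auto simp: is_amalgamated_free_product_def)
  have main: "p_gradient p \<Gamma> L =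
      p_gradient p (\<Gamma>\<lparr>carrier := \<Gamma>1\<rparr>) ((\<lambda>H. \<Gamma>1 \<inter> H) ` L) +
      p_gradient p (\<Gamma>\<lparr>carrier := \<Gamma>2\<rparr>) ((\<lambda>H. \<Gamma>2 \<inter> H) ` L) + inverse_order A"
    if "subgroup_lattice \<Gamma> L" "L \<subseteq> normal_p_power_index p \<Gamma>" "\<Inter> L = {\<one>\<^bsub>\<Gamma>\<^esub>}" for L
    by (rule p_gradient_amalgamated_free_product[OF assms(1-5,7) that])
  let ?L = "normal_p_power_index p \<Gamma>"
  have L0: "?L \<noteq> {}" using carrier_in_normal_p_power_index by blast
  \<comment> \<open>The normal subgroups of p-power index themselves form a lattice, and being
    residually-p says that its intersection is trivial, so the equality applies to it.\<close>
  have "subgroup_lattice \<Gamma> ?L"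
    unfolding subgroup_lattice_def
    using L0 normal_p_power_index_Int[OF assms(1)] normal_imp_subgroup[OF normal_p_power_indexD(1)[OF assms(1)]]
    by blast
  then have "abs_p_gradient p \<Gamma> =
      p_gradient p (\<Gamma>\<lparr>carrier := \<Gamma>1\<rparr>) ((\<lambda>H. \<Gamma>1 \<inter> H) ` ?L) +
      p_gradient p (\<Gamma>\<lparr>carrier := \<Gamma>2\<rparr>) ((\<lambda>H. \<Gamma>2 \<inter> H) ` ?L) + inverse_order A"
    unfolding abs_p_gradient_def using assms(6) by (intro main) (auto simp: residually_p_def)
  then have "abs_p_gradient p \<Gamma> \<ge>
      abs_p_gradient p (\<Gamma>\<lparr>carrier := \<Gamma>1\<rparr>) + abs_p_gradient p (\<Gamma>\<lparr>carrier := \<Gamma>2\<rparr>) + inverse_order A"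
    using abs_p_gradient_le_p_gradient_restrict[OF assms(1) sub(1) L0 order_refl]
      abs_p_gradient_le_p_gradient_restrict[OF assms(1) sub(2) L0 order_refl] by linarith
  then show ?thesis using main by blast
qed

end
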